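(* Let $d>2$ and let $v$ be as in the context. There is $L_0$ depending only on $d$ and $v$ such that for every $\varepsilon>0$ there exist constants $K=K(\varepsilon)$ and $K_S=K_S(\varepsilon)$ (depending on $\varepsilon$, $d$, $v$, but not on $L$ or $x$) such that for all $L\ge L_0$ and all $x\in\mathbb{Z}^d$, $$\Big| S_1(x) - \delta_{0,x} - \frac{1}{\sigma^2}C_1(x)\Big| \le \frac{K}{L^{1-\varepsilon}\,|\!|\!|x|\!|\!|^{d-1}}$$ and $$S_1(x)\le \delta_{0,x} + K_S L^{-(2-\varepsilon)}\,|\!|\!|x|\!|\!|^{-(d-2)} .$$
   Context: Notation: $|x|$ is the Euclidean norm, $|\!|\!|x|\!|\!|=\max\{|x|,1\}$, $\mathbb{T}^d=(\mathbb{R}/2\pi\mathbb{Z})^d$ is identified with $(-\pi,\pi]^d$, and $\hat f(k)=\sum_{x\in\mathbb{Z}^d} f(x)e^{ik\cdot x}$ for $f:\mathbb{Z}^d\to\mathbb{R}$. A function is $\mathbb{Z}^d$-symmetric if it is invariant under reflection in coordinate hyperplanes and rotation by $\pi/2$. Definition of $D$: let $v:\mathbb{R}^d\to[0,\infty)$ be bounded, $\mathbb{Z}^d$-symmetric, supported in $[-1,1]^d$, with $\frac{\partial^d v}{\partial x_1\cdots\partial x_d}$ piecewise continuous and $\int_{[-1,1]^d}v(x)\,dx=1$. For $L\ge L_0$, $D:\mathbb{Z}^d\to[0,1]$ is $D(x)=v(x/L)/\sum_{y\in\mathbb{Z}^d}v(y/L)$; $L_0\ge 1$ is large enough (depending only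 on $d,v$) that the denominator is nonzero. Let $\sigma^2=\sum_{x\in\mathbb{Z}^d}|x|^2D(x)$. Green functions: $S_1(x)=\int_{\mathbb{T}^d}\frac{e^{-ik\cdot x}}{1-\hat D(k)}\frac{dk}{(2\pi)^d}$ is the critical spread-out Green function, and $C_1(x)=\int_{\mathbb{T}^d}\frac{e^{-ik\cdot x}}{1-\hat P(k)}\frac{dk}{(2\pi)^d}$, with $P(x)=\frac{1}{2d}\mathbf{1}_{|x|=1}$, is the critical nearest-neighbour Green function. *)

theory Defs
  imports "HOL-Analysis.Analysis" "HOL-Library.Disjoint_Sets"
begin

section \<open>The lattice, symmetry, and Fourier transform\<close>

text \<open>
  The dimension is \<open>d = CARD('n)\<close>; the lattice \<open>\<int>\<^sup>d\<close> is the type \<open>int ^ 'n\<close>, and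
  \<open>lat\<close> is its inclusion into \<open>\<real>\<^sup>d\<close>.
\<close>

definition lat :: "int ^ 'n \<Rightarrow> real ^ 'n::finite" where
  "lat x = (\<chi> i. real_of_int (x $ i))"

definition tnorm :: "real ^ 'n::finite \<Rightarrow> real" where
  "tnorm x = max (norm x) 1"

definition torus :: "(real ^ 'n::finite) set" where
  "torus = {k. \<forall>i. - pi < k $ i \<and> k $ i \<le> pi}"

definition reflect :: "'n \<Rightarrow> real ^ 'n \<Rightarrow> real ^ 'n::finite" where
  "reflect i x = (\<chi> l. if l = i then - x $ l else x $ l)"

text \<open>Rotation by \<open>\<pi>/2\<close> in the coordinate plane spanned by the axes \<open>i \<noteq> j\<close>.\<close>

definition rotate_plane :: "'n \<Rightarrow> 'n \<Rightarrow> real ^ 'n \<Rightarrow> real ^ 'n::finite" where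
  "rotate_plane i j x = (\<chi> l. if l = i then - x $ j else if l = j then x $ i else x $ l)"

definition lattice_symmetric :: "(real ^ 'n::finite \<Rightarrow> 'a) \<Rightarrow> bool" where
  "lattice_symmetric f \<longleftrightarrow>
     (\<forall>i x. f (reflect i x) = f x) \<and>
     (\<forall>i j x. i \<noteq> j \<longrightarrow> f (rotate_plane i j x) = f x)"

definition fourier :: "(int ^ 'n \<Rightarrow> real) \<Rightarrow> real ^ 'n::finite \<Rightarrow> complex" where
  "fourier f k = (\<Sum>\<^sub>\<infinity>x. of_real (f x) * exp (\<i> * of_real (k \<bullet> lat x)))"

section \<open>The profile \<open>v\<close>\<close>

definition has_partial ::
  "'n \<Rightarrow> (real ^ 'n \<Rightarrow> real) \<Rightarrow> (real ^ 'n \<Rightarrow> real) \<Rightarrow> (real ^ 'n::finite) set \<Rightarrow> bool" where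
  "has_partial i f g U \<longleftrightarrow>
     (\<forall>x\<in>U. ((\<lambda>t. f (x + t *\<^sub>R axis i 1)) has_real_derivative g x) (at 0))"

text \<open>
  \<open>has_mixed_partial [i\<^sub>1, \<dots>, i\<^sub>m] f g U\<close>: on the open set \<open>U\<close> the iterated partial derivative
  of \<open>f\<close>, taken successively in the coordinates \<open>i\<^sub>1\<close>, \<open>i\<^sub>2\<close>, and so on, exists and equals \<open>g\<close>.
\<close>

primrec has_mixed_partial ::
  "'n list \<Rightarrow> (real ^ 'n \<Rightarrow> real) \<Rightarrow> (real ^ 'n \<Rightarrow> real) \<Rightarrow> (real ^ 'n::finite) set \<Rightarrow> bool" where
  "has_mixed_partial [] f g U \<longleftrightarrow> (\<forall>x\<in>U. g x = f x)"
| "has_mixed_partial (i # is) f g U \<longleftrightarrow>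
     (\<exists>h. has_partial i f h U \<and> has_mixed_partial is h g U)"

text \<open>
  Piecewise continuity of \<open>\<partial>\<^sup>d v / \<partial>x\<^sub>1 \<dots> \<partial>x\<^sub>d\<close>: the space is divided into finitely many
  domains with null boundaries; inside each of them \<open>v\<close> is continuous and the mixed derivative
  exists, in every order of differentiation, and extends continuously up to the boundary.
  On the boundaries of the pieces \<open>v\<close> may jump, so that \<open>v = 2\<^sup>-\<^sup>d\<close> on \<open>[-1,1]\<^sup>d\<close> qualifies.
  Continuity of \<open>v\<close> itself has to be required, because a continuous mixed derivative alone does
  not control functions of fewer than \<open>d\<close> of the variables (which it annihilates).
\<close>

definition mixed_derivative_piecewise_continuous :: "(real ^ 'n::finite \<Rightarrow> real) \<Rightarrow> bool" where
  "mixed_derivative_piecewise_continuous v \<longleftrightarrow>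
     (\<exists>\<U>. finite \<U> \<and> disjoint \<U> \<and>
          (\<forall>U\<in>\<U>. open U \<and> connected U \<and> negligible (frontier U)) \<and>
          (\<Union>U\<in>\<U>. closure U) = UNIV \<and>
          (\<forall>U\<in>\<U>. continuous_on U v \<and>
             (\<exists>w. continuous_on (closure U) w \<and>
                (\<forall>is. distinct is \<and> set is = UNIV \<longrightarrow> has_mixed_partial is v w U))))"

definition spread_out_profile :: "(real ^ 'n::finite \<Rightarrow> real) \<Rightarrow> bool" where
  "spread_out_profile v \<longleftrightarrow>
     (\<forall>x. 0 \<le> v x) \<and>
     bounded (range v) \<and>
     lattice_symmetric v \<and>
     (\<forall>x. x \<notin> cbox (- 1) 1 \<longrightarrow> v x = 0) \<and>
     mixed_derivative_piecewise_continuous v \<and>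
     (v has_integral 1) (cbox (- 1) 1)"

section \<open>Step distributions and Green functions\<close>

definition profile_sum :: "(real ^ 'n::finite \<Rightarrow> real) \<Rightarrow> real \<Rightarrow> real" where
  "profile_sum v L = (\<Sum>\<^sub>\<infinity>y::int ^ 'n. v (lat y /\<^sub>R L))"

definition spread_out_step :: "(real ^ 'n::finite \<Rightarrow> real) \<Rightarrow> real \<Rightarrow> int ^ 'n \<Rightarrow> real" where
  "spread_out_step v L x = v (lat x /\<^sub>R L) / profile_sum v L"

definition nearest_neighbour_step :: "int ^ 'n::finite \<Rightarrow> real" where
  "nearest_neighbour_step x = (if norm (lat x) = 1 then 1 / (2 * real CARD('n)) else 0)"

definition variance :: "(int ^ 'n::finite \<Rightarrow> real) \<Rightarrow> real" where
  "variance f = (\<Sum>\<^sub>\<infinity>x. (norm (lat x))\<^sup>2 * f x)"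

definition green_integral :: "(int ^ 'n::finite \<Rightarrow> real) \<Rightarrow> int ^ 'n \<Rightarrow> complex" where
  "green_integral f x =
     (LINT k:torus|lborel.
        exp (- \<i> * of_real (k \<bullet> lat x)) / (1 - fourier f k)) / (2 * of_real pi) ^ CARD('n)"

text \<open>
  For even, finitely supported \<open>f\<close>, as are all step distributions considered here, the integral is real
  (\<open>green_integral_real\<close>), so that taking the real part only changes the type.
\<close>

definition green :: "(int ^ 'n::finite \<Rightarrow> real) \<Rightarrow> int ^ 'n \<Rightarrow> real" where
  "green f x = Re (green_integral f x)"

lemma lat_minus: "lat (- x) = - lat x"
  by (simp add: lat_def vec_eq_iff)

lemma fourier_cnj: "fourier f (- k) = cnj (fourier f k)"
  unfolding fourier_def by (subst infsum_cnj[symmetric]) (simp add: exp_cnj)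

lemma fourier_measurable:
  assumes "finite {x. f x \<noteq> 0}"
  shows "fourier f \<in> borel_measurable borel"
proof -
  have "fourier f = (\<lambda>k. \<Sum>x | f x \<noteq> 0. of_real (f x) * exp (\<i> * of_real (k \<bullet> lat x)))"
  proof
    fix k
    have "fourier f k =
        (\<Sum>\<^sub>\<infinity>x\<in>{x. f x \<noteq> 0}. of_real (f x) * exp (\<i> * of_real (k \<bullet> lat x)))"
      unfolding fourier_def by (rule infsum_cong_neutral) auto
    then show "fourier f k =
        (\<Sum>x | f x \<noteq> 0. of_real (f x) * exp (\<i> * of_real (k \<bullet> lat x)))"
      using assms by simp
  qed
  then show ?thesis
    by (auto intro!: borel_measurable_continuous_onI continuous_intros)
qed

lemma torus_measurable: "(torus :: (real ^ 'n::finite) set) \<in> sets borel"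
proof -
  have "(torus :: (real ^ 'n) set) = (\<Inter>i. {k. - pi < k $ i} \<inter> {k. k $ i \<le> pi})"
    by (auto simp: torus_def)
  also have "\<dots> \<in> sets borel"
    by (intro sets.finite_INT sets.Int borel_open borel_closed open_Collect_less
        closed_Collect_le continuous_intros) auto
  finally show ?thesis .
qed

lemma lborel_distr_uminus_euclidean:
  "distr lborel borel uminus = (lborel :: 'a::euclidean_space measure)"
  using lborel_affine[of "- 1" "0 :: 'a"] by (simp add: density_1)

lemma AE_torus_uminus:
  "AE k in lborel. - k \<in> torus \<longleftrightarrow> k \<in> (torus :: (real ^ 'n::finite) set)"
proof -
  have "AE k in lborel. (k :: real ^ 'n) \<bullet> axis i 1 \<noteq> c" for i c
    by (rule AE_lborel_inner_neq) (auto simp: axis_in_Basis_iff)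
  then have "AE k in lborel. \<forall>i. (k :: real ^ 'n) $ i \<noteq> pi \<and> k $ i \<noteq> - pi"
    by (simp add: AE_all_countable inner_axis)
  then show ?thesis
  proof eventually_elim
    case (elim k)
    have "(- pi < - k $ i \<and> - k $ i \<le> pi) \<longleftrightarrow> (- pi < k $ i \<and> k $ i \<le> pi)" for i
      using elim[rule_format, of i] by linarith
    then show ?case by (simp add: torus_def)
  qed
qed

lemma green_integral_real:
  fixes f :: "int ^ 'n::finite \<Rightarrow> real"
  assumes even: "\<And>x. f (- x) = f x" and fin: "finite {x. f x \<noteq> 0}"
  shows "green_integral f x = of_real (green f x)"
proof -
  define g where "g = (\<lambda>k. exp (- \<i> * of_real (k \<bullet> lat x)) / (1 - fourier f k))"
  define G where "G = (LINT k:torus|lborel. g k)"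
  have [measurable]: "fourier f \<in> borel_measurable borel" "torus \<in> sets (borel :: (real ^ 'n) measure)"
    using fin by (auto intro: fourier_measurable torus_measurable)
  have [measurable]: "(\<lambda>k. exp (- \<i> * of_real (k \<bullet> lat x))) \<in> borel_measurable borel"
    by (intro borel_measurable_continuous_onI continuous_intros)
  have g [measurable]: "g \<in> borel_measurable borel"
    unfolding g_def by measurable
  have refl: "g (- k) = cnj (g k)" for k
    unfolding g_def by (simp add: fourier_cnj exp_cnj)
  have "G = (LINT k|distr lborel borel uminus. indicator torus k *\<^sub>R g k)"
    by (simp add: G_def set_lebesgue_integral_def lborel_distr_uminus_euclidean)
  also have "\<dots> = (LINT k|lborel. indicator torus (- k) *\<^sub>R g (- k))"
    by (intro integral_distr) auto
  also have "\<dots> = (LINT k|lborel. cnj (indicator torus k *\<^sub>R g k))"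
  proof (rule integral_cong_AE)
    show "AE k in lborel. indicator torus (- k) *\<^sub>R g (- k) = cnj (indicator torus k *\<^sub>R g k)"
      using AE_torus_uminus by eventually_elim (auto simp: refl indicator_def)
  qed (auto simp flip: refl)
  also have "\<dots> = cnj G"
    unfolding G_def set_lebesgue_integral_def by (rule Bochner_Integration.integral_cnj)
  finally have "G \<in> \<real>"
    by (simp add: Reals_cnj_iff)
  then have "green_integral f x \<in> \<real>"
    unfolding green_integral_def G_def g_def by (intro Reals_divide Reals_power Reals_mult) auto
  then show ?thesis
    by (simp add: green_def)
qed

end

theory Submission
  imports Defs "HOL-Complex_Analysis.Cauchy_Integral_Theorem"
begin

text \<open>
  Write \<open>d = CARD('n)\<close>, \<open>u\<close> for the transform of the spread-out step \<open>D\<close> and \<open>w\<close> for that of the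
  nearest-neighbour step. Since \<open>1 / (1 - u) = 1 + u + u\<^sup>2 / (1 - u)\<close> and the first two terms
  are transforms of the unit mass at the origin and of \<open>D\<close>, whose size is known, the first
  estimate is a bound on the Fourier coefficients of the symbol \<open>u\<^sup>2 / (1 - u) - 1 / (\<sigma>\<^sup>2 (1 -
  w))\<close>.

  The properties of \<open>D\<close> that enter are collected in \<open>step_kernel\<close>: it lives on \<open>|x\<^sub>i| \<le> L\<close>, has
  density at most \<open>b / L\<^sup>d\<close>, is symmetric, and satisfies the infrared bound \<open>1 - u(k) \<ge> c min(1,
  L\<^sup>2 |k|\<^sup>2)\<close> with \<open>c\<close> independent of \<open>L\<close>. Near the origin the quadratic parts of \<open>1 - u\<close> and
  \<open>\<sigma>\<^sup>2 (1 - w)\<close> cancel, so the symbol is bounded there. Away from the origin \<open>|u|\<^sup>2\<close> has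
  integral of order \<open>L\<^sup>-\<^sup>d\<close> by Parseval, because \<open>\<Sum> D\<^sup>2 \<le> max D\<close>; this is the reason for
  splitting off the first two terms of the geometric series.

  Decay in \<open>x\<close> comes from analyticity instead of derivatives. Let \<open>x\<^sub>j\<close> be the largest component
  of \<open>x\<close> and \<open>k'\<close> the part of \<open>k\<close> orthogonal to the axis \<open>j\<close>. For fixed \<open>k' \<noteq> 0\<close> the symbol is
  periodic and analytic in \<open>k\<^sub>j\<close> in a strip of width proportional to \<open>min(|k'|, 1/L)\<close>,
  respectively \<open>|k'|\<close> for the nearest-neighbour part. Moving the contour inside this strip
  produces a factor \<open>exp (- \<rho> |x\<^sub>j| |k'|)\<close>, and what is left has an integral over \<open>k\<^sub>j\<close> of order
  \<open>1 / L\<close> (\<open>averaged_error_bound\<close>). The integral of the exponential over the \<open>d - 1\<close> components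
  of \<open>k'\<close> is of order \<open>|x\<^sub>j|\<^sup>-\<^sup>(\<^sup>d\<^sup>-\<^sup>1\<^sup>)\<close> (\<open>error_fourier_decay\<close>). The one exception is the
  spread-out part where \<open>|k'| > 1/L\<close>; it carries the factor \<open>exp (- \<rho> |x\<^sub>j| / L)\<close> only, but its
  integral is of order \<open>L\<^sup>-\<^sup>d\<close>. The singularity of the symbol at \<open>k = 0\<close> is invisible, as it
  lies over the single point \<open>k' = 0\<close>.

  The second estimate follows from the first and from the cruder bound \<open>|S(x) - \<delta>| = O(L\<^sup>-\<^sup>d)\<close>:
  these two at the scale \<open>L = |x|\<close> give \<open>C(x) = O(|x|\<^sup>2\<^sup>-\<^sup>d)\<close> for the nearest-neighbour Green
  function (\<open>green_estimates\<close>).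

  It remains to verify the infrared bound for \<open>D\<close>. The profile is continuous outside a null set,
  so Riemann sums converge and translations by a small multiple of \<open>L\<close> change \<open>D\<close> little in
  \<open>\<ell>\<^sup>1\<close>. This gives \<open>|u(k)| \<le> 1/2\<close> as soon as some \<open>L |k\<^sub>j|\<close> is large (\<open>fourier_half_bound\<close>).
  Smaller \<open>k\<close> are reduced to this case by doubling, since \<open>1 - cos 2t \<le> 4 (1 - cos t)\<close>.
\<close>

section \<open>Averaging over one coordinate of the torus\<close>

definition upd :: "real ^ 'n \<Rightarrow> 'n \<Rightarrow> real \<Rightarrow> real ^ 'n::finite" where
  "upd k j s = (\<chi> l. if l = j then s else k $ l)"

lemma upd_nth [simp]: "upd k j s $ l = (if l = j then s else k $ l)"
  by (simp add: upd_def)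

lemma borel_measurable_vec_lambda:
  assumes "\<And>i. (\<lambda>x. f x i) \<in> borel_measurable M"
  shows "(\<lambda>x. (\<chi> i. f x i) :: real ^ 'n) \<in> M \<rightarrow>\<^sub>M (borel :: (real ^ 'n::finite) measure)"
  by (rule borel_measurable_euclidean_space[THEN iffD2])
     (use assms in \<open>auto simp: Basis_vec_def inner_axis\<close>)

lemma measurable_upd [measurable]:
  assumes "f \<in> borel_measurable M" "g \<in> borel_measurable M"
  shows "(\<lambda>x. upd (f x) j (g x)) \<in> M \<rightarrow>\<^sub>M (borel :: (real ^ 'n::finite) measure)"
  unfolding upd_def
proof (rule borel_measurable_vec_lambda)
  fix i
  have "(\<lambda>x. f x $ i) \<in> borel_measurable M"
    using assms(1) by (intro borel_measurable_continuous_on[of "\<lambda>y. y $ i"] continuous_intros)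
  then show "(\<lambda>x. if i = j then g x else f x $ i) \<in> borel_measurable M"
    using assms(2) by (cases "i = j") auto
qed

lemma emeasure_lborel_box_vec:
  fixes a b :: "real ^ 'n::finite"
  assumes "\<And>i. a $ i \<le> b $ i"
  shows "emeasure lborel (box a b) = ennreal (\<Prod>i\<in>UNIV. b $ i - a $ i)"
proof -
  have "emeasure lborel (box a b) = ennreal (\<Prod>e\<in>Basis. (b - a) \<bullet> e)"
    using assms by (intro emeasure_lborel_box) (auto simp: Basis_vec_def inner_axis)
  also have "(\<Prod>e\<in>Basis. (b - a) \<bullet> e) = (\<Prod>i\<in>UNIV. (b - a) \<bullet> axis i 1)"
    by (subst Basis_vec_def, simp add: UNION_singleton_eq_range,
        subst prod.reindex) (auto simp: inj_on_def axis_eq_axis)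
  finally show ?thesis by (simp add: inner_axis)
qed

lemma emeasure_lborel_box_vec_real:
  fixes a b :: "real ^ 'n::finite" and s t :: real
  assumes "\<And>i. a $ i \<le> b $ i" "s \<le> t"
  shows "emeasure lborel (box (a, s) (b, t)) = ennreal ((\<Prod>i\<in>UNIV. b $ i - a $ i) * (t - s))"
proof -
  have "box (a, s) (b, t) = box a b \<times> box s t"
    by (auto simp: box_def Basis_prod_def)
  then have "emeasure lborel (box (a, s) (b, t)) = emeasure (lborel \<Otimes>\<^sub>M lborel) (box a b \<times> box s t)"
    by (simp add: lborel_prod)
  also have "\<dots> = emeasure lborel (box a b) * emeasure lborel (box s t)"
    by (intro lborel.emeasure_pair_measure_Times) auto
  finally show ?thesis
    using assms by (simp add: emeasure_lborel_box_vec ennreal_mult prod_nonneg)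
qed

definition swap :: "'n \<Rightarrow> (real ^ 'n) \<times> real \<Rightarrow> (real ^ 'n::finite) \<times> real" where
  "swap j = (\<lambda>(k, s). (upd k j s, k $ j))"

lemma measurable_swap [measurable]: "swap j \<in> borel \<rightarrow>\<^sub>M borel"
  unfolding swap_def case_prod_beta
  by (intro borel_measurable_Pair measurable_upd borel_measurable_continuous_onI continuous_intros)

text \<open>
  The image of a box is the box with the side along the axis \<open>j\<close> and the side of the auxiliary
  variable exchanged, which has the same volume.
\<close>

lemma distr_swap: "distr lborel borel (swap j) = (lborel :: ((real ^ 'n::finite) \<times> real) measure)"
proof (rule lborel_eqI[symmetric])
  fix l u :: "(real ^ 'n) \<times> real"
  assume le: "\<And>b. b \<in> Basis \<Longrightarrow> l \<bullet> b \<le> u \<bullet> b"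
  obtain a s b t where lu: "l = (a, s)" "u = (b, t)" by (metis surj_pair)
  have ab: "a $ i \<le> b $ i" for i
    using le[of "(axis i 1, 0)"] by (auto simp: lu Basis_prod_def Basis_vec_def inner_axis)
  have st: "s \<le> t"
    using le[of "(0, 1)"] by (auto simp: lu Basis_prod_def)
  have pre: "swap j -` box l u = box (upd a j s, a $ j) (upd b j t, b $ j)"
    unfolding lu
    by (auto simp: swap_def mem_box Basis_prod_def Basis_vec_def inner_axis split: if_splits)
  have "emeasure (distr lborel borel (swap j)) (box l u) = emeasure lborel (swap j -` box l u)"
    by (subst emeasure_distr) auto
  also have "\<dots> = ennreal ((\<Prod>i\<in>UNIV. upd b j t $ i - upd a j s $ i) * (b $ j - a $ j))"
    unfolding pre using ab st by (intro emeasure_lborel_box_vec_real) auto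
  also have "(\<Prod>i\<in>UNIV. upd b j t $ i - upd a j s $ i) * (b $ j - a $ j)
       = (\<Prod>i\<in>UNIV. b $ i - a $ i) * (t - s)"
    by (subst (1 2) prod.remove[of UNIV j]) (auto simp: mult_ac)
  also have "ennreal \<dots> = emeasure lborel (box l u)"
    unfolding lu using ab st by (rule emeasure_lborel_box_vec_real[symmetric])
  also have "\<dots> = ennreal (\<Prod>b\<in>Basis. (u - l) \<bullet> b)"
    using le by (rule emeasure_lborel_box)
  finally show "emeasure (distr lborel borel (swap j)) (box l u) = ennreal (\<Prod>b\<in>Basis. (u - l) \<bullet> b)" .
qed simp

abbreviation circ :: "real set" where "circ \<equiv> {- pi<..pi}"

lemma torus_upd: "upd k j s \<in> torus \<and> k $ j \<in> circ \<longleftrightarrow> k \<in> torus \<and> s \<in> circ"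
  by (auto simp: torus_def split: if_splits)

declare torus_measurable [measurable]

text \<open>
  Fubini's theorem for the coordinate \<open>j\<close>. The average over the coordinate remains a function on
  the whole torus, constant in \<open>k\<^sub>j\<close>, so that no splitting of the index type is needed; the
  price is the factor \<open>2\<pi>\<close> from the idle coordinate.
\<close>

lemma nn_integral_torus_average:
  fixes h :: "real ^ 'n::finite \<Rightarrow> ennreal"
  assumes [measurable]: "h \<in> borel_measurable borel"
  shows "2 * pi * (\<integral>\<^sup>+k\<in>torus. h k \<partial>lborel)
    = (\<integral>\<^sup>+k\<in>torus. (\<integral>\<^sup>+s\<in>circ. h (upd k j s) \<partial>lborel) \<partial>lborel)"
proof -
  define H where "H = (\<lambda>(k, s). h k * indicator torus k * indicator circ (s::real))"
  have H [measurable]: "H \<in> borel_measurable borel"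
    unfolding H_def borel_prod[symmetric] by measurable
  have "2 * pi * (\<integral>\<^sup>+k\<in>torus. h k \<partial>lborel) = (\<integral>\<^sup>+k. \<integral>\<^sup>+s. H (k, s) \<partial>lborel \<partial>lborel)"
    by (simp add: H_def nn_integral_cmult nn_integral_multc mult.commute[of _ "ennreal (2 * pi)"])
  also have "\<dots> = (\<integral>\<^sup>+x. H x \<partial>(lborel \<Otimes>\<^sub>M lborel))"
    by (rule lborel.nn_integral_fst) (simp add: lborel_prod)
  also have "\<dots> = (\<integral>\<^sup>+x. H x \<partial>(distr lborel borel (swap j)))"
    by (simp add: lborel_prod distr_swap)
  also have "\<dots> = (\<integral>\<^sup>+x. H (swap j x) \<partial>lborel)"
    by (rule nn_integral_distr) auto
  also have "\<dots> = (\<integral>\<^sup>+k. \<integral>\<^sup>+s. H (swap j (k, s)) \<partial>lborel \<partial>lborel)"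
    unfolding lborel_prod[symmetric]
    by (rule lborel.nn_integral_fst[symmetric]) (simp add: lborel_prod)
  also have "\<dots> = (\<integral>\<^sup>+k. \<integral>\<^sup>+s. (h (upd k j s) * indicator circ s) * indicator torus k \<partial>lborel \<partial>lborel)"
    using torus_upd[of _ j] by (intro nn_integral_cong) (auto simp: H_def swap_def indicator_def)
  also have "\<dots> = (\<integral>\<^sup>+k\<in>torus. (\<integral>\<^sup>+s\<in>circ. h (upd k j s) \<partial>lborel) \<partial>lborel)"
    by (intro nn_integral_cong nn_integral_multc) measurable
  finally show ?thesis .
qed

lemma integral_torus_average:
  fixes h :: "real ^ 'n::finite \<Rightarrow> complex"
  assumes "set_integrable lborel torus h"
  shows "2 * pi * (LINT k:torus|lborel. h k)
      = (LINT k:torus|lborel. (LINT s:circ|lborel. h (upd k j s)))"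
    and "set_integrable lborel torus (\<lambda>k. (LINT s:circ|lborel. h (upd k j s)))"
proof -
  define H where "H = (\<lambda>(k, s). indicator circ (s::real) *\<^sub>R (indicator torus k *\<^sub>R h k))"
  have hi: "integrable lborel (\<lambda>k. indicator torus k *\<^sub>R h k)"
    using assms by (simp add: set_integrable_def)
  have ci: "integrable lborel (\<lambda>s. indicator circ s :: real)"
    by (intro integrable_real_indicator) auto
  have "integrable (lborel \<Otimes>\<^sub>M lborel) H"
  proof (rule lborel_pair.Fubini_integrable)
    show "H \<in> borel_measurable (lborel \<Otimes>\<^sub>M lborel)"
      unfolding H_def using hi[THEN borel_measurable_integrable] by measurable
    have "(\<lambda>x. LINT y|lborel. norm (H (x, y))) = (\<lambda>x. (2 * pi) * norm (indicator torus x *\<^sub>R h x))"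
      by (auto simp: H_def)
    moreover have "integrable lborel (\<lambda>x. (2 * pi) * norm (indicator torus x *\<^sub>R h x))"
      using hi by (intro integrable_mult_right integrable_norm)
    ultimately show "integrable lborel (\<lambda>x. LINT y|lborel. norm (H (x, y)))" by simp
    show "AE x in lborel. integrable lborel (\<lambda>y. H (x, y))"
      unfolding H_def using ci by auto
  qed
  then have HI: "integrable lborel H" by (simp add: lborel_prod)
  then have [measurable]: "H \<in> borel_measurable borel" by auto
  have HS: "integrable (lborel \<Otimes>\<^sub>M lborel) (\<lambda>x. H (swap j x))"
    using HI integrable_distr_eq[of "swap j" lborel borel H]
    by (simp add: distr_swap lborel_prod)
  have eq: "H (swap j (k, s)) = indicator torus k *\<^sub>R indicator circ s *\<^sub>R h (upd k j s)" for k s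
    using torus_upd[of k j s] by (auto simp: H_def swap_def indicator_def)
  have "2 * pi * (LINT k:torus|lborel. h k) = (LINT k|lborel. LINT s|lborel. H (k, s))"
  proof -
    have "(LINT s|lborel. H (k, s)) = 2 * pi * (indicator torus k *\<^sub>R h k)" for k
      by (simp add: H_def scaleR_conv_of_real)
    then show ?thesis by (simp only: set_lebesgue_integral_def integral_mult_right_zero)
  qed
  also have "\<dots> = integral\<^sup>L (lborel \<Otimes>\<^sub>M lborel) H"
    using \<open>integrable (lborel \<Otimes>\<^sub>M lborel) H\<close> by (simp add: lborel_pair.integral_fst')
  also have "\<dots> = integral\<^sup>L (distr lborel borel (swap j)) H"
    by (simp add: lborel_prod distr_swap)
  also have "\<dots> = (LINT x|lborel. H (swap j x))"
    by (rule integral_distr) auto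
  also have "\<dots> = (LINT k|lborel. LINT s|lborel. H (swap j (k, s)))"
    using lborel_pair.integral_fst'[OF HS] by (simp add: lborel_prod)
  also have "\<dots> = (LINT k:torus|lborel. (LINT s:circ|lborel. h (upd k j s)))"
    unfolding eq set_lebesgue_integral_def by (simp del: scaleR_scaleR)
  finally show "2 * pi * (LINT k:torus|lborel. h k)
      = (LINT k:torus|lborel. (LINT s:circ|lborel. h (upd k j s)))" .
  have "integrable lborel (\<lambda>k. LINT s|lborel. H (swap j (k, s)))"
    using lborel_pair.integrable_fst'[OF HS] .
  then show "set_integrable lborel torus (\<lambda>k. (LINT s:circ|lborel. h (upd k j s)))"
    unfolding eq set_integrable_def set_lebesgue_integral_def by (simp del: scaleR_scaleR)
qed

section \<open>One-dimensional integrals and contour shifts\<close>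

lemma set_lebesgue_integral_circ:
  fixes f :: "real \<Rightarrow> complex"
  assumes "continuous_on {- pi..pi} f"
  shows "(LINT s:circ|lborel. f s) = integral {- pi..pi} f"
    and "set_integrable lborel circ f"
proof -
  have 1: "set_integrable lborel {- pi..pi} f"
    by (rule borel_integrable_atLeastAtMost') fact
  then show "set_integrable lborel circ f"
    by (rule set_integrable_subset) auto
  have "(LINT s:circ|lborel. f s) = (LINT s:{- pi..pi}|lborel. f s)"
  proof (rule set_integral_cong_set)
    show "set_borel_measurable lborel {- pi..pi} f" "set_borel_measurable lborel circ f"
      using 1 \<open>set_integrable lborel circ f\<close>
      by (auto simp: set_borel_measurable_def set_integrable_def dest: borel_measurable_integrable)
    show "AE s in lborel. s \<in> {- pi..pi} \<longleftrightarrow> s \<in> circ"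
      using AE_lborel_singleton[of "- pi"] by eventually_elim auto
  qed
  also have "\<dots> = integral {- pi..pi} f"
    using 1 by (rule set_borel_integral_eq_integral(2))
  finally show "(LINT s:circ|lborel. f s) = integral {- pi..pi} f" .
qed

text \<open>
  A primitive \<open>g\<close> of \<open>G\<close> exists because the strip is convex. By periodicity \<open>g(z + 2\<pi>) - g(z)\<close>
  has derivative zero, and its constant value is the integral of \<open>G\<close> over every horizontal
  period.
\<close>

lemma contour_shift:
  fixes G :: "complex \<Rightarrow> complex"
  assumes diff: "\<And>z. \<bar>Im z\<bar> \<le> \<bar>r\<bar> \<Longrightarrow> G field_differentiable at z"
    and per: "\<And>z. G (z + 2 * complex_of_real pi) = G z"
  shows "(LINT s:circ|lborel. G (of_real s)) = (LINT s:circ|lborel. G (of_real s - \<i> * of_real r))"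
proof -
  define S where "S = {z. \<bar>Im z\<bar> \<le> \<bar>r\<bar>}"
  have S: "convex S"
  proof -
    have "S = {z. Im z \<le> \<bar>r\<bar>} \<inter> {z. Im z \<ge> - \<bar>r\<bar>}" by (auto simp: S_def)
    then show ?thesis by (auto intro: convex_Int convex_halfspace_Im_le convex_halfspace_Im_ge)
  qed
  have diffS: "G field_differentiable at z" if "z \<in> S" for z
    using diff that by (auto simp: S_def)
  have cont: "continuous_on S G"
    by (rule continuous_at_imp_continuous_on)
       (auto intro: field_differentiable_imp_continuous_at diffS)
  obtain g where g: "\<And>z. z \<in> S \<Longrightarrow> (g has_field_derivative G z) (at z within S)"
    using holomorphic_convex_primitive[of S "{}" G] S cont diffS interior_subset by blast
  have shift: "z + 2 * complex_of_real pi \<in> S \<longleftrightarrow> z \<in> S" for z by (auto simp: S_def)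
  have "\<exists>c. \<forall>z\<in>S. g (z + 2 * pi) - g z = c"
  proof (rule has_field_derivative_zero_constant[OF S])
    fix z assume z: "z \<in> S"
    have im: "(\<lambda>z. z + 2 * complex_of_real pi) ` S \<subseteq> S" by (auto simp: S_def)
    have "(g \<circ> (\<lambda>z. z + 2 * complex_of_real pi) has_field_derivative G (z + 2 * complex_of_real pi) * 1)
        (at z within S)"
    proof (rule DERIV_image_chain)
      show "(g has_field_derivative G (z + 2 * complex_of_real pi))
          (at (z + 2 * complex_of_real pi) within (\<lambda>z. z + 2 * complex_of_real pi) ` S)"
        by (rule DERIV_subset[OF g im]) (use shift z in blast)
      show "((\<lambda>z. z + 2 * complex_of_real pi) has_field_derivative 1) (at z within S)"
        by (rule DERIV_cong[OF DERIV_add[OF DERIV_ident DERIV_const]]) simp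
    qed
    moreover have "G (z + 2 * complex_of_real pi) = G z"
      using per[of z] by simp
    ultimately have "((\<lambda>z. g (z + 2 * pi)) has_field_derivative G z) (at z within S)"
      by (simp add: o_def)
    from DERIV_diff[OF this g[OF z]]
    show "((\<lambda>z. g (z + 2 * pi) - g z) has_field_derivative 0) (at z within S)"
      by simp
  qed
  then obtain c where c: "\<And>z. z \<in> S \<Longrightarrow> g (z + 2 * pi) - g z = c" by blast
  have "(LINT s:circ|lborel. G (of_real s - \<i> * of_real y)) = c" if "\<bar>y\<bar> \<le> \<bar>r\<bar>" for y
  proof -
    let ?p = "\<lambda>s. of_real s - \<i> * of_real y :: complex"
    have pS: "?p s \<in> S" for s using that by (auto simp: S_def)
    have "((\<lambda>s. G (?p s)) has_integral (g (?p pi) - g (?p (- pi)))) {- pi..pi}"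
    proof (rule fundamental_theorem_of_calculus)
      fix s assume "s \<in> {- pi..pi}"
      have "((g \<circ> ?p) has_vector_derivative 1 * G (?p s)) (at s within {- pi..pi})"
      proof (rule field_vector_diff_chain_within)
        show "(?p has_vector_derivative 1) (at s within {- pi..pi})"
          by (auto intro!: derivative_eq_intros)
        show "(g has_field_derivative G (?p s)) (at (?p s) within ?p ` {- pi..pi})"
          by (rule DERIV_subset[OF g]) (use pS in auto)
      qed
      then show "((\<lambda>s. g (?p s)) has_vector_derivative G (?p s)) (at s within {- pi..pi})"
        by (simp add: o_def)
    qed simp
    moreover have "g (?p pi) - g (?p (- pi)) = c"
      using c[OF pS[of "- pi"]] by (simp add: algebra_simps)
    moreover have "continuous_on {- pi..pi} (\<lambda>s. G (?p s))"
      using pS by (intro continuous_on_compose2[OF cont] continuous_intros) auto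
    ultimately show ?thesis
      using set_lebesgue_integral_circ(1) by (simp add: integral_unique)
  qed
  from this[of 0] this[of r] show ?thesis by simp
qed

lemma integral_circ_exp:
  "(LINT s:circ|lborel. exp (\<i> * of_real (s * of_int m))) = (if m = 0 then 2 * of_real pi else 0)"
proof -
  have 1: "(LINT s:circ|lborel. exp (\<i> * of_real (s * of_int m)))
     = integral {- pi..pi} (\<lambda>s. exp (\<i> * of_real (s * of_int m)))"
    by (rule set_lebesgue_integral_circ) (intro continuous_intros)
  show ?thesis
  proof (cases "m = 0")
    case True
    then show ?thesis using 1 by (simp add: scaleR_conv_of_real)
  next
    case False
    let ?F = "\<lambda>s. exp (\<i> * of_real (s * of_int m)) / (\<i> * of_int m)"
    have "((\<lambda>s. exp (\<i> * of_real (s * of_int m))) has_integral ?F pi - ?F (- pi)) {- pi..pi}"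
    proof (rule fundamental_theorem_of_calculus)
      fix s
      have "((\<lambda>z. exp (\<i> * (z * of_int m)) / (\<i> * of_int m)) has_field_derivative
          exp (\<i> * (of_real s * of_int m))) (at (of_real s))"
        using False by (auto intro!: derivative_eq_intros simp: field_simps)
      from has_vector_derivative_real_field[OF this]
      show "(?F has_vector_derivative exp (\<i> * of_real (s * of_int m))) (at s within {- pi..pi})"
        by simp
    qed simp
    moreover have "exp (\<i> * of_real (pi * of_int m)) = exp (\<i> * of_real (- pi * of_int m))"
    proof -
      have "exp (\<i> * of_real (pi * of_int m)) = exp (\<i> * of_real (- pi * of_int m)
          + 2 * of_int m * pi * \<i>)"
        by (simp add: algebra_simps)
      also have "\<dots> = exp (\<i> * of_real (- pi * of_int m))"
        unfolding exp_eq by (intro exI[of _ m]) simp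
      finally show ?thesis .
    qed
    ultimately show ?thesis using 1 False by (simp add: integral_unique)
  qed
qed

lemma nn_integral_circ_arctan:
  assumes "a > 0"
  shows "(\<integral>\<^sup>+s\<in>circ. ennreal (1 / (1 + a\<^sup>2 * s\<^sup>2)) \<partial>lborel) \<le> ennreal (pi / a)"
proof -
  have pos: "1 + a\<^sup>2 * s\<^sup>2 > 0" for s :: real
    by (smt (verit) zero_le_mult_iff zero_le_power2)
  have "(\<integral>\<^sup>+s\<in>circ. ennreal (1 / (1 + a\<^sup>2 * s\<^sup>2)) \<partial>lborel)
      \<le> (\<integral>\<^sup>+s. ennreal (1 / (1 + a\<^sup>2 * s\<^sup>2)) * indicator {- pi..pi} s \<partial>lborel)"
    by (intro nn_integral_mono) (auto simp: indicator_def)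
  also have "\<dots> = ennreal (arctan (a * pi) / a - arctan (a * (- pi)) / a)"
  proof (rule nn_integral_FTC_Icc)
    fix x :: real
    show "((\<lambda>x. arctan (a * x) / a) has_real_derivative 1 / (1 + a\<^sup>2 * x\<^sup>2)) (at x)"
    proof -
      have "((\<lambda>x. arctan (a * x) / a) has_real_derivative (a * inverse (1 + (a * x)\<^sup>2)) / a) (at x)"
        by (auto intro!: derivative_eq_intros)
      then show ?thesis using assms by (simp add: power_mult_distrib inverse_eq_divide)
    qed
  qed (use pos[THEN less_imp_le] in auto)
  also have "\<dots> \<le> ennreal (pi / a)"
  proof (rule ennreal_leI)
    have "arctan (a * pi) - arctan (a * (- pi)) \<le> pi"
      using arctan_ubound[of "a * pi"] by (simp add: arctan_minus)
    then show "arctan (a * pi) / a - arctan (a * (- pi)) / a \<le> pi / a"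
      using assms by (simp add: divide_simps)
  qed
  finally show ?thesis .
qed

lemma nn_integral_powr_cutoff:
  assumes a: "- 1 < a" and L: "L > 0"
  shows "(\<integral>\<^sup>+s. ennreal ((L * \<bar>s\<bar>) powr a) * indicator {- 1 / L..1 / L} s \<partial>lborel)
     = ennreal (2 / ((a + 1) * L))"
proof -
  have R: "((\<lambda>s. s powr a) has_integral ((1 / L) powr (a + 1) / (a + 1))) {0..1 / L}"
    using a L by (intro has_integral_powr_from_0) auto
  have R1: "((\<lambda>s. \<bar>s\<bar> powr a) has_integral ((1 / L) powr (a + 1) / (a + 1))) {0..1 / L}"
    by (rule has_integral_eq[OF _ R]) auto
  have "((\<lambda>s. \<bar>- s\<bar> powr a) has_integral ((1 / L) powr (a + 1) / (a + 1))) {- (1 / L)..- 0}"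
    using R1 by (subst has_integral_reflect_real)
  then have L1: "((\<lambda>s. \<bar>s\<bar> powr a) has_integral ((1 / L) powr (a + 1) / (a + 1))) {- 1 / L..0}"
    by simp
  have "((\<lambda>s. \<bar>s\<bar> powr a) has_integral
      ((1 / L) powr (a + 1) / (a + 1) + (1 / L) powr (a + 1) / (a + 1))) {- 1 / L..1 / L}"
    by (rule has_integral_combine[OF _ _ L1 R1]) (use L in auto)
  then have "((\<lambda>s. L powr a * \<bar>s\<bar> powr a) has_integral
      (L powr a * ((1 / L) powr (a + 1) / (a + 1) + (1 / L) powr (a + 1) / (a + 1)))) {- 1 / L..1 / L}"
    by (rule has_integral_mult_right)
  also have "(\<lambda>s. L powr a * \<bar>s\<bar> powr a) = (\<lambda>s. (L * \<bar>s\<bar>) powr a)"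
    using L by (simp add: powr_mult)
  also have "L powr a * ((1 / L) powr (a + 1) / (a + 1) + (1 / L) powr (a + 1) / (a + 1)) = 2 / ((a
      + 1) * L)"
  proof -
    have "L powr a * (1 / L) powr (a + 1) = 1 / L"
      using L by (simp add: powr_divide powr_add)
    then have "L powr a * ((1 / L) powr (a + 1) / (a + 1) + (1 / L) powr (a + 1) / (a + 1))
        = 1 / L / (a + 1) + 1 / L / (a + 1)"
      by (simp only: distrib_left times_divide_eq_right)
    also have "\<dots> = 2 / ((a + 1) * L)"
      using a L by (simp add: divide_simps)
    finally show ?thesis .
  qed
  finally have "((\<lambda>s. if s \<in> {- 1 / L..1 / L} then (L * \<bar>s\<bar>) powr a else 0) has_integral
      2 / ((a + 1) * L)) UNIV"
    unfolding has_integral_restrict_UNIV .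
  also have "(\<lambda>s. if s \<in> {- 1 / L..1 / L} then (L * \<bar>s\<bar>) powr a else 0)
      = (\<lambda>s. indicator {- 1 / L..1 / L} s * (L * \<bar>s\<bar>) powr a)"
    by (auto simp: indicator_def)
  finally have "integral\<^sup>N lborel (\<lambda>s. indicator {- 1 / L..1 / L} s * ((L * \<bar>s\<bar>) powr a))
      = ennreal (2 / ((a + 1) * L))"
    by (intro nn_integral_has_integral_lborel) auto
  then show ?thesis
    by (simp add: ennreal_mult' mult.commute ennreal_indicator)
qed

lemma nn_integral_lborel_vec_prod:
  fixes f :: "'n::finite \<Rightarrow> real \<Rightarrow> ennreal"
  assumes [measurable]: "\<And>i. f i \<in> borel_measurable borel"
  shows "(\<integral>\<^sup>+k. (\<Prod>i\<in>UNIV. f i (k $ i)) \<partial>lborel) = (\<Prod>i\<in>UNIV. (\<integral>\<^sup>+s. f i s \<partial>lborel))"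
proof -
  define ix :: "real ^ 'n \<Rightarrow> 'n" where "ix b = (THE i. b = axis i 1)" for b
  have ix: "ix (axis i 1) = i" for i unfolding ix_def by (auto simp: axis_eq_axis)
  have B: "(Basis :: (real ^ 'n) set) = range (\<lambda>i. axis i 1)"
    by (auto simp: Basis_vec_def)
  have inj: "inj (\<lambda>i. axis i 1 :: real ^ 'n)" by (auto simp: inj_on_def axis_eq_axis)
  have "(\<integral>\<^sup>+k. (\<Prod>b\<in>Basis. f (ix b) (k \<bullet> b)) \<partial>lborel)
      = (\<Prod>b\<in>(Basis :: (real ^ 'n) set). (\<integral>\<^sup>+s. f (ix b) s \<partial>lborel))"
    by (rule nn_integral_lborel_prod) auto
  then show ?thesis
    unfolding B by (subst (asm) (1 2) prod.reindex[OF inj]) (simp add: ix inner_axis)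
qed

section \<open>Step kernels and their tilts\<close>

definition lbox :: "real \<Rightarrow> (int ^ 'n::finite) set" where
  "lbox L = {x. \<forall>i. \<bar>real_of_int (x $ i)\<bar> \<le> L}"

lemma vec_box_card:
  fixes S :: "'n::finite \<Rightarrow> int set"
  assumes "\<And>i. finite (S i)"
  shows "finite {x :: int ^ 'n. \<forall>i. x $ i \<in> S i}"
    and "card {x :: int ^ 'n. \<forall>i. x $ i \<in> S i} = (\<Prod>i\<in>UNIV. card (S i))"
proof -
  have "bij_betw vec_lambda (\<Pi>\<^sub>E i\<in>UNIV. S i) {x :: int ^ 'n. \<forall>i. x $ i \<in> S i}"
    by (rule bij_betw_byWitness[where f' = vec_nth]) (auto simp: vec_lambda_inverse)
  from bij_betw_finite[OF this] bij_betw_same_card[OF this]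
  show "finite {x :: int ^ 'n. \<forall>i. x $ i \<in> S i}"
    and "card {x :: int ^ 'n. \<forall>i. x $ i \<in> S i} = (\<Prod>i\<in>UNIV. card (S i))"
    using assms by (auto simp: card_PiE finite_PiE)
qed

lemma abs_le_int_iff: "\<bar>real_of_int m\<bar> \<le> L \<longleftrightarrow> m \<in> {- \<lfloor>L\<rfloor>..\<lfloor>L\<rfloor>}"
proof -
  have "m \<le> \<lfloor>L\<rfloor> \<longleftrightarrow> of_int m \<le> L" "- m \<le> \<lfloor>L\<rfloor> \<longleftrightarrow> of_int (- m) \<le> L"
    by (rule le_floor_iff)+
  then show ?thesis by auto
qed

lemma card_floor_interval: "L \<ge> 1 \<Longrightarrow> real (card {- \<lfloor>L\<rfloor>..\<lfloor>L\<rfloor>}) \<le> 3 * L"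
proof -
  assume L: "L \<ge> 1"
  have "real (card {- \<lfloor>L\<rfloor>..\<lfloor>L\<rfloor>}) = of_int (2 * \<lfloor>L\<rfloor> + 1)"
    using L by (simp add: le_floor_iff)
  also have "\<dots> \<le> 2 * L + 1" using of_int_floor_le[of L] by simp
  finally show ?thesis using L by linarith
qed

lemma finite_lbox [simp]: "finite (lbox L)"
  unfolding lbox_def abs_le_int_iff by (rule vec_box_card) auto

lemma card_lbox_slice:
  assumes "L \<ge> 1"
  shows "real (card {x \<in> (lbox L :: (int ^ 'n::finite) set). x $ j = m}) \<le> (3 * L) ^ (CARD('n) - 1)"
proof -
  define S where "S = (\<lambda>i. if i = j then {m} else {- \<lfloor>L\<rfloor>..\<lfloor>L\<rfloor>})"
  have "{x \<in> (lbox L :: (int ^ 'n) set). x $ j = m} \<subseteq> {x. \<forall>i. x $ i \<in> S i}"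
    unfolding lbox_def abs_le_int_iff by (auto simp: S_def)
  then have "card {x \<in> (lbox L :: (int ^ 'n) set). x $ j = m} \<le> card {x :: int ^ 'n. \<forall>i. x $ i \<in> S i}"
    by (intro card_mono vec_box_card) (auto simp: S_def)
  also have "\<dots> = (\<Prod>i\<in>UNIV. card (S i))"
    by (rule vec_box_card) (auto simp: S_def)
  also have "\<dots> = (\<Prod>i\<in>UNIV - {j}. card {- \<lfloor>L\<rfloor>..\<lfloor>L\<rfloor>})"
    by (subst prod.remove[of UNIV j]) (auto simp: S_def)
  finally have "real (card {x \<in> (lbox L :: (int ^ 'n) set). x $ j = m})
      \<le> real (card {- \<lfloor>L\<rfloor>..\<lfloor>L\<rfloor>} ^ (CARD('n) - 1))"
    by (simp add: card_Diff_singleton del: card_atLeastAtMost_int)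
  also have "\<dots> \<le> (3 * L) ^ (CARD('n) - 1)"
    unfolding of_nat_power using card_floor_interval[OF assms] by (rule power_mono) simp
  finally show ?thesis .
qed

lemma uminus_lbox: "- x \<in> lbox L \<longleftrightarrow> x \<in> lbox L"
  by (simp add: lbox_def)

lemma sum_lbox_uminus: "(\<Sum>x\<in>lbox L. g (- x)) = (\<Sum>x\<in>lbox L. g x)"
  by (rule sum.reindex_bij_witness[of _ uminus uminus]) (auto simp: uminus_lbox)

lemma fourier_lbox:
  assumes "\<And>x. x \<notin> lbox L \<Longrightarrow> f x = 0"
  shows "fourier f k = (\<Sum>x\<in>lbox L. of_real (f x) * exp (\<i> * of_real (k \<bullet> lat x)))"
proof -
  have "fourier f k = (\<Sum>\<^sub>\<infinity>x\<in>lbox L. of_real (f x) * exp (\<i> * of_real (k \<bullet> lat x)))"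
    unfolding fourier_def by (rule infsum_cong_neutral) (use assms in auto)
  then show ?thesis by simp
qed

lemma inner_lat: "k \<bullet> lat x = (\<Sum>i\<in>UNIV. k $ i * real_of_int (x $ i))"
  by (simp add: inner_vec_def lat_def)

lemma norm_lat_lbox:
  fixes x :: "int ^ 'n::finite" and L :: real
  assumes "x \<in> lbox L"
  shows "norm (lat x) \<le> real CARD('n) * L"
proof -
  have "norm (lat x) \<le> (\<Sum>i\<in>UNIV. \<bar>lat x $ i\<bar>)" by (rule norm_le_l1_cart)
  also have "\<dots> \<le> (\<Sum>i\<in>(UNIV :: 'n set). L)"
    using assms by (intro sum_mono) (auto simp: lat_def lbox_def)
  finally show ?thesis by simp
qed

lemma variance_lbox:
  assumes "\<And>x. x \<notin> lbox L \<Longrightarrow> f x = 0"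
  shows "variance f = (\<Sum>x\<in>lbox L. (norm (lat x))\<^sup>2 * f x)"
proof -
  have "variance f = (\<Sum>\<^sub>\<infinity>x\<in>lbox L. (norm (lat x))\<^sup>2 * f x)"
    unfolding variance_def by (rule infsum_cong_neutral) (use assms in auto)
  then show ?thesis by simp
qed

text \<open>
  The hypotheses under which the Green function is estimated; the constants obtained depend on
  the kernel through \<open>b\<close> and \<open>c\<close> only. The spread-out steps satisfy them for all large \<open>L\<close> with
  common \<open>b\<close> and \<open>c\<close>, and the nearest-neighbour step satisfies them with \<open>L = 1\<close>. The last
  clause is the infrared bound.
\<close>

definition step_kernel :: "real \<Rightarrow> real \<Rightarrow> real \<Rightarrow> (int ^ 'n::finite \<Rightarrow> real) \<Rightarrow> bool" where
  "step_kernel b c L D \<longleftrightarrow>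
     1 \<le> L \<and> 0 < c \<and> (\<forall>x. 0 \<le> D x) \<and> (\<forall>x. D x \<le> b / L ^ CARD('n)) \<and>
     (\<forall>x. x \<notin> lbox L \<longrightarrow> D x = 0) \<and> (\<Sum>x\<in>lbox L. D x) = 1 \<and>
     (\<exists>u. lattice_symmetric u \<and> D = u \<circ> lat) \<and>
     (\<forall>k. (\<forall>i. \<bar>k $ i\<bar> \<le> pi) \<longrightarrow> c * min 1 (L\<^sup>2 * (norm k)\<^sup>2) \<le> 1 - Re (fourier D k))"

lemma
  assumes "step_kernel b c L (D :: int ^ 'n::finite \<Rightarrow> real)"
  shows kernel_scale: "1 \<le> L" and kernel_c: "0 < c"
    and kernel_nonneg: "\<And>x. 0 \<le> D x" and kernel_le: "\<And>x. D x \<le> b / L ^ CARD('n)"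
    and kernel_supp: "\<And>x. x \<notin> lbox L \<Longrightarrow> D x = 0" and kernel_sum: "(\<Sum>x\<in>lbox L. D x) = 1"
    and kernel_infrared: "\<And>k. (\<And>i. \<bar>k $ i\<bar> \<le> pi) \<Longrightarrow> c * min 1 (L\<^sup>2 * (norm k)\<^sup>2) \<le> 1 - Re (fourier D k)"
  using assms unfolding step_kernel_def by auto

lemma kernel_bound_nonneg:
  fixes D :: "int ^ 'a::finite \<Rightarrow> real" and L :: real
  assumes K: "step_kernel b c L D"
  shows "0 \<le> b"
proof -
  have "0 \<le> b / L ^ CARD('a)" using kernel_nonneg[OF K] kernel_le[OF K] order_trans by blast
  moreover have "0 < L ^ CARD('a)" using kernel_scale[OF K] by simp
  ultimately show ?thesis by (auto simp: zero_le_divide_iff)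
qed

text \<open>
  The point reflection is the product of the reflections in all coordinates.
\<close>

lemma lattice_symmetric_uminus:
  fixes u :: "real ^ 'n::finite \<Rightarrow> 'a"
  assumes "lattice_symmetric u"
  shows "u (- x) = u x"
proof -
  have "u (\<chi> l. if l \<in> A then - x $ l else x $ l) = u x" if "finite A" for A :: "'n set"
    using that
  proof induction
    case empty
    then show ?case by (simp add: vec_nth_inverse)
  next
    case (insert i A)
    have "(\<chi> l. if l \<in> insert i A then - x $ l else x $ l)
        = reflect i (\<chi> l. if l \<in> A then - x $ l else x $ l)"
      using insert by (auto simp: reflect_def vec_eq_iff)
    then show ?case using assms insert by (simp add: lattice_symmetric_def)
  qed
  from this[of UNIV] show ?thesis by (simp add: uminus_vec_def)
qed

lemma kernel_even:
  assumes "step_kernel b c L D"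
  shows "D (- x) = D x"
  using assms lattice_symmetric_uminus by (auto simp: step_kernel_def lat_minus)

text \<open>
  A reflection in one coordinate changes the sign of the mixed moments, and a quarter turn
  exchanges two diagonal ones.
\<close>

lemma kernel_second_moments:
  assumes K: "step_kernel b c L (D :: int ^ 'n::finite \<Rightarrow> real)"
  shows "(\<Sum>x\<in>lbox L. D x * (real_of_int (x $ i) * real_of_int (x $ j)))
    = (if i = j then variance D / CARD('n) else 0)"
proof -
  obtain u where u: "lattice_symmetric u" "D = u \<circ> lat"
    using K by (auto simp: step_kernel_def)
  define m where "m i j = (\<Sum>x\<in>lbox L. D x * (real_of_int (x $ i) * real_of_int (x $ j)))" for i j
  have off: "m i j = 0" if "i \<noteq> j" for i j
  proof -
    define R where "R x = (\<chi> l. if l = i then - x $ l else x $ l)" for x :: "int ^ 'n"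
    have RR: "R (R x) = x" for x by (simp add: R_def vec_eq_iff)
    have lR: "lat (R x) = reflect i (lat x)" for x
      by (auto simp: R_def lat_def reflect_def vec_eq_iff)
    have RL: "R x \<in> lbox L \<longleftrightarrow> x \<in> lbox L" for x by (auto simp: R_def lbox_def)
    have DR: "D (R x) = D x" for x
      using u by (simp add: lR lattice_symmetric_def)
    have "m i j = (\<Sum>x\<in>lbox L. D (R x) * (real_of_int (R x $ i) * real_of_int (R x $ j)))"
      unfolding m_def by (rule sum.reindex_bij_witness[of _ R R]) (auto simp: RR RL)
    also have "\<dots> = - m i j"
    proof -
      have "R x $ i = - x $ i" "R x $ j = x $ j" for x using that by (auto simp: R_def)
      then show ?thesis by (simp add: DR m_def sum_negf)
    qed
    finally show ?thesis by simp
  qed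
  have diag: "m i i = m j j" for i j
  proof (cases "i = j")
    case False
    define R where "R x = (\<chi> l. if l = i then - x $ j else if l = j then x $ i else x $ l)"
        for x :: "int ^ 'n"
    define R' where "R' x = (\<chi> l. if l = i then x $ j else if l = j then - x $ i else x $ l)"
        for x :: "int ^ 'n"
    have RR: "R (R' x) = x" "R' (R x) = x" for x
      using False by (auto simp: R_def R'_def vec_eq_iff)
    have lR: "lat (R x) = rotate_plane i j (lat x)" for x
      by (auto simp: R_def lat_def rotate_plane_def vec_eq_iff)
    have RL: "R x \<in> lbox L" if "x \<in> lbox L" for x using that by (auto simp: R_def lbox_def)
    have RL': "R' x \<in> lbox L" if "x \<in> lbox L" for x using that by (auto simp: R'_def lbox_def)
    have DR: "D (R x) = D x" for x
      using u False by (simp add: lR lattice_symmetric_def)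
    have "m i i = (\<Sum>x\<in>lbox L. D (R x) * (real_of_int (R x $ i) * real_of_int (R x $ i)))"
      unfolding m_def by (rule sum.reindex_bij_witness[of _ R R']) (auto simp: RR RL RL')
    also have "\<dots> = m j j"
    proof -
      have "R x $ i = - x $ j" for x by (simp add: R_def)
      then show ?thesis by (simp add: DR m_def)
    qed
    finally show ?thesis .
  qed simp
  have "variance D = (\<Sum>x\<in>lbox L. \<Sum>l\<in>UNIV. D x * (real_of_int (x $ l) * real_of_int (x $ l)))"
    by (subst variance_lbox[of L, OF kernel_supp[OF K]])
       (auto simp: lat_def power2_norm_eq_inner inner_vec_def sum_distrib_left mult_ac intro!: sum.cong)
  also have "\<dots> = (\<Sum>l\<in>UNIV. m l l)"
    unfolding m_def by (rule sum.swap)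
  also have "\<dots> = (\<Sum>l\<in>(UNIV::'n set). m i i)"
    by (intro sum.cong refl diag)
  finally have "variance D = CARD('n) * m i i" by simp
  then show ?thesis using off[of i j] by (auto simp: m_def field_simps)
qed

lemma kernel_quadratic_form:
  fixes w :: "'n::finite \<Rightarrow> complex"
  assumes K: "step_kernel b c L D"
  shows "(\<Sum>x\<in>lbox L. of_real (D x) * (\<Sum>i\<in>UNIV. w i * of_int (x $ i))\<^sup>2)
    = of_real (variance D / CARD('n)) * (\<Sum>i\<in>UNIV. (w i)\<^sup>2)"
proof -
  have "(\<Sum>x\<in>lbox L. of_real (D x) * (\<Sum>i\<in>UNIV. w i * of_int (x $ i))\<^sup>2)
     = (\<Sum>x\<in>lbox L. \<Sum>i\<in>UNIV. \<Sum>j\<in>UNIV. w i * w j * of_real (D x * (real_of_int (x $ i) * real_of_int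
         (x $ j))))"
    by (simp add: power2_eq_square sum_product sum_distrib_left mult_ac)
  also have "\<dots> = (\<Sum>i\<in>UNIV. \<Sum>x\<in>lbox L. \<Sum>j\<in>UNIV. w i * w j * of_real (D x * (real_of_int (x $ i) *
      real_of_int (x $ j))))"
    by (rule sum.swap)
  also have "\<dots> = (\<Sum>i\<in>UNIV. \<Sum>j\<in>UNIV. \<Sum>x\<in>lbox L. w i * w j * of_real (D x * (real_of_int (x $ i) *
      real_of_int (x $ j))))"
    by (intro sum.cong refl sum.swap)
  also have "\<dots> = (\<Sum>i\<in>UNIV. \<Sum>j\<in>UNIV. w i * w j * of_real (if i = j then variance D / CARD('n) else 0))"
    unfolding kernel_second_moments[OF K, symmetric] of_real_sum sum_distrib_left ..
  also have "\<dots> = (\<Sum>i\<in>UNIV. w i * w i * of_real (variance D / CARD('n)))"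
    by (intro sum.cong refl) (simp add: if_distrib cong: if_cong)
  finally show ?thesis by (simp add: power2_eq_square sum_distrib_left mult_ac)
qed

text \<open>
  The Fourier transform of \<open>tilt j r f\<close> at \<open>k\<close> is that of \<open>f\<close> at the complex point \<open>k - \<i> r
  e\<^sub>j\<close>.
\<close>

definition tilt :: "'n \<Rightarrow> real \<Rightarrow> (int ^ 'n \<Rightarrow> real) \<Rightarrow> int ^ 'n::finite \<Rightarrow> real" where
  "tilt j r f x = f x * exp (r * real_of_int (x $ j))"

lemma tilt_0 [simp]: "tilt j 0 f = f"
  by (simp add: tilt_def fun_eq_iff)

lemma fourier_tilt:
  assumes K: "step_kernel b c L D"
  shows "fourier (tilt j r D) k
     = (\<Sum>x\<in>lbox L. of_real (D x) * exp (\<i> * (of_real (k \<bullet> lat x) - \<i> * of_real (r * real_of_int (x $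
         j)))))"
proof -
  have "fourier (tilt j r D) k = (\<Sum>x\<in>lbox L. of_real (tilt j r D x) * exp (\<i> * of_real (k \<bullet> lat x)))"
    by (rule fourier_lbox) (simp add: tilt_def kernel_supp[OF K])
  also have "\<dots> = (\<Sum>x\<in>lbox L. of_real (D x) * exp (\<i> * (of_real (k \<bullet> lat x) - \<i> * of_real (r *
      real_of_int (x $ j)))))"
    by (intro sum.cong refl) (simp add: tilt_def algebra_simps exp_add flip: exp_of_real)
  finally show ?thesis .
qed

lemma cosh_quadratic_bound:
  fixes u :: real
  assumes "\<bar>u\<bar> \<le> 1"
  shows "(exp u + exp (- u)) / 2 \<le> 1 + u\<^sup>2"
proof -
  have "(exp u + exp (- u)) / 2 \<le> 1 + u\<^sup>2" if "0 \<le> u" "u \<le> 1" for u :: real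
  proof -
    have "exp (- u) = 1 / exp u" by (simp add: exp_minus inverse_eq_divide)
    also have "\<dots> \<le> 1 / (1 + u)"
      using that exp_ge_add_one_self[of u] by (intro divide_left_mono) auto
    also have "\<dots> \<le> 1 - u + u\<^sup>2"
    proof -
      have "(1 - u + u\<^sup>2) * (1 + u) = 1 + u ^ 3"
          by (simp add: algebra_simps power2_eq_square power3_eq_cube)
      then show ?thesis using that by (simp add: divide_le_eq)
    qed
    finally show ?thesis using exp_bound[OF that] by simp
  qed
  from this[of u] this[of "- u"] assms show ?thesis by (cases "0 \<le> u") (auto simp: add.commute)
qed

text \<open>
  By evenness the real part of the tilted transform is \<open>\<Sum> D(x) cosh (r x\<^sub>j) cos (k \<bullet> x)\<close>. As
  \<open>cosh t - 1 \<le> t\<^sup>2\<close> for \<open>|t| \<le> 1\<close>, the tilt costs at most \<open>(r L)\<^sup>2\<close> in the infrared bound,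
  which is at most half of it under the smallness assumption.
\<close>

lemma kernel_tilt_infrared:
  assumes K: "step_kernel b c L D" and r: "\<bar>r\<bar> * L \<le> 1"
    and small: "(r * L)\<^sup>2 \<le> c / 2 * min 1 (L\<^sup>2 * (norm k)\<^sup>2)" and k: "\<And>i. \<bar>k $ i\<bar> \<le> pi"
  shows "c / 2 * min 1 (L\<^sup>2 * (norm k)\<^sup>2) \<le> Re (1 - fourier (tilt j r D) k)"
proof -
  let ?c = "\<lambda>x. (exp (r * real_of_int (x $ j)) + exp (- (r * real_of_int (x $ j)))) / 2"
  have "Re (fourier (tilt j r D) k) = (\<Sum>x\<in>lbox L. D x * exp (r * real_of_int (x $ j)) * cos (k \<bullet> lat x))"
    by (subst fourier_lbox[of L]) (auto simp: tilt_def kernel_supp[OF K] Re_exp)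
  moreover have "(\<Sum>x\<in>lbox L. D x * exp (r * real_of_int (x $ j)) * cos (k \<bullet> lat x))
      = (\<Sum>x\<in>lbox L. D x * exp (- (r * real_of_int (x $ j))) * cos (k \<bullet> lat x))"
    by (subst sum_lbox_uminus[symmetric]) (simp add: kernel_even[OF K] lat_minus)
  ultimately have "Re (fourier (tilt j r D) k)
      = ((\<Sum>x\<in>lbox L. D x * exp (r * real_of_int (x $ j)) * cos (k \<bullet> lat x))
        + (\<Sum>x\<in>lbox L. D x * exp (- (r * real_of_int (x $ j))) * cos (k \<bullet> lat x))) / 2"
    by simp
  also have "\<dots> = (\<Sum>x\<in>lbox L. D x * (?c x * cos (k \<bullet> lat x)))"
    by (simp add: sum.distrib[symmetric] sum_divide_distrib distrib_right distrib_left
        add_divide_distrib mult_ac)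
  also have "\<dots> \<le> (\<Sum>x\<in>lbox L. D x * (cos (k \<bullet> lat x) + (r * L)\<^sup>2))"
  proof (intro sum_mono mult_left_mono kernel_nonneg[OF K])
    fix x :: "int ^ 'a" assume x: "x \<in> lbox L"
    define u where "u = r * real_of_int (x $ j)"
    have uL: "\<bar>u\<bar> \<le> \<bar>r\<bar> * L"
      using x by (auto simp: u_def abs_mult lbox_def intro: mult_left_mono)
    have "(1 + u) + (1 + - u) \<le> exp u + exp (- u)" by (intro add_mono exp_ge_add_one_self)
    then have "1 \<le> (exp u + exp (- u)) / 2" by simp
    then have "1 \<le> ?c x" by (simp only: u_def)
    then have "(?c x - 1) * cos (k \<bullet> lat x) \<le> (?c x - 1) * 1"
      by (intro mult_left_mono) auto
    also have "\<dots> \<le> u\<^sup>2"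
    proof -
      have "(exp u + exp (- u)) / 2 \<le> u\<^sup>2 + 1"
        using cosh_quadratic_bound[of u] uL r by (simp add: add.commute)
      then show ?thesis unfolding mult_1_right diff_le_eq u_def[symmetric] .
    qed
    also have "\<dots> \<le> (r * L)\<^sup>2"
      using uL kernel_scale[OF K] by (metis abs_le_square_iff abs_mult abs_of_nonneg zero_le_one
          order_trans)
    finally show "?c x * cos (k \<bullet> lat x) \<le> cos (k \<bullet> lat x) + (r * L)\<^sup>2"
      by (simp only: left_diff_distrib)
  qed
  also have "\<dots> = Re (fourier D k) + (r * L)\<^sup>2"
    by (subst fourier_lbox[of L])
       (auto simp: kernel_supp[OF K] Re_exp distrib_left sum.distrib sum_distrib_right[symmetric]
           kernel_sum[OF K])
  finally show ?thesis using kernel_infrared[OF K k] small by simp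
qed

lemma cos_quartic_bound:
  fixes u :: complex
  shows "norm (1 - cos u - u\<^sup>2 / 2) \<le> exp \<bar>Im u\<bar> * norm u ^ 4 / 6"
proof -
  have "norm (cos u - (\<Sum>k\<le>3. complex_of_real (cos_coeff k) * u ^ k))
      \<le> exp \<bar>Im u\<bar> * norm u ^ Suc 3 / fact 3"
    by (rule Taylor_cos)
  also have "(\<Sum>k\<le>3. complex_of_real (cos_coeff k) * u ^ k) = 1 - u\<^sup>2 / 2"
  proof -
    have "{..3::nat} = {0, 1, 2, 3}" by auto
    then show ?thesis by (simp add: cos_coeff_def)
  qed
  finally have "norm (cos u - (1 - u\<^sup>2 / 2)) \<le> exp \<bar>Im u\<bar> * norm u ^ 4 / 6"
    by (simp add: fact_numeral numeral_eq_Suc)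
  then show ?thesis
    by (subst norm_minus_cancel[symmetric]) (simp add: algebra_simps)
qed

text \<open>
  By evenness the tilted transform is \<open>\<Sum> D(x) cos (w \<bullet> x)\<close> with the complex vector \<open>w = k - \<i> r
  e\<^sub>j\<close>. Its quadratic part is \<open>\<Sum> w\<^sub>i\<^sup>2\<close> times a factor that involves the kernel only through its
  variance, which makes the quadratic parts of two kernels comparable.
\<close>

lemma kernel_tilt_quadratic:
  fixes D :: "int ^ 'n::finite \<Rightarrow> real" and L :: real and j :: 'n
  assumes K: "step_kernel b c L D" and r: "\<bar>r\<bar> * L \<le> 1" "\<bar>r\<bar> \<le> norm k"
  defines "w \<equiv> \<lambda>i. of_real (k $ i) - (if i = j then \<i> * of_real r else 0)"
  shows "norm (1 - fourier (tilt j r D) k - of_real (variance D / (2 * CARD('n))) * (\<Sum>i\<in>UNIV. (w i)\<^sup>2))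
    \<le> 8 * CARD('n) ^ 4 * (L * norm k) ^ 4"
proof -
  let ?u = "\<lambda>x. \<Sum>i\<in>UNIV. w i * of_int (x $ i)"
  have u: "of_real (k \<bullet> lat x) - \<i> * of_real (r * real_of_int (x $ j)) = ?u x" for x
  proof -
    have "(\<Sum>i\<in>UNIV. (if i = j then \<i> * of_real r else 0) * of_int (x $ i))
        = \<i> * of_real r * (of_int (x $ j) :: complex)"
      by (subst sum.remove[of UNIV j]) auto
    then show ?thesis
      by (simp add: inner_lat w_def left_diff_distrib sum_subtractf)
  qed
  have um: "?u (- x) = - ?u x" for x by (simp add: sum_negf)
  have F: "fourier (tilt j r D) k = (\<Sum>x\<in>lbox L. of_real (D x) * exp (\<i> * ?u x))"
    unfolding fourier_tilt[OF K] u ..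
  have F': "fourier (tilt j r D) k = (\<Sum>x\<in>lbox L. of_real (D x) * exp (- (\<i> * ?u x)))"
    unfolding F by (subst sum_lbox_uminus[symmetric]) (simp only: um kernel_even[OF K] mult_minus_right)
  have "fourier (tilt j r D) k = (\<Sum>x\<in>lbox L. of_real (D x) * cos (?u x))"
  proof -
    have "2 * fourier (tilt j r D) k = (\<Sum>x\<in>lbox L. of_real (D x) * (exp (\<i> * ?u x)
        + exp (- (\<i> * ?u x))))"
      using F F' by (simp add: distrib_left sum.distrib)
    also have "\<dots> = 2 * (\<Sum>x\<in>lbox L. of_real (D x) * cos (?u x))"
      by (simp add: cos_exp_eq sum_distrib_left)
    finally show ?thesis by simp
  qed
  moreover have "1 = (\<Sum>x\<in>lbox L. of_real (D x) * (1::complex))"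
    using kernel_sum[OF K] by (simp flip: of_real_sum)
  moreover have "of_real (variance D / (2 * CARD('n))) * (\<Sum>i\<in>UNIV. (w i)\<^sup>2)
      = (\<Sum>x\<in>lbox L. of_real (D x) * ((?u x)\<^sup>2 / 2))"
    using kernel_quadratic_form[OF K, of w] by (simp flip: sum_divide_distrib)
  ultimately have "1 - fourier (tilt j r D) k - of_real (variance D / (2 * CARD('n))) * (\<Sum>i\<in>UNIV. (w
      i)\<^sup>2)
     = (\<Sum>x\<in>lbox L. of_real (D x) * (1 - cos (?u x) - (?u x)\<^sup>2 / 2))"
    by (simp add: right_diff_distrib sum_subtractf)
  also have "norm \<dots> \<le> (\<Sum>x\<in>lbox L. norm (of_real (D x) * (1 - cos (?u x) - (?u x)\<^sup>2 / 2)))"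
    by (rule norm_sum)
  also have "\<dots> \<le> (\<Sum>x\<in>lbox L. D x * (8 * CARD('n) ^ 4 * (L * norm k) ^ 4))"
  proof (intro sum_mono)
    fix x :: "int ^ 'n" assume x: "x \<in> lbox L"
    have Im: "\<bar>Im (?u x)\<bar> \<le> 1"
    proof -
      have "\<bar>Im (?u x)\<bar> = \<bar>r\<bar> * \<bar>real_of_int (x $ j)\<bar>"
        by (simp add: u[symmetric] abs_mult)
      also have "\<dots> \<le> \<bar>r\<bar> * L" using x by (intro mult_left_mono) (auto simp: lbox_def)
      finally show ?thesis using r by simp
    qed
    have "norm (?u x) \<le> norm (of_real (k \<bullet> lat x) :: complex)
        + norm (\<i> * of_real (r * real_of_int (x $ j)))"
      unfolding u[symmetric] by (rule norm_triangle_ineq4)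
    also have "\<dots> = \<bar>k \<bullet> lat x\<bar> + \<bar>r\<bar> * \<bar>lat x $ j\<bar>"
      by (simp add: norm_mult lat_def abs_mult)
    also have "\<dots> \<le> norm k * norm (lat x) + norm k * norm (lat x)"
      using r(2) by (intro add_mono Cauchy_Schwarz_ineq2 mult_mono component_le_norm_cart) auto
    also have "\<dots> \<le> 2 * (norm k * (real CARD('n) * L))"
      using norm_lat_lbox[OF x] by (simp add: mult_left_mono)
    finally have nu: "norm (?u x) \<le> 2 * (norm k * (real CARD('n) * L))" .
    have "norm (1 - cos (?u x) - (?u x)\<^sup>2 / 2) \<le> exp \<bar>Im (?u x)\<bar> * norm (?u x) ^ 4 / 6"
      by (rule cos_quartic_bound)
    also have "\<dots> \<le> 3 * (2 * (norm k * (real CARD('n) * L))) ^ 4 / 6"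
    proof (intro divide_right_mono mult_mono power_mono nu)
      have "exp \<bar>Im (?u x)\<bar> \<le> exp 1" using Im by simp
      also have "\<dots> \<le> (3::real)" by (rule exp_le)
      finally show "exp \<bar>Im (?u x)\<bar> \<le> 3" .
    qed auto
    also have "\<dots> = 8 * CARD('n) ^ 4 * (L * norm k) ^ 4"
      by (simp add: power_mult_distrib)
    finally have "norm (1 - cos (?u x) - (?u x)\<^sup>2 / 2) \<le> 8 * CARD('n) ^ 4 * (L * norm k) ^ 4" .
    then show "norm (of_real (D x) * (1 - cos (?u x) - (?u x)\<^sup>2 / 2))
        \<le> D x * (8 * CARD('n) ^ 4 * (L * norm k) ^ 4)"
      using kernel_nonneg[OF K, of x] by (simp add: norm_mult mult_left_mono)
  qed
  also have "\<dots> = 8 * CARD('n) ^ 4 * (L * norm k) ^ 4"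
    by (simp flip: sum_distrib_right add: kernel_sum[OF K])
  finally show ?thesis .
qed

lemma kernel_variance_upper:
  fixes D :: "int ^ 'n::finite \<Rightarrow> real" and L :: real
  assumes K: "step_kernel b c L D"
  shows "variance D \<le> (real CARD('n) * L)\<^sup>2"
proof -
  have "variance D = (\<Sum>x\<in>lbox L. (norm (lat x))\<^sup>2 * D x)"
    by (rule variance_lbox) (rule kernel_supp[OF K])
  also have "\<dots> \<le> (\<Sum>x\<in>lbox L. (real CARD('n) * L)\<^sup>2 * D x)"
    by (intro sum_mono mult_right_mono power_mono norm_lat_lbox kernel_nonneg[OF K]) auto
  also have "\<dots> = (real CARD('n) * L)\<^sup>2"
    by (simp flip: sum_distrib_left add: kernel_sum[OF K])
  finally show ?thesis .
qed

lemma cos_ge_quadratic: "1 - cos (t::real) \<le> t\<^sup>2 / 2"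
proof -
  have "1 - cos t = 2 * (sin (t / 2))\<^sup>2" using cos_double_sin[of "t / 2"] by simp
  also have "\<dots> \<le> 2 * (t / 2)\<^sup>2"
    using abs_sin_le_one abs_sin_x_le_abs_x[of "t / 2"] by (simp add: abs_le_square_iff[symmetric])
  finally show ?thesis by (simp add: power2_eq_square)
qed

text \<open>
  The infrared bound is evaluated at a point of norm \<open>1 / L\<close>; there \<open>1 - cos t \<le> t\<^sup>2 / 2\<close> bounds
  the symbol by the variance.
\<close>

lemma kernel_variance_lower:
  fixes D :: "int ^ 'n::finite \<Rightarrow> real" and L :: real
  assumes K: "step_kernel b c L D"
  shows "2 * real CARD('n) * c * L\<^sup>2 \<le> variance D"
proof -
  obtain j :: 'n where True by simp
  have L: "L \<ge> 1" by (rule kernel_scale[OF K])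
  define k :: "real ^ 'n" where "k = (1 / L) *\<^sub>R axis j 1"
  have kx: "k \<bullet> lat x = real_of_int (x $ j) / L" for x
    by (simp add: k_def inner_axis' lat_def)
  have nk: "norm k = 1 / L" using L by (simp add: k_def)
  have "c * min 1 (L\<^sup>2 * (norm k)\<^sup>2) \<le> 1 - Re (fourier D k)"
  proof (rule kernel_infrared[OF K])
    fix i
    have "\<bar>k $ i\<bar> \<le> norm k" by (rule component_le_norm_cart)
    also have "\<dots> \<le> 1" using nk L by simp
    finally show "\<bar>k $ i\<bar> \<le> pi" using pi_gt3 by simp
  qed
  also have "L\<^sup>2 * (norm k)\<^sup>2 = 1" using nk L by (simp add: power_divide)
  also have "1 - Re (fourier D k) = (\<Sum>x\<in>lbox L. D x * (1 - cos (k \<bullet> lat x)))"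
    by (subst fourier_lbox[of L])
       (auto simp: kernel_supp[OF K] kernel_sum[OF K] Re_exp right_diff_distrib sum_subtractf)
  also have "\<dots> \<le> (\<Sum>x\<in>lbox L. D x * ((k \<bullet> lat x)\<^sup>2 / 2))"
    by (intro sum_mono mult_left_mono cos_ge_quadratic kernel_nonneg[OF K])
  also have "\<dots> = (\<Sum>x\<in>lbox L. D x * (real_of_int (x $ j) * real_of_int (x $ j))) / (2 * L\<^sup>2)"
    by (simp add: kx sum_divide_distrib power_divide power2_eq_square mult_ac)
  also have "\<dots> = variance D / (2 * CARD('n) * L\<^sup>2)"
    using kernel_second_moments[OF K, of j j] by simp
  finally show ?thesis using L by (simp add: field_simps)
qed

section \<open>Parseval bounds and singular integrals on the torus\<close>

lemma set_integral_sum: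
  fixes f :: "'x \<Rightarrow> 's \<Rightarrow> complex"
  assumes "\<And>x. x \<in> A \<Longrightarrow> set_integrable M S (f x)"
  shows "(LINT s:S|M. \<Sum>x\<in>A. f x s) = (\<Sum>x\<in>A. LINT s:S|M. f x s)"
    and "set_integrable M S (\<lambda>s. \<Sum>x\<in>A. f x s)"
proof -
  have i: "\<And>x. x \<in> A \<Longrightarrow> integrable M (\<lambda>s. indicator S s *\<^sub>R f x s)"
    using assms by (simp add: set_integrable_def)
  show "(LINT s:S|M. \<Sum>x\<in>A. f x s) = (\<Sum>x\<in>A. LINT s:S|M. f x s)"
    unfolding set_lebesgue_integral_def scaleR_sum_right
    by (rule Bochner_Integration.integral_sum) (rule i)
  show "set_integrable M S (\<lambda>s. \<Sum>x\<in>A. f x s)"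
    unfolding set_integrable_def scaleR_sum_right
    by (rule Bochner_Integration.integrable_sum) (rule i)
qed

text \<open>
  Parseval's inequality in a form that covers both the torus and a single coordinate. In the
  second case different lattice points may carry the same exponential; \<open>R\<close> is the relation of
  carrying the same one.
\<close>

lemma nn_integral_square_exponential_sum:
  fixes a :: "'x \<Rightarrow> complex" and e :: "'x \<Rightarrow> 's \<Rightarrow> complex"
  assumes A: "finite A"
    and int: "\<And>x y. x \<in> A \<Longrightarrow> y \<in> A \<Longrightarrow> set_integrable M S (\<lambda>s. e x s * cnj (e y s))"
    and val: "\<And>x y. x \<in> A \<Longrightarrow> y \<in> A \<Longrightarrow>
        (LINT s:S|M. e x s * cnj (e y s)) = (if R x y then of_real w else 0)"
    and w: "0 \<le> w"
  shows "(\<integral>\<^sup>+s\<in>S. ennreal ((norm (\<Sum>x\<in>A. a x * e x s))\<^sup>2) \<partial>M)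
    \<le> ennreal (w * (\<Sum>x\<in>A. \<Sum>y\<in>{y\<in>A. R x y}. norm (a x) * norm (a y)))"
proof -
  let ?F = "\<lambda>s. \<Sum>x\<in>A. a x * e x s"
  have sq: "of_real ((norm (?F s))\<^sup>2) = (\<Sum>x\<in>A. \<Sum>y\<in>A. a x * cnj (a y) * (e x s * cnj (e y s)))" for s
    unfolding complex_norm_square by (simp add: sum_product mult_ac)
  have int': "set_integrable M S (\<lambda>s. a x * cnj (a y) * (e x s * cnj (e y s)))" if "x \<in> A" "y \<in> A"
      for x y
    using int[OF that] by (rule set_integrable_mult_right)
  have intF: "set_integrable M S (\<lambda>s. of_real ((norm (?F s))\<^sup>2) :: complex)"
    unfolding sq by (rule set_integral_sum(2), rule set_integral_sum(2), rule int')
  have intR: "integrable M (\<lambda>s. indicator S s * (norm (?F s))\<^sup>2)"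
    using integrable_Re[OF intF[unfolded set_integrable_def]] by (simp del: of_real_power)
  have "of_real (LINT s|M. indicator S s * (norm (?F s))\<^sup>2)
      = (LINT s:S|M. of_real ((norm (?F s))\<^sup>2) :: complex)"
  proof -
    have "(LINT s:S|M. of_real ((norm (?F s))\<^sup>2) :: complex)
        = (LINT s|M. complex_of_real (indicator S s * (norm (?F s))\<^sup>2))"
      by (simp only: set_lebesgue_integral_def scaleR_conv_of_real of_real_mult)
    then show ?thesis by (simp only: integral_complex_of_real)
  qed
  also have "\<dots> = (\<Sum>x\<in>A. \<Sum>y\<in>A. LINT s:S|M. a x * cnj (a y) * (e x s * cnj (e y s)))"
  proof -
    have "(LINT s:S|M. of_real ((norm (?F s))\<^sup>2) :: complex)
        = (\<Sum>x\<in>A. LINT s:S|M. \<Sum>y\<in>A. a x * cnj (a y) * (e x s * cnj (e y s)))"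
      unfolding sq by (rule set_integral_sum(1), rule set_integral_sum(2), rule int')
    also have "\<dots> = (\<Sum>x\<in>A. \<Sum>y\<in>A. LINT s:S|M. a x * cnj (a y) * (e x s * cnj (e y s)))"
      by (intro sum.cong refl, rule set_integral_sum(1), rule int')
    finally show ?thesis .
  qed
  also have "\<dots> = (\<Sum>x\<in>A. \<Sum>y\<in>A. a x * cnj (a y) * (if R x y then of_real w else 0))"
    using val by (intro sum.cong refl) simp
  finally have eq: "of_real (LINT s|M. indicator S s * (norm (?F s))\<^sup>2)
      = (\<Sum>x\<in>A. \<Sum>y\<in>A. a x * cnj (a y) * (if R x y then of_real w else 0))" .
  have "(LINT s|M. indicator S s * (norm (?F s))\<^sup>2)
      \<le> norm (\<Sum>x\<in>A. \<Sum>y\<in>A. a x * cnj (a y) * (if R x y then of_real w else 0))"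
    unfolding eq[symmetric] norm_of_real by (rule abs_ge_self)
  also have "\<dots> \<le> (\<Sum>x\<in>A. \<Sum>y\<in>A. norm (a x * cnj (a y) * (if R x y then of_real w else 0)))"
    by (rule order_trans[OF norm_sum], rule sum_mono, rule norm_sum)
  also have "\<dots> = (\<Sum>x\<in>A. \<Sum>y\<in>A. if R x y then w * (norm (a x) * norm (a y)) else 0)"
    by (rule sum.cong[OF refl], rule sum.cong[OF refl]) (simp add: norm_mult w)
  also have "\<dots> = w * (\<Sum>x\<in>A. \<Sum>y\<in>{y\<in>A. R x y}. norm (a x) * norm (a y))"
    unfolding sum.inter_filter[OF A] sum_distrib_left by (intro sum.cong refl) auto
  finally have "(LINT s|M. indicator S s * (norm (?F s))\<^sup>2)
      \<le> w * (\<Sum>x\<in>A. \<Sum>y\<in>{y\<in>A. R x y}. norm (a x) * norm (a y))" .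
  moreover have "(\<integral>\<^sup>+s\<in>S. ennreal ((norm (?F s))\<^sup>2) \<partial>M)
      = ennreal (LINT s|M. indicator S s * (norm (?F s))\<^sup>2)"
    by (subst nn_integral_eq_integral[OF intR, symmetric])
       (auto intro!: nn_integral_cong simp: ennreal_mult' ennreal_indicator mult.commute)
  ultimately show ?thesis by (simp add: ennreal_leI)
qed

lemma emeasure_torus: "emeasure lborel (torus :: (real ^ 'n::finite) set)
    = ennreal ((2 * pi) ^ CARD('n))"
proof -
  have "emeasure lborel (torus :: (real ^ 'n) set)
      = (\<integral>\<^sup>+k. indicator (torus :: (real ^ 'n) set) k \<partial>lborel)"
    by simp
  also have "\<dots> = (\<integral>\<^sup>+k. (\<Prod>i\<in>(UNIV :: 'n set). indicator circ (k $ i)) \<partial>lborel)"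
  proof (intro nn_integral_cong)
    fix k :: "real ^ 'n"
    show "indicator torus k = (\<Prod>i\<in>UNIV. indicator circ (k $ i) :: ennreal)"
    proof (cases "k \<in> torus")
      case False
      then obtain i where "k $ i \<notin> circ" by (auto simp: torus_def)
      then have "(\<Prod>i\<in>UNIV. indicator circ (k $ i) :: ennreal) = 0"
        by (intro prod_zero bexI[of _ i]) auto
      then show ?thesis using False by simp
    qed (auto simp: torus_def)
  qed
  also have "\<dots> = (\<Prod>i\<in>(UNIV :: 'n set). \<integral>\<^sup>+s. indicator circ s \<partial>lborel)"
    by (rule nn_integral_lborel_vec_prod) auto
  also have "\<dots> = ennreal ((2 * pi) ^ CARD('n))"
    by (simp add: ennreal_power)
  finally show ?thesis .
qed

lemma set_integrable_torus_bounded: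
  fixes f :: "real ^ 'n::finite \<Rightarrow> complex"
  assumes [measurable]: "f \<in> borel_measurable borel" and "\<And>k. k \<in> torus \<Longrightarrow> norm (f k) \<le> B"
  shows "set_integrable lborel torus f"
  unfolding set_integrable_def
proof (rule Bochner_Integration.integrable_bound)
  show "integrable lborel (\<lambda>k. indicator torus k * B :: real)"
    by (intro integrable_mult_left integrable_real_indicator)
       (simp_all only: emeasure_torus ennreal_less_top infinity_ennreal_def sets_lborel torus_measurable)
  show "AE k in lborel. norm (indicator torus k *\<^sub>R f k) \<le> norm (indicator torus k * B)"
  proof (rule AE_I2)
    fix k
    show "norm (indicator torus k *\<^sub>R f k) \<le> norm (indicator torus k * B)"
      using assms(2)[of k] by (cases "k \<in> torus") auto
  qed
qed measurable

lemma measurable_exp_inner [measurable]: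
  "(\<lambda>k. exp (\<i> * of_real (k \<bullet> y))) \<in> borel_measurable borel"
  by (intro borel_measurable_continuous_onI continuous_intros)

lemma inner_upd: "upd k j s \<bullet> lat x = upd k j 0 \<bullet> lat x + s * real_of_int (x $ j)"
  unfolding inner_lat by (subst (1 2) sum.remove[of UNIV j]) (auto intro!: sum.cong)

lemma integral_torus_exp:
  fixes x :: "int ^ 'n::finite"
  shows "(LINT k:torus|lborel. exp (\<i> * of_real (k \<bullet> lat x))) = (if x
      = 0 then of_real ((2 * pi) ^ CARD('n)) else 0)"
proof (cases "x = 0")
  case True
  have "lat (0 :: int ^ 'n) = 0" by (simp add: lat_def vec_eq_iff)
  then show ?thesis
    using True by (simp add: set_lebesgue_integral_def measure_def emeasure_torus scaleR_conv_of_real)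
next
  case False
  then obtain j where j: "x $ j \<noteq> 0" by (auto simp: vec_eq_iff)
  have "set_integrable lborel torus (\<lambda>k :: real ^ 'n. exp (\<i> * of_real (k \<bullet> lat x)))"
    by (rule set_integrable_torus_bounded[where B = 1]) auto
  from integral_torus_average(1)[OF this, of j]
  have "2 * pi * (LINT k:torus|lborel. exp (\<i> * of_real (k \<bullet> lat x)))
      = (LINT k:torus|lborel. (LINT s:circ|lborel. exp (\<i> * of_real (upd k j s \<bullet> lat x))))" .
  also have "\<dots> = (LINT k:torus|lborel. exp (\<i> * of_real (upd k j 0 \<bullet> lat x)) *
      (LINT s:circ|lborel. exp (\<i> * of_real (s * real_of_int (x $ j)))))"
    by (subst inner_upd) (simp add: distrib_left exp_add)
  also have "\<dots> = 0"
    using j by (simp only: integral_circ_exp) simp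
  finally show ?thesis using False by simp
qed

lemma tilt_bound:
  assumes K: "step_kernel b c L D" and r: "\<bar>r\<bar> * L \<le> 1"
  shows "0 \<le> tilt j r D x" "tilt j r D x \<le> 3 * D x"
proof -
  show "0 \<le> tilt j r D x" by (simp add: tilt_def kernel_nonneg[OF K])
  show "tilt j r D x \<le> 3 * D x"
  proof (cases "x \<in> lbox L")
    case True
    have "r * real_of_int (x $ j) \<le> \<bar>r\<bar> * \<bar>real_of_int (x $ j)\<bar>"
      by (metis abs_ge_self abs_mult)
    also have "\<dots> \<le> \<bar>r\<bar> * L" using True by (intro mult_left_mono) (auto simp: lbox_def)
    finally have "exp (r * real_of_int (x $ j)) \<le> exp 1" using r by simp
    also have "\<dots> \<le> (3::real)" by (rule exp_le)
    finally show ?thesis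
      using kernel_nonneg[OF K, of x] by (simp add: tilt_def mult_left_mono mult.commute[of "D x"]
          mult_right_mono)
  qed (simp add: tilt_def kernel_supp[OF K])
qed

lemma fourier_tilt_lbox:
  assumes K: "step_kernel b c L D"
  shows "fourier (tilt j r D) k = (\<Sum>x\<in>lbox L. of_real (tilt j r D x) * exp (\<i> * of_real (k \<bullet> lat x)))"
  by (rule fourier_lbox) (simp add: tilt_def kernel_supp[OF K])

lemma fourier_tilt_bound:
  assumes K: "step_kernel b c L D" and r: "\<bar>r\<bar> * L \<le> 1"
  shows "norm (fourier (tilt j r D) k) \<le> 3"
proof -
  have "norm (fourier (tilt j r D) k) \<le> (\<Sum>x\<in>lbox L. norm (of_real (tilt j r D x) * exp (\<i> * of_real
      (k \<bullet> lat x))))"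
    unfolding fourier_tilt_lbox[OF K] by (rule norm_sum)
  also have "\<dots> \<le> (\<Sum>x\<in>lbox L. 3 * D x)"
    using tilt_bound[OF K r] by (intro sum_mono) (simp add: norm_mult)
  also have "\<dots> = 3" by (simp flip: sum_distrib_left add: kernel_sum[OF K])
  finally show ?thesis .
qed

lemma fourier_tilt_measurable:
  assumes K: "step_kernel b c L D"
  shows "fourier (tilt j r D) \<in> borel_measurable borel"
  unfolding fourier_tilt_lbox[OF K, abs_def]
  by measurable

text \<open>
  The power of \<open>L\<close> is that of \<open>\<Sum> D\<^sup>2 \<le> max D \<Sum> D \<le> b / L\<^sup>d\<close>.
\<close>

lemma nn_integral_torus_fourier_tilt:
  fixes D :: "int ^ 'n::finite \<Rightarrow> real" and L :: real
  assumes K: "step_kernel b c L D" and r: "\<bar>r\<bar> * L \<le> 1"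
  shows "(\<integral>\<^sup>+k\<in>torus. ennreal ((norm (fourier (tilt j r D) k))\<^sup>2) \<partial>lborel)
    \<le> ennreal (9 * b * (2 * pi) ^ CARD('n) / L ^ CARD('n))"
proof -
  let ?a = "\<lambda>x. of_real (tilt j r D x) :: complex"
  have cnj: "exp (\<i> * of_real (k \<bullet> lat x)) * cnj (exp (\<i> * of_real (k \<bullet> lat y)))
      = exp (\<i> * of_real (k \<bullet> lat (x - y)))"
    for x y :: "int ^ 'n" and k
  proof -
    have "lat (x - y) = lat x - lat y" by (simp add: lat_def vec_eq_iff)
    then have "k \<bullet> lat (x - y) = k \<bullet> lat x - k \<bullet> lat y" by (simp only: inner_diff_right)
    then show ?thesis by (simp only: exp_cnj of_real_diff right_diff_distrib exp_diff) (simp add: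
        exp_minus field_simps)
  qed
  have "(\<integral>\<^sup>+k\<in>torus. ennreal ((norm (fourier (tilt j r D) k))\<^sup>2) \<partial>lborel)
    \<le> ennreal ((2 * pi) ^ CARD('n) * (\<Sum>x\<in>lbox L. \<Sum>y\<in>{y\<in>lbox L. x = y}. norm (?a x) * norm (?a y)))"
    unfolding fourier_tilt_lbox[OF K]
  proof (rule nn_integral_square_exponential_sum)
    fix x y :: "int ^ 'n"
    show "set_integrable lborel torus (\<lambda>k. exp (\<i> * of_real (k \<bullet> lat x)) * cnj (exp (\<i> * of_real (k
        \<bullet> lat y))))"
      unfolding cnj by (rule set_integrable_torus_bounded[where B = 1]) auto
    show "(LINT k:torus|lborel. exp (\<i> * of_real (k \<bullet> lat x)) * cnj (exp (\<i> * of_real (k \<bullet> lat y))))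
        = (if x = y then of_real ((2 * pi) ^ CARD('n)) else 0)"
      unfolding cnj integral_torus_exp by simp
  qed auto
  also have "\<dots> \<le> ennreal (9 * b * (2 * pi) ^ CARD('n) / L ^ CARD('n))"
  proof (rule ennreal_leI)
    have tb: "tilt j r D y \<le> 3 * (b / L ^ CARD('n))" for y
      using tilt_bound(2)[OF K r, of j y] kernel_le[OF K, of y] by linarith
    have "(\<Sum>x\<in>lbox L. \<Sum>y\<in>{y\<in>lbox L. x = y}. norm (?a x) * norm (?a y))
        = (\<Sum>x\<in>lbox L. tilt j r D x * tilt j r D x)"
    proof (intro sum.cong refl)
      fix x :: "int ^ 'n" assume "x \<in> lbox L"
      then have "{y\<in>lbox L. x = y} = {x}" by auto
      then show "(\<Sum>y\<in>{y\<in>lbox L. x = y}. norm (?a x) * norm (?a y)) = tilt j r D x * tilt j r D x" by simp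
    qed
    also have "\<dots> \<le> (\<Sum>x\<in>lbox L. (3 * D x) * (3 * (b / L ^ CARD('n))))"
      using tilt_bound[OF K r, of j] tb kernel_nonneg[OF K]
      by (intro sum_mono mult_mono) auto
    also have "\<dots> = (3 * (\<Sum>x\<in>lbox L. D x)) * (3 * (b / L ^ CARD('n)))"
      unfolding sum_distrib_left sum_distrib_right ..
    also have "\<dots> = 9 * b / L ^ CARD('n)"
      by (simp add: kernel_sum[OF K])
    finally have "(2 * pi) ^ CARD('n) * (\<Sum>x\<in>lbox L. \<Sum>y\<in>{y\<in>lbox L. x = y}. norm (?a x) * norm (?a y))
        \<le> (2 * pi) ^ CARD('n) * (9 * b / L ^ CARD('n))"
      by (rule mult_left_mono) simp
    also have "\<dots> = 9 * b * (2 * pi) ^ CARD('n) / L ^ CARD('n)" by simp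
    finally show "(2 * pi) ^ CARD('n) * (\<Sum>x\<in>lbox L. \<Sum>y\<in>{y\<in>lbox L. x = y}. norm (?a x) * norm (?a y))
        \<le> 9 * b * (2 * pi) ^ CARD('n) / L ^ CARD('n)" .
  qed
  finally show ?thesis .
qed

text \<open>
  As a function of \<open>k\<^sub>j\<close> alone, the transform has one frequency for each slice \<open>x\<^sub>j = m\<close>, and a
  slice has mass at most of order \<open>1 / L\<close>.
\<close>

lemma nn_integral_circ_fourier_tilt:
  fixes D :: "int ^ 'n::finite \<Rightarrow> real" and L :: real
  assumes K: "step_kernel b c L D" and r: "\<bar>r\<bar> * L \<le> 1"
  shows "(\<integral>\<^sup>+s\<in>circ. ennreal ((norm (fourier (tilt j r D) (upd k j s)))\<^sup>2) \<partial>lborel)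
    \<le> ennreal (9 * b * (2 * pi) * 3 ^ (CARD('n) - 1) / L)"
proof -
  let ?a = "\<lambda>x. of_real (tilt j r D x) * exp (\<i> * of_real (upd k j 0 \<bullet> lat x)) :: complex"
  have L: "L \<ge> 1" by (rule kernel_scale[OF K])
  have cnj: "exp (\<i> * of_real (s * of_int m)) * cnj (exp (\<i> * of_real (s * of_int n)))
      = exp (\<i> * of_real (s * of_int (m - n)))"
    for m n :: int and s
    by (simp add: exp_cnj algebra_simps flip: exp_add)
  have F: "fourier (tilt j r D) (upd k j s) = (\<Sum>x\<in>lbox L. ?a x * exp (\<i> * of_real (s * of_int (x $
      j))))" for s
    unfolding fourier_tilt_lbox[OF K] by (subst inner_upd) (simp add: distrib_left exp_add mult_ac)
  have "(\<integral>\<^sup>+s\<in>circ. ennreal ((norm (fourier (tilt j r D) (upd k j s)))\<^sup>2) \<partial>lborel)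
    \<le> ennreal (2 * pi * (\<Sum>x\<in>lbox L. \<Sum>y\<in>{y\<in>lbox L. x $ j = y $ j}. norm (?a x) * norm (?a y)))"
    unfolding F
  proof (rule nn_integral_square_exponential_sum)
    fix x y :: "int ^ 'n"
    show "set_integrable lborel circ (\<lambda>s. exp (\<i> * of_real (s * of_int (x $ j))) * cnj (exp (\<i> *
        of_real (s * of_int (y $ j)))))"
      unfolding cnj by (intro set_lebesgue_integral_circ(2) continuous_intros)
    show "(LINT s:circ|lborel. exp (\<i> * of_real (s * of_int (x $ j))) * cnj (exp (\<i> * of_real (s *
        of_int (y $ j)))))
        = (if x $ j = y $ j then of_real (2 * pi) else 0)"
      unfolding cnj integral_circ_exp by simp
  qed auto
  also have "\<dots> \<le> ennreal (9 * b * (2 * pi) * 3 ^ (CARD('n) - 1) / L)"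
  proof (rule ennreal_leI)
    have b: "0 \<le> b / L ^ CARD('n)" using kernel_bound_nonneg[OF K] L by simp
    have tb: "tilt j r D y \<le> 3 * (b / L ^ CARD('n))" for y
      using tilt_bound(2)[OF K r, of j y] kernel_le[OF K, of y] by linarith
    have "(\<Sum>x\<in>lbox L. \<Sum>y\<in>{y\<in>lbox L. x $ j = y $ j}. norm (?a x) * norm (?a y))
        \<le> (\<Sum>x\<in>lbox L. \<Sum>y\<in>{y\<in>lbox L. x $ j = y $ j}. (3 * D x) * (3 * (b / L ^ CARD('n))))"
      using tilt_bound[OF K r, of j] tb kernel_nonneg[OF K]
      by (intro sum_mono mult_mono) (auto simp: norm_mult)
    also have "\<dots> = (\<Sum>x\<in>lbox L. real (card {y\<in>lbox L. y $ j
        = x $ j}) * ((3 * D x) * (3 * (b / L ^ CARD('n)))))"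
      by (simp add: eq_commute)
    also have "\<dots> \<le> (\<Sum>x\<in>lbox L. (3 * L) ^ (CARD('n) - 1) * ((3 * D x) * (3 * (b / L ^ CARD('n)))))"
      by (intro sum_mono mult_right_mono card_lbox_slice L mult_nonneg_nonneg b) (use
          kernel_nonneg[OF K] b in auto)
    also have "\<dots> = (3 * L) ^ (CARD('n) - 1) * (9 * b / L ^ CARD('n)) * (\<Sum>x\<in>lbox L. D x)"
      unfolding sum_distrib_left by (intro sum.cong refl) simp
    also have "\<dots> = 9 * b * 3 ^ (CARD('n) - 1) / L"
    proof -
      have "L ^ CARD('n) = L * L ^ (CARD('n) - 1)"
        by (metis One_nat_def Suc_pred power_Suc zero_less_card_finite)
      then show ?thesis using L by (simp add: kernel_sum[OF K] power_mult_distrib)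
    qed
    finally have "2 * pi * (\<Sum>x\<in>lbox L. \<Sum>y\<in>{y\<in>lbox L. x $ j = y $ j}. norm (?a x) * norm (?a y))
        \<le> 2 * pi * (9 * b * 3 ^ (CARD('n) - 1) / L)"
      by (rule mult_left_mono) simp
    also have "\<dots> = 9 * b * (2 * pi) * 3 ^ (CARD('n) - 1) / L" by simp
    finally show "2 * pi * (\<Sum>x\<in>lbox L. \<Sum>y\<in>{y\<in>lbox L. x $ j = y $ j}. norm (?a x) * norm (?a y))
        \<le> 9 * b * (2 * pi) * 3 ^ (CARD('n) - 1) / L" .
  qed
  finally show ?thesis .
qed

lemma AE_nonzero_components: "AE k in lborel. \<forall>i. (k :: real ^ 'n::finite) $ i \<noteq> 0"
proof -
  have "AE k in lborel. (k :: real ^ 'n) \<bullet> axis i 1 \<noteq> 0" for i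
    by (rule AE_lborel_inner_neq) (auto simp: axis_in_Basis_iff)
  then show ?thesis by (simp add: AE_all_countable inner_axis)
qed

text \<open>
  Since \<open>|k|\<^sup>2 \<ge> \<Prod> |k\<^sub>i|\<^bsup>2/d\<^esup>\<close>, the singularity is dominated by a product of one-dimensional
  ones of exponent \<open>2 / d < 1\<close>.
\<close>

lemma nn_integral_inverse_square_cutoff:
  fixes L :: real
  assumes d: "CARD('n::finite) > 2" and L: "L > 0"
  shows "(\<integral>\<^sup>+k. ennreal (of_bool (L * norm k \<le> 1) / (L * norm (k :: real ^ 'n))\<^sup>2) \<partial>lborel)
    \<le> ennreal ((2 / (1 - 2 / CARD('n))) ^ CARD('n) / L ^ CARD('n))"
proof -
  let ?p = "- 2 / real CARD('n)"
  have p: "- 1 < ?p" using d by (simp add: field_simps)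
  have "(\<integral>\<^sup>+k. ennreal (of_bool (L * norm k \<le> 1) / (L * norm (k :: real ^ 'n))\<^sup>2) \<partial>lborel)
    \<le> (\<integral>\<^sup>+k. (\<Prod>i\<in>(UNIV :: 'n set). ennreal ((L * \<bar>k $ i\<bar>) powr ?p) * indicator {- 1 / L..1 / L} (k $
        i)) \<partial>lborel)"
  proof (rule nn_integral_mono_AE, use AE_nonzero_components[where 'n='n] in eventually_elim)
    case (elim k)
    show ?case
    proof (cases "L * norm k \<le> 1")
      case True
      have k0: "norm k > 0" using elim by auto
      have comp: "\<bar>k $ i\<bar> \<le> norm k" for i by (rule component_le_norm_cart)
      have ind: "k $ i \<in> {- 1 / L..1 / L}" for i
      proof -
        have "L * \<bar>k $ i\<bar> \<le> 1" using comp[of i] True L by (meson mult_left_mono order_trans less_imp_le)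
        then have "\<bar>k $ i\<bar> \<le> 1 / L" using L by (simp add: field_simps)
        then show ?thesis by (auto simp: abs_le_iff)
      qed
      have "1 / (L * norm k)\<^sup>2 = (L * norm k) powr (- 2)"
        using L k0 by (simp add: powr_minus powr_numeral inverse_eq_divide)
      also have "\<dots> = (\<Prod>i\<in>(UNIV :: 'n set). (L * norm k) powr ?p)"
        using L k0 by (simp add: powr_realpow[symmetric] powr_powr)
      also have "\<dots> \<le> (\<Prod>i\<in>(UNIV :: 'n set). (L * \<bar>k $ i\<bar>) powr ?p)"
        using L comp elim by (intro prod_mono conjI powr_mono2') auto
      finally have "1 / (L * norm k)\<^sup>2 \<le> (\<Prod>i\<in>(UNIV :: 'n set). (L * \<bar>k $ i\<bar>) powr ?p)" .
      then show ?thesis using True ind by (simp add: prod_ennreal ennreal_leI)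
    qed simp
  qed
  also have "\<dots> = (\<Prod>i\<in>(UNIV :: 'n set). \<integral>\<^sup>+s. ennreal ((L * \<bar>s\<bar>) powr ?p) * indicator {- 1 / L..1 /
      L} s \<partial>lborel)"
    by (rule nn_integral_lborel_vec_prod) auto
  also have "\<dots> = (\<Prod>i\<in>(UNIV :: 'n set). ennreal (2 / ((?p + 1) * L)))"
    by (subst nn_integral_powr_cutoff[OF p L]) simp
  also have "\<dots> = ennreal ((2 / ((?p + 1) * L)) ^ CARD('n))"
    using p L by (simp add: ennreal_power)
  also have "(2 / ((?p + 1) * L)) ^ CARD('n) = (2 / (1 - 2 / CARD('n))) ^ CARD('n) / L ^ CARD('n)"
    by (simp add: power_divide power_mult_distrib)
  finally show ?thesis .
qed

text \<open>
  The exponential is at most the product over \<open>i \<noteq> j\<close> of \<open>exp (- \<alpha> |k\<^sub>i|)\<close> with \<open>\<alpha> = a / d\<close>, and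
  each factor is at most \<open>2 / (1 + \<alpha>\<^sup>2 k\<^sub>i\<^sup>2)\<close>, with integral at most \<open>2\<pi> / \<alpha>\<close>.
\<close>

lemma nn_integral_exp_transverse:
  fixes j :: "'n::finite"
  assumes a: "a > 0"
  shows "(\<integral>\<^sup>+k\<in>torus. ennreal (exp (- a * norm (upd k j 0))) \<partial>lborel)
     \<le> ennreal (2 * pi * (2 * pi * CARD('n) / a) ^ (CARD('n) - 1))"
proof -
  define \<alpha> where "\<alpha> = a / CARD('n)"
  have \<alpha>: "\<alpha> > 0" using a by (simp add: \<alpha>_def)
  define f where "f i s = ennreal (if i = j then 1 else 2 / (1 + \<alpha>\<^sup>2 * s\<^sup>2)) * indicator circ s"
      for i :: 'n and s :: real
  have e: "exp (- (\<alpha> * \<bar>s\<bar>)) \<le> 2 / (1 + \<alpha>\<^sup>2 * s\<^sup>2)" for s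
  proof -
    have "(1 + \<alpha>\<^sup>2 * s\<^sup>2) / 2 \<le> 1 + \<alpha> * \<bar>s\<bar> + (\<alpha> * \<bar>s\<bar>)\<^sup>2 / 2"
      using \<alpha> by (simp add: power_mult_distrib field_simps)
    also have "\<dots> \<le> exp (\<alpha> * \<bar>s\<bar>)"
      using \<alpha> by (intro exp_lower_Taylor_quadratic) auto
    finally show ?thesis
      by (simp add: exp_minus field_simps add_pos_nonneg)
  qed
  have "(\<integral>\<^sup>+k\<in>torus. ennreal (exp (- a * norm (upd k j 0))) \<partial>lborel)
      \<le> (\<integral>\<^sup>+k. (\<Prod>i\<in>UNIV. f i (k $ i)) \<partial>lborel)"
  proof (rule nn_integral_mono)
    fix k :: "real ^ 'n"
    show "ennreal (exp (- a * norm (upd k j 0))) * indicator torus k \<le> (\<Prod>i\<in>UNIV. f i (k $ i))"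
    proof (cases "k \<in> torus")
      case True
      have "(\<Sum>i\<in>UNIV - {j}. \<bar>k $ i\<bar>) \<le> (\<Sum>i\<in>UNIV - {j}. norm (upd k j 0))"
      proof (rule sum_mono)
        fix i assume "i \<in> UNIV - {j}"
        then show "\<bar>k $ i\<bar> \<le> norm (upd k j 0)"
          using component_le_norm_cart[of "upd k j 0" i] by simp
      qed
      also have "\<dots> \<le> CARD('n) * norm (upd k j 0)"
        by (simp add: mult_right_mono)
      finally have "\<alpha> * (\<Sum>i\<in>UNIV - {j}. \<bar>k $ i\<bar>) \<le> \<alpha> * (CARD('n) * norm (upd k j 0))"
        using \<alpha> by (intro mult_left_mono) auto
      then have "exp (- a * norm (upd k j 0)) \<le> exp (\<Sum>i\<in>UNIV - {j}. - (\<alpha> * \<bar>k $ i\<bar>))"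
        by (simp add: \<alpha>_def sum_negf sum_distrib_left)
      also have "\<dots> = (\<Prod>i\<in>UNIV - {j}. exp (- (\<alpha> * \<bar>k $ i\<bar>)))"
        by (rule exp_sum) simp
      also have "\<dots> \<le> (\<Prod>i\<in>UNIV - {j}. 2 / (1 + \<alpha>\<^sup>2 * (k $ i)\<^sup>2))"
        by (intro prod_mono conjI e) auto
      also have "\<dots> = (\<Prod>i\<in>UNIV. if i = j then 1 else 2 / (1 + \<alpha>\<^sup>2 * (k $ i)\<^sup>2))"
        by (subst prod.remove[of UNIV j]) auto
      finally have "ennreal (exp (- a * norm (upd k j 0)))
          \<le> (\<Prod>i\<in>UNIV. ennreal (if i = j then 1 else 2 / (1 + \<alpha>\<^sup>2 * (k $ i)\<^sup>2)))"
        by (subst prod_ennreal) (auto intro: ennreal_leI)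
      then show ?thesis using True by (simp add: f_def torus_def)
    qed simp
  qed
  also have "\<dots> = (\<Prod>i\<in>UNIV. \<integral>\<^sup>+s. f i s \<partial>lborel)"
    by (rule nn_integral_lborel_vec_prod) (auto simp: f_def)
  also have "\<dots> = (\<integral>\<^sup>+s. f j s \<partial>lborel) * (\<Prod>i\<in>UNIV - {j}. \<integral>\<^sup>+s. f i s \<partial>lborel)"
    by (rule prod.remove) auto
  also have "\<dots> \<le> ennreal (2 * pi) * (\<Prod>i\<in>UNIV - {j}. ennreal (2 * pi / \<alpha>))"
  proof (intro mult_mono prod_mono_ennreal)
    show "(\<integral>\<^sup>+s. f j s \<partial>lborel) \<le> ennreal (2 * pi)" by (simp add: f_def)
    fix i assume "i \<in> UNIV - {j}"
    then have "(\<integral>\<^sup>+s. f i s \<partial>lborel) = (\<integral>\<^sup>+s. 2 * (ennreal (1 / (1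
        + \<alpha>\<^sup>2 * s\<^sup>2)) * indicator circ s) \<partial>lborel)"
      by (intro nn_integral_cong)
         (auto simp: f_def indicator_def ennreal_mult'[symmetric] ennreal_numeral[symmetric] simp
             del: ennreal_numeral)
    also have "\<dots> = 2 * (\<integral>\<^sup>+s\<in>circ. ennreal (1 / (1 + \<alpha>\<^sup>2 * s\<^sup>2)) \<partial>lborel)"
      by (rule nn_integral_cmult) auto
    also have "\<dots> \<le> 2 * ennreal (pi / \<alpha>)"
      by (intro mult_left_mono nn_integral_circ_arctan \<alpha>) auto
    also have "\<dots> = ennreal (2 * pi / \<alpha>)"
    proof -
      have "2 * ennreal (pi / \<alpha>) = ennreal (2 * (pi / \<alpha>))"
        using \<alpha> by (subst ennreal_mult') auto
      then show ?thesis by simp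
    qed
    finally show "(\<integral>\<^sup>+s. f i s \<partial>lborel) \<le> ennreal (2 * pi / \<alpha>)" .
  qed auto
  also have "\<dots> = ennreal (2 * pi * (2 * pi * CARD('n) / a) ^ (CARD('n) - 1))"
    using a by (simp add: ennreal_power ennreal_mult' \<alpha>_def)
  finally show ?thesis .
qed

section \<open>Bounds on the symbols\<close>

lemma norm_upd_sq: "(norm (upd k j s))\<^sup>2 = (norm (upd k j 0))\<^sup>2 + s\<^sup>2"
proof -
  have "(norm (upd k j t))\<^sup>2 = t\<^sup>2 + (\<Sum>i\<in>UNIV - {j}. (k $ i)\<^sup>2)" for t
  proof -
    have "(norm (upd k j t))\<^sup>2 = (\<Sum>i\<in>UNIV. (upd k j t $ i)\<^sup>2)"
      unfolding power2_norm_eq_inner inner_vec_def by (simp add: power2_eq_square)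
    also have "\<dots> = (upd k j t $ j)\<^sup>2 + (\<Sum>i\<in>UNIV - {j}. (upd k j t $ i)\<^sup>2)"
      by (rule sum.remove) auto
    finally show ?thesis by simp
  qed
  from this[of s] this[of 0] show ?thesis by simp
qed

lemma norm_upd_mono: "norm (upd k j 0) \<le> norm (upd k j s)" "\<bar>s\<bar> \<le> norm (upd k j s)"
proof -
  show "norm (upd k j 0) \<le> norm (upd k j s)"
  proof (rule power2_le_imp_le)
    show "(norm (upd k j 0))\<^sup>2 \<le> (norm (upd k j s))\<^sup>2"
      unfolding norm_upd_sq[of k j s] by simp
  qed simp
  show "\<bar>s\<bar> \<le> norm (upd k j s)"
    using component_le_norm_cart[of "upd k j s" j] by simp
qed

lemma norm_le_pi:
  fixes k :: "real ^ 'n::finite"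
  assumes "\<And>i. \<bar>k $ i\<bar> \<le> pi"
  shows "norm k \<le> real CARD('n) * pi"
proof -
  have "norm k \<le> (\<Sum>i\<in>UNIV. \<bar>k $ i\<bar>)" by (rule norm_le_l1_cart)
  also have "\<dots> \<le> (\<Sum>i\<in>(UNIV :: 'n set). pi)" by (intro sum_mono assms)
  finally show ?thesis by simp
qed

text \<open>
  Tilts of size at most \<open>\<rho> |k|\<close> and \<open>\<rho> / L\<close> keep half of the infrared bound of a kernel of scale
  \<open>L\<close> with constant \<open>c\<close>; tilts of size at most \<open>\<rho> |k|\<close> leave a lower bound of order \<open>|k|\<^sup>2\<close> for
  a kernel of scale \<open>1\<close> with constant \<open>cP\<close>. On the torus of dimension \<open>n\<close> one has \<open>|k| \<le> n \<pi>\<close>,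
  whence the last two conditions.
\<close>

definition admissible_tilt :: "real \<Rightarrow> real \<Rightarrow> real \<Rightarrow> real \<Rightarrow> bool" where
  "admissible_tilt n c cP \<rho> \<longleftrightarrow> 0 < \<rho> \<and> \<rho> \<le> 1 \<and> \<rho>\<^sup>2 \<le> c / 2 \<and> \<rho> * (n * pi) \<le> 1 \<and> (\<rho> * (n * pi))\<^sup>2 \<le> cP / 2"

lemma admissible_tilt_exists:
  assumes "0 < c" "0 < cP" "1 \<le> n"
  shows "\<exists>\<rho>. admissible_tilt n c cP \<rho>"
proof -
  define m where "m = min 1 (min (c / 2) (cP / 2))"
  have m: "0 < m" "m \<le> 1" "m \<le> c / 2" "m \<le> cP / 2" using assms by (auto simp: m_def)
  have npi: "1 \<le> n * pi" using assms(3) pi_gt3 by (intro mult_ge1_I) auto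
  define \<rho> where "\<rho> = m / (n * pi)"
  have "n * pi \<noteq> 0" using npi by linarith
  then have e: "\<rho> * (n * pi) = m" by (simp add: \<rho>_def)
  have le: "\<rho> \<le> m" using npi m by (simp add: \<rho>_def divide_le_eq mult_le_cancel_left1)
  have pos: "0 < \<rho>" using npi m by (simp add: \<rho>_def)
  have sq: "m\<^sup>2 \<le> m" using m by (simp add: power2_eq_square mult_left_le)
  have "\<rho>\<^sup>2 \<le> m\<^sup>2" using le pos by (intro power_mono) auto
  then have "\<rho>\<^sup>2 \<le> c / 2" "\<rho> \<le> 1" using sq m le by linarith+
  moreover have "m\<^sup>2 \<le> cP / 2" using sq m by linarith
  ultimately have "admissible_tilt n c cP \<rho>"
    unfolding admissible_tilt_def e using pos m by blast
  then show ?thesis ..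
qed

lemma tilted_infrared:
  fixes D :: "int ^ 'n::finite \<Rightarrow> real" and L :: real
  assumes K: "step_kernel b c L D" and \<rho>: "admissible_tilt CARD('n) c cP \<rho>"
    and r: "\<bar>r\<bar> \<le> \<rho> * norm k" "\<bar>r\<bar> * L \<le> \<rho>" and k: "\<And>i. \<bar>k $ i\<bar> \<le> pi"
  shows "c / 2 * min 1 (L\<^sup>2 * (norm k)\<^sup>2) \<le> norm (1 - fourier (tilt j r D) k)"
proof -
  have L: "1 \<le> L" by (rule kernel_scale[OF K])
  note \<rho>' = \<rho>[unfolded admissible_tilt_def]
  have "(r * L)\<^sup>2 \<le> \<rho>\<^sup>2 * min 1 (L\<^sup>2 * (norm k)\<^sup>2)"
  proof (cases "1 \<le> L\<^sup>2 * (norm k)\<^sup>2")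
    case True
    have "(\<bar>r\<bar> * L)\<^sup>2 \<le> \<rho>\<^sup>2" using r(2) L by (intro power_mono) auto
    then show ?thesis using True by (simp add: power_mult_distrib min_def)
  next
    case False
    have "(\<bar>r\<bar> * L)\<^sup>2 \<le> (\<rho> * norm k * L)\<^sup>2" using r(1) L by (intro power_mono mult_right_mono) auto
    then show ?thesis using False by (simp add: power_mult_distrib min_def mult_ac)
  qed
  also have "\<dots> \<le> c / 2 * min 1 (L\<^sup>2 * (norm k)\<^sup>2)"
    using \<rho>' by (intro mult_right_mono) auto
  finally have "c / 2 * min 1 (L\<^sup>2 * (norm k)\<^sup>2) \<le> Re (1 - fourier (tilt j r D) k)"
    using r(2) \<rho>' k by (intro kernel_tilt_infrared[OF K]) auto
  also have "\<dots> \<le> norm (1 - fourier (tilt j r D) k)" by (rule complex_Re_le_cmod)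
  finally show ?thesis .
qed

lemma tilted_infrared_unit:
  fixes P :: "int ^ 'n::finite \<Rightarrow> real"
  assumes K: "step_kernel bP cP 1 P" and \<rho>: "admissible_tilt CARD('n) c cP \<rho>"
    and r: "\<bar>r\<bar> \<le> \<rho> * norm k" and k: "\<And>i. \<bar>k $ i\<bar> \<le> pi"
  shows "cP / (2 * (CARD('n) * pi)\<^sup>2) * (norm k)\<^sup>2 \<le> norm (1 - fourier (tilt j r P) k)"
proof -
  define N where "N = real CARD('n) * pi"
  note \<rho>' = \<rho>[unfolded admissible_tilt_def, folded N_def]
  have cP: "0 < cP" by (rule kernel_c[OF K])
  have "1 \<le> CARD('n)" by (simp add: Suc_leI)
  then have N1: "1 \<le> N" using pi_gt3 unfolding N_def by (intro mult_ge1_I) auto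
  have nk: "norm k \<le> N" unfolding N_def by (rule norm_le_pi) (rule k)
  have m: "(norm k)\<^sup>2 / N\<^sup>2 \<le> min 1 ((norm k)\<^sup>2)"
  proof -
    have "(norm k)\<^sup>2 \<le> N\<^sup>2" using nk by (intro power_mono) auto
    moreover have "(norm k)\<^sup>2 * 1 \<le> (norm k)\<^sup>2 * N\<^sup>2" using N1 by (intro mult_left_mono) auto
    ultimately show ?thesis using N1 by (simp add: divide_le_eq)
  qed
  have "r\<^sup>2 \<le> (\<rho> * norm k)\<^sup>2" using r by (metis abs_ge_zero power2_abs power_mono)
  also have "\<dots> = (\<rho> * N)\<^sup>2 * ((norm k)\<^sup>2 / N\<^sup>2)" using N1 by (simp add: power_mult_distrib)
  also have "\<dots> \<le> cP / 2 * min 1 ((norm k)\<^sup>2)"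
    using \<rho>' m cP by (intro mult_mono) auto
  finally have "r\<^sup>2 \<le> cP / 2 * min 1 ((norm k)\<^sup>2)" .
  moreover have "\<bar>r\<bar> \<le> 1"
    using r nk \<rho>' mult_left_mono[of "norm k" N \<rho>] by linarith
  ultimately have "cP / 2 * min 1 (1\<^sup>2 * (norm k)\<^sup>2) \<le> Re (1 - fourier (tilt j r P) k)"
    using k by (intro kernel_tilt_infrared[OF K]) auto
  also have "\<dots> \<le> norm (1 - fourier (tilt j r P) k)" by (rule complex_Re_le_cmod)
  finally have "cP / 2 * min 1 ((norm k)\<^sup>2) \<le> norm (1 - fourier (tilt j r P) k)" by simp
  moreover have "cP / (2 * N\<^sup>2) * (norm k)\<^sup>2 = cP / 2 * ((norm k)\<^sup>2 / N\<^sup>2)" by simp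
  moreover have "cP / 2 * ((norm k)\<^sup>2 / N\<^sup>2) \<le> cP / 2 * min 1 ((norm k)\<^sup>2)"
    using m cP by (intro mult_left_mono) auto
  ultimately show ?thesis unfolding N_def by linarith
qed

lemma square_over_one_minus_bound:
  fixes D :: "int ^ 'n::finite \<Rightarrow> real" and L :: real
  assumes K: "step_kernel b c L D" and \<rho>: "admissible_tilt CARD('n) c cP \<rho>"
    and r: "\<bar>r\<bar> \<le> \<rho> * norm k" "\<bar>r\<bar> * L \<le> \<rho>" and k: "\<And>i. \<bar>k $ i\<bar> \<le> pi"
    and far: "1 \<le> L * norm k"
  shows "norm ((fourier (tilt j r D) k)\<^sup>2 / (1 - fourier (tilt j r D) k))
      \<le> 2 / c * (norm (fourier (tilt j r D) k))\<^sup>2"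
proof -
  have c: "0 < c" by (rule kernel_c[OF K])
  have "1 \<le> (L * norm k)\<^sup>2" using far by (simp add: one_le_power)
  then have "c / 2 \<le> norm (1 - fourier (tilt j r D) k)"
    using tilted_infrared[OF K \<rho> r k, of j] by (simp add: power_mult_distrib)
  then have "(norm (fourier (tilt j r D) k))\<^sup>2 / norm (1 - fourier (tilt j r D) k)
      \<le> (norm (fourier (tilt j r D) k))\<^sup>2 / (c / 2)"
    using c by (intro divide_left_mono mult_pos_pos) auto
  then show ?thesis by (simp add: norm_divide norm_power mult.commute)
qed

lemma unit_green_bound:
  fixes D P :: "int ^ 'n::finite \<Rightarrow> real" and L :: real
  assumes K: "step_kernel b c L D" and KP: "step_kernel bP cP 1 P"
    and \<rho>: "admissible_tilt CARD('n) c cP \<rho>"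
    and r: "\<bar>r\<bar> \<le> \<rho> * norm k" and k: "\<And>i. \<bar>k $ i\<bar> \<le> pi"
    and far: "1 \<le> L * norm k"
  shows "norm (1 / (of_real (variance D) * (1 - fourier (tilt j r P) k)))
    \<le> 2 * real CARD('n) * pi\<^sup>2 / (c * cP) / (1 + L\<^sup>2 * (norm k)\<^sup>2)"
proof -
  have c: "0 < c" "0 < cP" by (rule kernel_c[OF K], rule kernel_c[OF KP])
  have L: "1 \<le> L" by (rule kernel_scale[OF K])
  have k0: "0 < norm k" using far L by (cases "norm k = 0") auto
  define n where "n = real CARD('n)"
  have n: "0 < n" by (simp add: n_def)
  have v: "2 * n * c * L\<^sup>2 \<le> variance D" unfolding n_def by (rule kernel_variance_lower[OF K])
  have l: "cP / (2 * (n * pi)\<^sup>2) * (norm k)\<^sup>2 \<le> norm (1 - fourier (tilt j r P) k)"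
    unfolding n_def by (rule tilted_infrared_unit[OF KP \<rho> r k])
  have "1 \<le> (L * norm k)\<^sup>2" using far by (simp add: one_le_power)
  then have "c * cP / (2 * n * pi\<^sup>2) * (1 + L\<^sup>2 * (norm k)\<^sup>2)
      \<le> c * cP / (2 * n * pi\<^sup>2) * (2 * (L\<^sup>2 * (norm k)\<^sup>2))"
    using c n by (intro mult_left_mono) (auto simp: power_mult_distrib)
  also have "\<dots> = (2 * n * c * L\<^sup>2) * (cP / (2 * (n * pi)\<^sup>2) * (norm k)\<^sup>2)"
    using n by (simp add: power_mult_distrib field_simps power2_eq_square)
  also have "\<dots> \<le> variance D * norm (1 - fourier (tilt j r P) k)"
    using c n L by (intro mult_mono v l) (auto intro: order_trans[OF _ v])
  finally have "c * cP / (2 * n * pi\<^sup>2) * (1 + L\<^sup>2 * (norm k)\<^sup>2)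
      \<le> variance D * norm (1 - fourier (tilt j r P) k)" .
  moreover have "0 < c * cP / (2 * n * pi\<^sup>2) * (1 + L\<^sup>2 * (norm k)\<^sup>2)"
    using c n by (intro mult_pos_pos divide_pos_pos) (auto intro: add_pos_nonneg)
  ultimately have "1 / (variance D * norm (1 - fourier (tilt j r P) k))
      \<le> 1 / (c * cP / (2 * n * pi\<^sup>2) * (1 + L\<^sup>2 * (norm k)\<^sup>2))"
    by (intro frac_le) auto
  moreover have "0 \<le> variance D" using v c n L by (auto intro: order_trans[OF _ v])
  ultimately show ?thesis by (simp add: norm_divide norm_mult n_def)
qed

text \<open>
  The first term is \<open>1 / (1 - u)\<close> without the initial terms \<open>1 + u\<close> of its geometric series.
\<close>

definition symbol_error :: "real \<Rightarrow> complex \<Rightarrow> complex \<Rightarrow> complex" where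
  "symbol_error \<sigma> u w = u\<^sup>2 / (1 - u) - 1 / (of_real \<sigma> * (1 - w))"

text \<open>
  With \<open>\<alpha> = 1 - u\<close> and \<open>\<beta> = 1 - w\<close> the symbol is \<open>(\<sigma> \<beta> - \<alpha>) / (\<sigma> \<beta> \<alpha>) - 1 - u\<close>. The quadratic
  parts of \<open>\<sigma> \<beta>\<close> and \<open>\<alpha>\<close> agree, so the numerator is of order \<open>(L |k|)\<^sup>4\<close>, as is the denominator.
\<close>

lemma symbol_error_near:
  fixes D P :: "int ^ 'n::finite \<Rightarrow> real" and L :: real
  assumes K: "step_kernel b c L D" and KP: "step_kernel bP cP 1 P" and vP: "variance P = 1"
    and \<rho>: "admissible_tilt CARD('n) c cP \<rho>"
    and r: "\<bar>r\<bar> \<le> \<rho> * norm k" "\<bar>r\<bar> * L \<le> \<rho>" and k: "\<And>i. \<bar>k $ i\<bar> \<le> pi"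
    and near: "L * norm k \<le> 1" and k0: "k \<noteq> 0"
  shows "norm (symbol_error (variance D) (fourier (tilt j r D) k) (fourier (tilt j r P) k))
    \<le> 4 + 16 * real CARD('n) ^ 3 * ((real CARD('n))\<^sup>2 + 1) / (c\<^sup>2 * cP)"
proof -
  define n where "n = real CARD('n)"
  define \<sigma> where "\<sigma> = variance D"
  define F where "F = fourier (tilt j r D) k"
  define \<alpha> where "\<alpha> = 1 - F"
  define \<beta> where "\<beta> = 1 - fourier (tilt j r P) k"
  define q where "q = norm k"
  have q: "0 < q" using k0 by (simp add: q_def)
  have n: "1 \<le> n" by (simp add: n_def Suc_leI)
  have c: "0 < c" "0 < cP" by (rule kernel_c[OF K], rule kernel_c[OF KP])
  have L: "1 \<le> L" by (rule kernel_scale[OF K])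
  note \<rho>' = \<rho>[unfolded admissible_tilt_def]
  have rk: "\<bar>r\<bar> \<le> norm k" using r(1) \<rho>' mult_right_mono[of \<rho> 1 "norm k"] by simp
  have r1: "\<bar>r\<bar> * L \<le> 1" "\<bar>r\<bar> * 1 \<le> 1"
    using r(2) \<rho>' L mult_left_mono[of 1 L "\<bar>r\<bar>"] by auto
  have "1 * q \<le> L * q" using L q by (intro mult_right_mono) auto
  then have q1: "q \<le> 1" using near unfolding q_def by linarith
  have \<sigma>: "2 * n * c * L\<^sup>2 \<le> \<sigma>" "\<sigma> \<le> (n * L)\<^sup>2"
    unfolding n_def \<sigma>_def by (rule kernel_variance_lower[OF K], rule kernel_variance_upper[OF K])
  have \<sigma>0: "0 < \<sigma>" using \<sigma>(1) n c L by (auto intro!: less_le_trans[OF _ \<sigma>(1)] mult_pos_pos)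
  define w where "w = (\<Sum>i\<in>UNIV. (complex_of_real (k $ i) - (if i = j then \<i> * of_real r else 0))\<^sup>2)"
  have w: "norm (\<alpha> - of_real (\<sigma> / (2 * n)) * w) \<le> 8 * n ^ 4 * (L * q) ^ 4"
      "norm (\<beta> - of_real (1 / (2 * n)) * w) \<le> 8 * n ^ 4 * (1 * q) ^ 4"
    using kernel_tilt_quadratic[OF K r1(1) rk, of j] kernel_tilt_quadratic[OF KP r1(2) rk, of j]
    by (simp_all add: \<alpha>_def \<beta>_def F_def \<sigma>_def n_def q_def w_def vP)
  have num: "norm (of_real \<sigma> * \<beta> - \<alpha>) \<le> 8 * n ^ 4 * (n\<^sup>2 + 1) * (L * q) ^ 4"
  proof -
    have "of_real \<sigma> * \<beta> - \<alpha> = of_real \<sigma> * (\<beta> - of_real (1 / (2 * n)) * w) - (\<alpha> - of_real (\<sigma> / (2 *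
        n)) * w)"
      by (simp add: algebra_simps)
    also have "norm \<dots> \<le> norm (of_real \<sigma> * (\<beta> - of_real (1 / (2 * n)) * w))
        + norm (\<alpha> - of_real (\<sigma> / (2 * n)) * w)"
      by (rule norm_triangle_ineq4)
    also have "\<dots> \<le> \<sigma> * (8 * n ^ 4 * (1 * q) ^ 4) + 8 * n ^ 4 * (L * q) ^ 4"
      using w \<sigma>0 by (intro add_mono) (auto simp: norm_mult)
    also have "\<dots> \<le> 8 * n ^ 4 * n\<^sup>2 * (L * q) ^ 4 + 8 * n ^ 4 * (L * q) ^ 4"
    proof (rule add_right_mono)
      have "\<sigma> * (8 * n ^ 4 * (1 * q) ^ 4) \<le> (n * L)\<^sup>2 * (8 * n ^ 4 * (1 * q) ^ 4)"
        using \<sigma> by (intro mult_right_mono) auto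
      also have "\<dots> = 8 * n ^ 4 * n\<^sup>2 * (L\<^sup>2 * q ^ 4)" by (simp add: power_mult_distrib)
      also have "\<dots> \<le> 8 * n ^ 4 * n\<^sup>2 * (L ^ 4 * q ^ 4)"
        using L by (intro mult_left_mono mult_right_mono power_increasing) auto
      also have "\<dots> = 8 * n ^ 4 * n\<^sup>2 * (L * q) ^ 4" by (simp add: power_mult_distrib)
      finally show "\<sigma> * (8 * n ^ 4 * (1 * q) ^ 4) \<le> 8 * n ^ 4 * n\<^sup>2 * (L * q) ^ 4" .
    qed
    also have "\<dots> = 8 * n ^ 4 * (n\<^sup>2 + 1) * (L * q) ^ 4"
      by (simp only: distrib_left distrib_right mult_1_right)
    finally show ?thesis .
  qed
  have la: "c / 2 * (L * q)\<^sup>2 \<le> norm \<alpha>"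
  proof -
    have "L\<^sup>2 * (norm k)\<^sup>2 \<le> 1"
      using power_mono[OF near, of 2] L by (simp add: power_mult_distrib)
    then show ?thesis
      using tilted_infrared[OF K \<rho> r k, of j]
          by (simp add: \<alpha>_def F_def q_def power_mult_distrib min_def split: if_splits)
  qed
  have lb: "cP / 2 * q\<^sup>2 \<le> norm \<beta>"
  proof -
    have "q\<^sup>2 \<le> 1" using q q1 by (simp add: power_le_one)
    moreover have "cP / 2 * min 1 (1\<^sup>2 * (norm k)\<^sup>2) \<le> norm (1 - fourier (tilt j r P) k)"
    proof (rule tilted_infrared[OF KP _ r(1) _ k])
      show "admissible_tilt CARD('n) cP cP \<rho>"
      proof -
        have "\<rho>\<^sup>2 * 1 \<le> \<rho>\<^sup>2 * (real CARD('n) * pi)\<^sup>2"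
        proof (intro mult_left_mono one_le_power)
          show "1 \<le> real CARD('n) * pi" using n pi_gt3 unfolding n_def by (intro mult_ge1_I) auto
        qed auto
        then have "\<rho>\<^sup>2 \<le> cP / 2"
          using \<rho>' power_mult_distrib[of \<rho> "real CARD('n) * pi" 2] by linarith
        then show ?thesis using \<rho>' by (simp add: admissible_tilt_def)
      qed
      show "\<bar>r\<bar> * 1 \<le> \<rho>" using r(2) L mult_left_mono[of 1 L "\<bar>r\<bar>"] by simp
    qed
    ultimately show ?thesis by (simp add: \<beta>_def q_def min_def split: if_splits)
  qed
  have \<alpha>0: "\<alpha> \<noteq> 0" using la c L q by (auto simp: mult_le_0_iff)
  have \<beta>0: "\<beta> \<noteq> 0" using lb c q by (auto simp: mult_le_0_iff)
  have F: "F = 1 - \<alpha>" by (simp add: \<alpha>_def)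
  have nF: "norm F \<le> 3" unfolding F_def by (rule fourier_tilt_bound[OF K r1(1)])
  have "symbol_error \<sigma> F (fourier (tilt j r P) k) = F\<^sup>2 / \<alpha> - 1 / (of_real \<sigma> * \<beta>)"
    by (simp add: symbol_error_def \<alpha>_def \<beta>_def)
  also have "\<dots> = (of_real \<sigma> * \<beta> - \<alpha>) / (of_real \<sigma> * \<beta> * \<alpha>) - 1 - F"
  proof -
    have "F\<^sup>2 = 1 - \<alpha> - F * \<alpha>" unfolding F by (simp add: power2_eq_square algebra_simps)
    then have "F\<^sup>2 / \<alpha> = 1 / \<alpha> - 1 - F" using \<alpha>0 by (simp add: diff_divide_distrib)
    moreover have "(of_real \<sigma> * \<beta> - \<alpha>) / (of_real \<sigma> * \<beta> * \<alpha>) = 1 / \<alpha> - 1 / (of_real \<sigma> * \<beta>)"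
      using \<alpha>0 \<beta>0 \<sigma>0 by (simp add: diff_divide_distrib)
    ultimately show ?thesis by simp
  qed
  also have "norm \<dots> \<le> norm ((of_real \<sigma> * \<beta> - \<alpha>) / (of_real \<sigma> * \<beta> * \<alpha>)) + 1 + norm F"
    by (rule order_trans[OF norm_triangle_ineq4 add_right_mono], rule order_trans[OF
        norm_triangle_ineq4]) simp
  finally have "norm (symbol_error \<sigma> F (fourier (tilt j r P) k))
      \<le> norm ((of_real \<sigma> * \<beta> - \<alpha>) / (of_real \<sigma> * \<beta> * \<alpha>)) + 1 + norm F" .
  moreover have "norm ((of_real \<sigma> * \<beta> - \<alpha>) / (of_real \<sigma> * \<beta> * \<alpha>)) \<le> 16 * n ^ 3 * (n\<^sup>2 + 1) / (c\<^sup>2 * cP)"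
  proof -
    have "norm ((of_real \<sigma> * \<beta> - \<alpha>) / (of_real \<sigma> * \<beta> * \<alpha>))
        = norm (of_real \<sigma> * \<beta> - \<alpha>) / (\<sigma> * norm \<beta> * norm \<alpha>)"
      using \<sigma>0 by (simp add: norm_divide norm_mult)
    also have "\<dots> \<le> (8 * n ^ 4 * (n\<^sup>2 + 1) * (L * q) ^ 4) / ((2 * n * c * L\<^sup>2) * (cP / 2 * q\<^sup>2) * (c
        / 2 * (L * q)\<^sup>2))"
      using \<sigma>0 c n L q by (intro frac_le num mult_mono \<sigma> la lb mult_pos_pos) auto
    also have "(2 * n * c * L\<^sup>2) * (cP / 2 * q\<^sup>2) * (c / 2 * (L * q)\<^sup>2)
        = (n * (c\<^sup>2 * cP) / 2) * (L * q) ^ 4"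
      by (simp add: power_mult_distrib power2_eq_square power4_eq_xxxx mult_ac)
    also have "8 * n ^ 4 * (n\<^sup>2 + 1) * (L * q) ^ 4 / ((n * (c\<^sup>2 * cP) / 2) * (L * q) ^ 4)
        = 8 * n ^ 4 * (n\<^sup>2 + 1) / (n * (c\<^sup>2 * cP) / 2)"
      using L q by (intro nonzero_mult_divide_mult_cancel_right) auto
    also have "8 * n ^ 4 * (n\<^sup>2 + 1) = n * (8 * n ^ 3 * (n\<^sup>2 + 1))"
      by (simp add: power4_eq_xxxx power3_eq_cube)
    also have "n * (8 * n ^ 3 * (n\<^sup>2 + 1)) / (n * (c\<^sup>2 * cP) / 2) = 16 * n ^ 3 * (n\<^sup>2 + 1) / (c\<^sup>2 * cP)"
      using n by simp
    finally show ?thesis .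
  qed
  ultimately have "norm (symbol_error \<sigma> F (fourier (tilt j r P) k)) \<le> 16 * n ^ 3 * (n\<^sup>2
      + 1) / (c\<^sup>2 * cP) + 1 + 3"
    using nF by linarith
  then show ?thesis unfolding \<sigma>_def F_def n_def by linarith
qed

definition symbol_const :: "real \<Rightarrow> real \<Rightarrow> real \<Rightarrow> real" where
  "symbol_const n c cP = 2 / c + 2 * n * pi\<^sup>2 / (c * cP) + 2 * (4 + 16 * n ^ 3 * (n\<^sup>2 + 1) / (c\<^sup>2 * cP))"

text \<open>
  For \<open>L |k| \<le> 1\<close> the second summand on the right is of order one and dominates the bounded
  symbol; for \<open>L |k| \<ge> 1\<close> the two summands dominate the two terms of the symbol.
\<close>

lemma symbol_error_bound:
  fixes D P :: "int ^ 'n::finite \<Rightarrow> real" and L :: real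
  assumes K: "step_kernel b c L D" and KP: "step_kernel bP cP 1 P" and vP: "variance P = 1"
    and \<rho>: "admissible_tilt CARD('n) c cP \<rho>"
    and r: "\<bar>r\<bar> \<le> \<rho> * norm k" "\<bar>r\<bar> * L \<le> \<rho>" and k: "\<And>i. \<bar>k $ i\<bar> \<le> pi" and k0: "k \<noteq> 0"
  shows "norm (symbol_error (variance D) (fourier (tilt j r D) k) (fourier (tilt j r P) k))
    \<le> symbol_const CARD('n) c cP * ((norm (fourier (tilt j r D) k))\<^sup>2 + 1 / (1 + L\<^sup>2 * (norm k)\<^sup>2))"
proof -
  define n where "n = real CARD('n)"
  define X where "X = (norm (fourier (tilt j r D) k))\<^sup>2"
  define Y where "Y = 1 / (1 + L\<^sup>2 * (norm k)\<^sup>2)"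
  define a where "a = 2 / c"
  define a' where "a' = 2 * n * pi\<^sup>2 / (c * cP)"
  define a'' where "a'' = 4 + 16 * n ^ 3 * (n\<^sup>2 + 1) / (c\<^sup>2 * cP)"
  have c: "0 < c" "0 < cP" by (rule kernel_c[OF K], rule kernel_c[OF KP])
  have L: "1 \<le> L" by (rule kernel_scale[OF K])
  have C: "symbol_const CARD('n) c cP = a + a' + 2 * a''"
    by (simp add: symbol_const_def a_def a'_def a''_def n_def)
  have n: "0 < n" by (simp add: n_def)
  have a: "0 \<le> a" "0 \<le> a'" "0 \<le> a''" using c n by (auto simp: a_def a'_def a''_def)
  have X: "0 \<le> X" by (simp add: X_def)
  have Y: "0 \<le> Y" unfolding Y_def by (intro divide_nonneg_nonneg add_nonneg_nonneg
      mult_nonneg_nonneg) auto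
  show ?thesis
  proof (cases "L * norm k \<le> 1")
    case True
    have "(L * norm k)\<^sup>2 \<le> 1" using True L by (simp add: power_le_one)
    then have "1 \<le> 2 * Y" using L
      unfolding Y_def by (simp add: power_mult_distrib le_divide_eq add_pos_nonneg)
    have "norm (symbol_error (variance D) (fourier (tilt j r D) k) (fourier (tilt j r P) k)) \<le> a''"
      unfolding a''_def n_def by (rule symbol_error_near[OF K KP vP \<rho> r k True k0])
    also have "\<dots> \<le> a'' * (2 * Y)" using a \<open>1 \<le> 2 * Y\<close> by (simp add: mult_le_cancel_left1)
    also have "\<dots> \<le> (a + a' + 2 * a'') * (X + Y)"
    proof -
      have "2 * a'' * Y \<le> (a + a' + 2 * a'') * (X + Y)" using a X Y by (intro mult_mono) auto
      then show ?thesis by simp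
    qed
    finally show ?thesis unfolding C X_def Y_def .
  next
    case False
    then have far: "1 \<le> L * norm k" by simp
    have "norm (symbol_error (variance D) (fourier (tilt j r D) k) (fourier (tilt j r P) k)) \<le> a * X
        + a' * Y"
      unfolding symbol_error_def
      using square_over_one_minus_bound[OF K \<rho> r k far, of j] unit_green_bound[OF K KP \<rho> r(1) k far,
          of j]
      by (intro order_trans[OF norm_triangle_ineq4] add_mono) (auto simp: a_def a'_def X_def Y_def n_def)
    also have "\<dots> \<le> (a + a' + 2 * a'') * (X + Y)"
    proof -
      have "a * X \<le> (a + a' + 2 * a'') * X" "a' * Y \<le> (a + a' + 2 * a'') * Y"
        using a X Y by (auto intro!: mult_right_mono)
      then show ?thesis by (simp add: distrib_left)
    qed
    finally show ?thesis unfolding C X_def Y_def .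
  qed
qed

section \<open>Shifting the contour in one coordinate\<close>

text \<open>
  The Fourier transform as an entire function of its coordinate \<open>j\<close>: the argument \<open>z\<close> replaces
  \<open>k\<^sub>j\<close>.
\<close>

definition fourier_ext :: "real \<Rightarrow> (int ^ 'n \<Rightarrow> real) \<Rightarrow> 'n \<Rightarrow> real ^ 'n::finite \<Rightarrow> complex \<Rightarrow> complex" where
  "fourier_ext L f j k z =
     (\<Sum>x\<in>lbox L. of_real (f x) * exp (\<i> * (of_real (upd k j 0 \<bullet> lat x) + z * of_int (x $ j))))"

lemma fourier_ext_tilt:
  assumes K: "step_kernel b c L D"
  shows "fourier_ext L D j k (of_real s - \<i> * of_real r) = fourier (tilt j r D) (upd k j s)"
  unfolding fourier_ext_def fourier_tilt[OF K] inner_upd[of k j s]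
  by (intro sum.cong refl arg_cong2[where f = "(*)"] arg_cong[where f = exp] arg_cong2[where f = "(*)"])
     (simp add: algebra_simps)

lemma fourier_ext_differentiable: "fourier_ext L f j k field_differentiable at z"
proof -
  have "fourier_ext L f j k holomorphic_on UNIV"
    unfolding fourier_ext_def[abs_def] by (intro holomorphic_intros)
  then show ?thesis by (rule holomorphic_on_imp_differentiable_at) auto
qed

lemma exp_shift_2pi: "exp (\<i> * (w + (z + 2 * of_int m * complex_of_real pi) * of_int a))
    = exp (\<i> * (w + z * of_int a))"
  unfolding exp_eq by (rule exI[of _ "m * a"]) (simp add: algebra_simps)

lemma fourier_ext_periodic: "fourier_ext L f j k (z + 2 * of_int m * of_real pi) = fourier_ext L f j k z"
  unfolding fourier_ext_def by (simp only: exp_shift_2pi)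

lemma fourier_ext_reduce:
  obtains s where "\<bar>s\<bar> \<le> pi"
    "\<And>L b c D. step_kernel b c L D \<Longrightarrow> fourier_ext L D j k z = fourier (tilt j (- Im z) D) (upd k j s)"
proof -
  define m where "m = round (Re z / (2 * pi))"
  define s where "s = Re z - 2 * of_int m * pi"
  have "\<bar>of_int m - Re z / (2 * pi)\<bar> \<le> 1 / 2" unfolding m_def by (rule of_int_round_abs_le)
  then have "2 * pi * \<bar>of_int m - Re z / (2 * pi)\<bar> \<le> 2 * pi * (1 / 2)" by (intro mult_left_mono) auto
  moreover have "2 * pi * \<bar>of_int m - Re z / (2 * pi)\<bar> = \<bar>s\<bar>"
  proof -
    have "2 * pi * \<bar>of_int m - Re z / (2 * pi)\<bar> = \<bar>2 * pi * (of_int m - Re z / (2 * pi))\<bar>"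
        by (simp add: abs_mult)
    also have "2 * pi * (of_int m - Re z / (2 * pi)) = - s" by (simp add: s_def right_diff_distrib)
    finally show ?thesis by simp
  qed
  ultimately have "\<bar>s\<bar> \<le> pi" by simp
  moreover have z: "z = (of_real s - \<i> * of_real (- Im z)) + 2 * of_int m * of_real pi"
    by (simp add: s_def complex_eq_iff)
  have "fourier_ext L D j k z = fourier (tilt j (- Im z) D) (upd k j s)" if "step_kernel b c L D"
      for L b c D
    by (subst z, subst fourier_ext_periodic) (rule fourier_ext_tilt[OF that])
  ultimately show ?thesis using that by blast
qed

text \<open>
  Moving the contour of the coordinate \<open>j\<close> by \<open>- \<i> r\<close> tilts both kernels and gives the phase the
  modulus \<open>exp (- r x\<^sub>j)\<close>.
\<close>

lemma shifted_average:
  fixes D P :: "int ^ 'n::finite \<Rightarrow> real" and x :: "int ^ 'n" and H :: "complex \<Rightarrow> complex \<Rightarrow> complex"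
  assumes K: "step_kernel b c L D" and KP: "step_kernel bP cP L' P"
    and H: "\<And>z. \<bar>Im z\<bar> \<le> \<bar>r\<bar> \<Longrightarrow>
      (\<lambda>z. H (fourier_ext L D j k z) (fourier_ext L' P j k z)) field_differentiable at z"
  defines "f \<equiv> \<lambda>s. exp (- \<i> * of_real (upd k j s \<bullet> lat x)) * H (fourier D (upd k j s)) (fourier P
      (upd k j s))"
  shows "set_integrable lborel circ f"
    and "ennreal (norm (LINT s:circ|lborel. f s))
      \<le> ennreal (exp (- r * real_of_int (x $ j))) *
        (\<integral>\<^sup>+s\<in>circ. ennreal (norm (H (fourier (tilt j r D) (upd k j s)) (fourier (tilt j r P) (upd k
            j s)))) \<partial>lborel)"
proof -
  define G where "G z = exp (- (\<i> * (of_real (upd k j 0 \<bullet> lat x) + z * of_int (x $ j)))) *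
      H (fourier_ext L D j k z) (fourier_ext L' P j k z)" for z
  have Gd: "G field_differentiable at z" if "\<bar>Im z\<bar> \<le> \<bar>r\<bar>" for z
  proof -
    have "(\<lambda>z. exp (- (\<i> * (of_real (upd k j 0 \<bullet> lat x)
        + z * of_int (x $ j))))) field_differentiable at z"
      by (rule holomorphic_on_imp_differentiable_at[of _ UNIV]) (auto intro!: holomorphic_intros)
    then show ?thesis unfolding G_def[abs_def] using H[OF that] by (rule field_differentiable_mult)
  qed
  have Gp: "G (z + 2 * complex_of_real pi) = G z" for z
  proof -
    have "exp (- (\<i> * (w + (z + 2 * complex_of_real pi) * of_int a))) = exp (- (\<i> * (w
        + z * of_int a)))" for w a
      using exp_shift_2pi[of w z 1 a] by (simp add: exp_minus)
    moreover have "fourier_ext L f j k (z + 2 * complex_of_real pi) = fourier_ext L f j k z" for L f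
      using fourier_ext_periodic[of L f j k z 1] by simp
    ultimately show ?thesis by (simp add: G_def)
  qed
  have Gf: "G (of_real s) = f s" for s
    using fourier_ext_tilt[OF K, of j k s 0] fourier_ext_tilt[OF KP, of j k s 0]
    by (simp add: G_def f_def inner_upd[of k j s] algebra_simps)
  have Gc: "continuous_on A (\<lambda>s. G (of_real s - \<i> * of_real y))" if "\<bar>y\<bar> \<le> \<bar>r\<bar>" for A y
  proof (rule continuous_at_imp_continuous_on, rule ballI)
    fix s
    have "isCont G (of_real s - \<i> * of_real y)"
      by (rule field_differentiable_imp_continuous_at, rule Gd) (use that in auto)
    moreover have "isCont (\<lambda>s. of_real s - \<i> * of_real y :: complex) s"
      by (intro continuous_intros)
    ultimately show "isCont (\<lambda>s. G (of_real s - \<i> * of_real y)) s"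
      by (rule isCont_o2[rotated])
  qed
  show "set_integrable lborel circ f"
    using set_lebesgue_integral_circ(2)[OF Gc[of 0]] by (simp add: Gf)
  have Gi: "set_integrable lborel circ (\<lambda>s. G (of_real s - \<i> * of_real r))"
    by (rule set_lebesgue_integral_circ(2)) (rule Gc, simp)
  have nG: "norm (G (of_real s - \<i> * of_real r)) = exp (- r * real_of_int (x $ j)) *
      norm (H (fourier (tilt j r D) (upd k j s)) (fourier (tilt j r P) (upd k j s)))" for s
    by (simp add: G_def fourier_ext_tilt[OF K] fourier_ext_tilt[OF KP] norm_mult)
  have "(LINT s:circ|lborel. f s) = (LINT s:circ|lborel. G (of_real s - \<i> * of_real r))"
    using contour_shift[of r G, OF Gd Gp] by (simp add: Gf)
  also have "ennreal (norm \<dots>) \<le> (\<integral>\<^sup>+s. ennreal (norm (indicator circ s *\<^sub>R G (of_real s - \<i> *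
      of_real r))) \<partial>lborel)"
    unfolding set_lebesgue_integral_def
    by (rule integral_norm_bound_ennreal) (use Gi in \<open>simp add: set_integrable_def\<close>)
  also have "\<dots> = (\<integral>\<^sup>+s. ennreal (exp (- r * real_of_int (x $ j))) *
      (ennreal (norm (H (fourier (tilt j r D) (upd k j s)) (fourier (tilt j r P) (upd k j s)))) *
          indicator circ s) \<partial>lborel)"
    by (intro nn_integral_cong) (auto simp: nG indicator_def ennreal_mult)
  also have "\<dots> = ennreal (exp (- r * real_of_int (x $ j))) *
        (\<integral>\<^sup>+s\<in>circ. ennreal (norm (H (fourier (tilt j r D) (upd k j s)) (fourier (tilt j r P) (upd k
            j s)))) \<partial>lborel)"
  proof (rule nn_integral_cmult)
    have "(\<lambda>s. norm (indicator circ s *\<^sub>R G (of_real s - \<i> * of_real r))) \<in> borel_measurable lborel"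
      using integrable_norm[OF Gi[unfolded set_integrable_def]] by (rule borel_measurable_integrable)
    then have "(\<lambda>s. norm (indicator circ s *\<^sub>R G (of_real s - \<i> * of_real r)) / exp (- r *
        real_of_int (x $ j))) \<in> borel_measurable lborel"
      by (rule borel_measurable_divide) simp
    also have "(\<lambda>s. norm (indicator circ s *\<^sub>R G (of_real s - \<i> * of_real r)) / exp (- r *
        real_of_int (x $ j)))
        = (\<lambda>s. norm (H (fourier (tilt j r D) (upd k j s)) (fourier (tilt j r P) (upd k j s))) *
            indicator circ s)"
      by (auto simp: nG indicator_def)
    finally have "(\<lambda>s. ennreal (norm (H (fourier (tilt j r D) (upd k j s)) (fourier (tilt j r P)
        (upd k j s))) * indicator circ s)) \<in> borel_measurable lborel"
      by measurable
    then show "(\<lambda>s. ennreal (norm (H (fourier (tilt j r D) (upd k j s)) (fourier (tilt j r P) (upd k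
        j s)))) * indicator circ s) \<in> borel_measurable lborel"
      by (simp add: ennreal_mult' ennreal_indicator)
  qed
  finally show "ennreal (norm (LINT s:circ|lborel. f s))
      \<le> ennreal (exp (- r * real_of_int (x $ j))) *
        (\<integral>\<^sup>+s\<in>circ. ennreal (norm (H (fourier (tilt j r D) (upd k j s)) (fourier (tilt j r P) (upd k
            j s)))) \<partial>lborel)" .
qed

lemma upd_le_pi: "k \<in> torus \<Longrightarrow> \<bar>s\<bar> \<le> pi \<Longrightarrow> \<bar>upd k j s $ i\<bar> \<le> pi"
  by (auto simp: torus_def abs_le_iff dest: spec[of _ i])

lemma fourier_ext_ne_1:
  fixes D :: "int ^ 'n::finite \<Rightarrow> real" and L :: real
  assumes K: "step_kernel b c L D" and \<rho>: "admissible_tilt CARD('n) c cP \<rho>"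
    and r: "\<bar>r\<bar> \<le> \<rho> * norm (upd k j 0)" "\<bar>r\<bar> * L \<le> \<rho>" and k: "k \<in> torus" "upd k j 0 \<noteq> 0"
    and z: "\<bar>Im z\<bar> \<le> \<bar>r\<bar>"
  shows "1 - fourier_ext L D j k z \<noteq> 0"
proof -
  obtain s where s: "\<bar>s\<bar> \<le> pi" "fourier_ext L D j k z = fourier (tilt j (- Im z) D) (upd k j s)"
    using fourier_ext_reduce[of j k z] K by metis
  have L: "1 \<le> L" by (rule kernel_scale[OF K])
  have p: "0 < \<rho>" using \<rho> by (simp add: admissible_tilt_def)
  have n: "0 < norm (upd k j s)" using k norm_upd_mono(1)[of k j s]
      by (meson less_le_trans zero_less_norm_iff)
  have "\<rho> * norm (upd k j 0) \<le> \<rho> * norm (upd k j s)"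
    by (rule mult_left_mono[OF norm_upd_mono(1)]) (use p in simp)
  then have rs: "\<bar>- Im z\<bar> \<le> \<rho> * norm (upd k j s)"
    using r(1) z by linarith
  have "\<bar>Im z\<bar> * L \<le> \<bar>r\<bar> * L" by (rule mult_right_mono[OF z]) (use L in simp)
  then have "\<bar>- Im z\<bar> * L \<le> \<rho>" using r(2) by simp
  with rs have "c / 2 * min 1 (L\<^sup>2 * (norm (upd k j s))\<^sup>2)
      \<le> norm (1 - fourier (tilt j (- Im z) D) (upd k j s))"
    by (intro tilted_infrared[OF K \<rho>] upd_le_pi k s)
  moreover have "0 < c / 2 * min 1 (L\<^sup>2 * (norm (upd k j s))\<^sup>2)"
    using n L kernel_c[OF K] by (intro mult_pos_pos) auto
  ultimately show ?thesis using s by auto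
qed

lemma fourier_ext_unit_ne_1:
  fixes P :: "int ^ 'n::finite \<Rightarrow> real"
  assumes K: "step_kernel bP cP 1 P" and \<rho>: "admissible_tilt CARD('n) c cP \<rho>"
    and r: "\<bar>r\<bar> \<le> \<rho> * norm (upd k j 0)" and k: "k \<in> torus" "upd k j 0 \<noteq> 0"
    and z: "\<bar>Im z\<bar> \<le> \<bar>r\<bar>"
  shows "1 - fourier_ext 1 P j k z \<noteq> 0"
proof -
  obtain s where s: "\<bar>s\<bar> \<le> pi" "fourier_ext 1 P j k z = fourier (tilt j (- Im z) P) (upd k j s)"
    using fourier_ext_reduce[of j k z] K by metis
  have p: "0 < \<rho>" using \<rho> by (simp add: admissible_tilt_def)
  have n: "0 < norm (upd k j s)" using k norm_upd_mono(1)[of k j s]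
      by (meson less_le_trans zero_less_norm_iff)
  have "\<rho> * norm (upd k j 0) \<le> \<rho> * norm (upd k j s)"
    by (rule mult_left_mono[OF norm_upd_mono(1)]) (use p in simp)
  then have rs: "\<bar>- Im z\<bar> \<le> \<rho> * norm (upd k j s)"
    using r z by linarith
  from rs have "cP / (2 * (CARD('n) * pi)\<^sup>2) * (norm (upd k j s))\<^sup>2
      \<le> norm (1 - fourier (tilt j (- Im z) P) (upd k j s))"
    by (intro tilted_infrared_unit[OF K \<rho>] upd_le_pi k s)
  moreover have "0 < cP / (2 * (CARD('n) * pi)\<^sup>2) * (norm (upd k j s))\<^sup>2"
    using n kernel_c[OF K] by (intro mult_pos_pos divide_pos_pos) auto
  ultimately show ?thesis using s by auto
qed

lemma exp_ge_power_over_fact: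
  fixes x :: real
  assumes "0 \<le> x"
  shows "x ^ n / fact n \<le> exp x"
proof -
  have "(\<Sum>i\<in>{n}. x ^ i /\<^sub>R fact i) \<le> (\<Sum>i. x ^ i /\<^sub>R fact i)"
    using assms exp_converges[of x] by (intro sum_le_suminf) (auto simp: sums_iff)
  then show ?thesis using exp_converges[of x] by (simp add: sums_iff divide_inverse mult.commute)
qed

lemma fourier_tilt_continuous:
  assumes K: "step_kernel b c L D"
  shows "continuous_on A (\<lambda>s. fourier (tilt j r D) (upd k j s))"
proof -
  have "fourier (tilt j r D) (upd k j s) = (\<Sum>x\<in>lbox L. of_real (tilt j r D x) *
      exp (\<i> * of_real (upd k j 0 \<bullet> lat x + s * real_of_int (x $ j))))" for s
    unfolding fourier_tilt_lbox[OF K] by (subst inner_upd) (rule refl)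
  then show ?thesis by (simp only:) (intro continuous_intros)
qed

lemma nn_integral_circ_symbol:
  fixes D :: "int ^ 'n::finite \<Rightarrow> real" and L :: real
  assumes K: "step_kernel b c L D" and r: "\<bar>r\<bar> * L \<le> 1" and C: "0 \<le> C"
    and X: "\<And>s. s \<in> circ \<Longrightarrow> X s \<le> C * ((norm (fourier (tilt j r D) (upd k j s)))\<^sup>2 + 1 / (1 + L\<^sup>2 * s\<^sup>2))"
  shows "(\<integral>\<^sup>+s\<in>circ. ennreal (X s) \<partial>lborel) \<le> ennreal (C * (9 * b * (2 * pi) * 3 ^ (CARD('n) - 1)
      + pi) / L)"
proof -
  have L: "1 \<le> L" by (rule kernel_scale[OF K])
  have [measurable]: "(\<lambda>s. fourier (tilt j r D) (upd k j s)) \<in> borel_measurable borel"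
    by (rule borel_measurable_continuous_onI) (rule fourier_tilt_continuous[OF K])
  have b: "0 \<le> b" by (rule kernel_bound_nonneg[OF K])
  let ?f = "\<lambda>s. (norm (fourier (tilt j r D) (upd k j s)))\<^sup>2" and ?g = "\<lambda>s. 1 / (1 + L\<^sup>2 * s\<^sup>2) :: real"
  have g: "0 \<le> ?g s" for s by (intro divide_nonneg_nonneg add_nonneg_nonneg) auto
  have "(\<integral>\<^sup>+s\<in>circ. ennreal (X s) \<partial>lborel)
      \<le> (\<integral>\<^sup>+s. ennreal C * (ennreal (?f s) * indicator circ s + ennreal (?g s) * indicator circ s)
          \<partial>lborel)"
  proof (rule nn_integral_mono)
    fix s :: real
    show "ennreal (X s) * indicator circ s \<le> ennreal C * (ennreal (?f s) * indicator circ s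
        + ennreal (?g s) * indicator circ s)"
    proof (cases "s \<in> circ")
      case True
      have "ennreal (X s) \<le> ennreal (C * (?f s + ?g s))" by (rule ennreal_leI) (rule X[OF True])
      also have "\<dots> = ennreal C * (ennreal (?f s) + ennreal (?g s))"
        using C g[of s] by (simp only: ennreal_mult' ennreal_plus zero_le_power2)
      finally show ?thesis using True by simp
    qed simp
  qed
  also have "\<dots> = ennreal C * ((\<integral>\<^sup>+s\<in>circ. ennreal (?f s) \<partial>lborel) + (\<integral>\<^sup>+s\<in>circ. ennreal (?g s) \<partial>lborel))"
    by (subst nn_integral_cmult, measurable, subst nn_integral_add) auto
  also have "\<dots> \<le> ennreal C * (ennreal (9 * b * (2 * pi) * 3 ^ (CARD('n) - 1) / L) + ennreal (pi / L))"
    using L by (intro mult_left_mono add_mono nn_integral_circ_fourier_tilt[OF K r]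
        nn_integral_circ_arctan) auto
  also have "\<dots> = ennreal (C * (9 * b * (2 * pi) * 3 ^ (CARD('n) - 1) / L + pi / L))"
    using C b L by (subst ennreal_plus[symmetric]) (auto simp: ennreal_mult' intro!:
        divide_nonneg_nonneg mult_nonneg_nonneg)
  also have "C * (9 * b * (2 * pi) * 3 ^ (CARD('n) - 1) / L + pi / L)
      = C * (9 * b * (2 * pi) * 3 ^ (CARD('n) - 1) + pi) / L"
    by (simp add: add_divide_distrib distrib_left)
  finally show ?thesis .
qed

text \<open>
  Let \<open>k'\<close> denote \<open>upd k j 0\<close>. If \<open>L |k'| \<le> 1\<close>, both kernels are tilted by the same amount \<open>\<rho>
  |k'|\<close>, so that the cancellation between the two terms of the symbol survives. If \<open>L |k'| > 1\<close>,
  the two terms are moved separately: the nearest-neighbour term still by \<open>\<rho> |k'|\<close>, the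
  spread-out term only by \<open>\<rho> / L\<close>, which is as far as its strip of analyticity reaches. The sign
  of the shift is that of \<open>x\<^sub>j\<close>. The spread-out term in the second case is left as an integral
  of \<open>|u|\<^sup>2\<close>: bounding it here by Parseval in one variable would forgo the smallness \<open>L\<^sup>-\<^sup>d\<close> of
  its integral over the whole torus.
\<close>

lemma averaged_error_bound:
  fixes D P :: "int ^ 'n::finite \<Rightarrow> real" and x :: "int ^ 'n" and L :: real
  assumes K: "step_kernel b c L D" and KP: "step_kernel bP cP 1 P" and vP: "variance P = 1"
    and \<rho>: "admissible_tilt CARD('n) c cP \<rho>"
    and k: "k \<in> torus" "upd k j 0 \<noteq> 0" and x: "x $ j \<noteq> 0"
  shows "ennreal (norm (LINT s:circ|lborel. exp (- \<i> * of_real (upd k j s \<bullet> lat x)) *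
        symbol_error (variance D) (fourier D (upd k j s)) (fourier P (upd k j s))))
    \<le> ennreal (symbol_const CARD('n) c cP * (9 * b * (2 * pi) * 3 ^ (CARD('n) - 1) + pi) / L *
          exp (- (\<rho> * \<bar>real_of_int (x $ j)\<bar>) * norm (upd k j 0)))
      + ennreal (exp (- (\<rho> * \<bar>real_of_int (x $ j)\<bar> / L)) * (2 / c)) *
        (\<integral>\<^sup>+s\<in>circ. ennreal ((norm (fourier (tilt j (sgn (real_of_int (x $ j)) * \<rho> / L) D) (upd k j
            s)))\<^sup>2) \<partial>lborel)"
proof -
  define C where "C = symbol_const CARD('n) c cP"
  define B where "B = 9 * b * (2 * pi) * 3 ^ (CARD('n) - 1) + pi"
  define m where "m = real_of_int (x $ j)"
  define q where "q = norm (upd k j 0)"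
  have c: "0 < c" "0 < cP" by (rule kernel_c[OF K], rule kernel_c[OF KP])
  have L: "1 \<le> L" by (rule kernel_scale[OF K])
  note \<rho>' = \<rho>[unfolded admissible_tilt_def]
  have q: "0 < q" using k by (simp add: q_def)
  have m: "m \<noteq> 0" using x by (simp add: m_def)
  have sm: "sgn m * m = \<bar>m\<bar>" "\<bar>sgn m\<bar> = 1" using m by (auto simp: sgn_if)
  have C': "2 * real CARD('n) * pi\<^sup>2 / (c * cP) \<le> C" "0 \<le> C"
    using c unfolding C_def symbol_const_def by (auto intro!: add_nonneg_nonneg)
  have \<sigma>0: "variance D \<noteq> 0"
  proof -
    have "0 < 2 * real CARD('n) * c * L\<^sup>2" using c L by (intro mult_pos_pos) auto
    then show ?thesis using kernel_variance_lower[OF K] by linarith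
  qed
  have pi: "\<bar>s\<bar> \<le> pi" if "s \<in> circ" for s using that by auto
  have qs: "q \<le> norm (upd k j s)" for s unfolding q_def by (rule norm_upd_mono)
  have ss: "1 / (1 + L\<^sup>2 * (norm (upd k j s))\<^sup>2) \<le> 1 / (1 + L\<^sup>2 * s\<^sup>2)" for s
    using norm_upd_sq[of k j s] L by (intro divide_left_mono add_left_mono mult_left_mono
        mult_pos_pos add_pos_nonneg) auto
  have u0: "upd k j s \<noteq> 0" for s using qs[of s] q by auto
  define r where "r = sgn m * (\<rho> * q)"
  have ar: "\<bar>r\<bar> = \<rho> * q" using \<rho>' q sm by (simp add: r_def abs_mult)
  have rm: "- r * m = - (\<rho> * \<bar>m\<bar>) * q"
  proof -
    have "r * m = (sgn m * m) * (\<rho> * q)" by (simp add: r_def)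
    then show ?thesis by (simp add: sm)
  qed
  have rs: "\<bar>r\<bar> \<le> \<rho> * norm (upd k j s)" for s unfolding ar using qs[of s] \<rho>'
      by (intro mult_left_mono) auto
  have P1: "1 - fourier_ext 1 P j k z \<noteq> 0" if "\<bar>Im z\<bar> \<le> \<bar>r\<bar>" for z
    using fourier_ext_unit_ne_1[OF KP \<rho> _ k that] ar by (simp add: q_def)
  let ?f = "\<lambda>H s. exp (- \<i> * of_real (upd k j s \<bullet> lat x)) * H (fourier D (upd k j s)) (fourier P
      (upd k j s)) :: complex"
  let ?I = "\<lambda>H. LINT s:circ|lborel. ?f H s"
  show ?thesis
  proof (cases "L * q \<le> 1")
    case True
    have rL: "\<bar>r\<bar> * L \<le> \<rho>" using mult_left_mono[OF True, of \<rho>] \<rho>' by (simp add: ar mult_ac)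
    have D1: "1 - fourier_ext L D j k z \<noteq> 0" if "\<bar>Im z\<bar> \<le> \<bar>r\<bar>" for z
      using fourier_ext_ne_1[OF K \<rho> _ rL k that] ar by (simp add: q_def)
    let ?H = "symbol_error (variance D)"
    have "ennreal (norm (?I ?H)) \<le> ennreal (exp (- r * m)) *
        (\<integral>\<^sup>+s\<in>circ. ennreal (norm (?H (fourier (tilt j r D) (upd k j s)) (fourier (tilt j r P) (upd
            k j s)))) \<partial>lborel)"
      unfolding m_def
    proof (rule shifted_average(2)[OF K KP])
      fix z :: complex assume z: "\<bar>Im z\<bar> \<le> \<bar>r\<bar>"
      show "(\<lambda>z. ?H (fourier_ext L D j k z) (fourier_ext 1 P j k z)) field_differentiable at z"
        unfolding symbol_error_def
        using D1[OF z] P1[OF z] \<sigma>0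
        by (intro field_differentiable_diff field_differentiable_divide field_differentiable_power
            field_differentiable_mult field_differentiable_const fourier_ext_differentiable) auto
    qed
    also have "\<dots> \<le> ennreal (exp (- r * m)) * ennreal (C * B / L)"
      unfolding B_def
    proof (intro mult_left_mono nn_integral_circ_symbol[OF K])
      fix s :: real assume s: "s \<in> circ"
      have "norm (?H (fourier (tilt j r D) (upd k j s)) (fourier (tilt j r P) (upd k j s)))
        \<le> C * ((norm (fourier (tilt j r D) (upd k j s)))\<^sup>2 + 1 / (1 + L\<^sup>2 * (norm (upd k j s))\<^sup>2))"
        unfolding C_def by (rule symbol_error_bound[OF K KP vP \<rho> rs rL upd_le_pi[OF k(1) pi[OF s]] u0])
      also have "\<dots> \<le> C * ((norm (fourier (tilt j r D) (upd k j s)))\<^sup>2 + 1 / (1 + L\<^sup>2 * s\<^sup>2))"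
        by (intro mult_left_mono add_left_mono ss C')
      finally show "norm (?H (fourier (tilt j r D) (upd k j s)) (fourier (tilt j r P) (upd k j s)))
        \<le> C * ((norm (fourier (tilt j r D) (upd k j s)))\<^sup>2 + 1 / (1 + L\<^sup>2 * s\<^sup>2))" .
    qed (use rL \<rho>' C' in auto)
    also have "\<dots> = ennreal (C * B / L * exp (- (\<rho> * \<bar>m\<bar>) * q))"
      unfolding rm by (subst ennreal_mult'[symmetric]) (auto simp: mult.commute)
    finally show ?thesis
      unfolding C_def B_def m_def q_def by (rule order_trans) simp
  next
    case False
    then have far: "1 \<le> L * norm (upd k j s)" for s
      using mult_left_mono[OF qs[of s], of L] L by linarith
    let ?H1 = "\<lambda>u w :: complex. u\<^sup>2 / (1 - u)"
        and ?H2 = "\<lambda>u w :: complex. 1 / (of_real (variance D) * (1 - w))"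
    \<comment> \<open>The shift of the spread-out term; that of the nearest-neighbour term is \<open>r\<close>.\<close>
    define t where "t = sgn m * \<rho> / L"
    have at: "\<bar>t\<bar> = \<rho> / L" using \<rho>' L sm by (simp add: t_def abs_mult)
    have tL: "\<bar>t\<bar> * L \<le> \<rho>" using at L by simp
    have tq: "\<bar>t\<bar> \<le> \<rho> * q"
    proof -
      have "1 / L \<le> q" using False L by (simp add: divide_le_eq mult.commute)
      then have "\<rho> * (1 / L) \<le> \<rho> * q" using \<rho>' by (intro mult_left_mono) auto
      then show ?thesis by (simp add: at)
    qed
    have ts: "\<bar>t\<bar> \<le> \<rho> * norm (upd k j s)" for s
      using tq mult_left_mono[OF qs[of s], of \<rho>] \<rho>' by linarith
    have tm: "- t * m = - (\<rho> * \<bar>m\<bar> / L)"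
    proof -
      have "t * m = (sgn m * m) * \<rho> / L" by (simp add: t_def)
      also have "\<dots> = \<rho> * \<bar>m\<bar> / L" unfolding sm by (simp add: mult.commute)
      finally show ?thesis by simp
    qed
    have H1: "(\<lambda>z. ?H1 (fourier_ext L D j k z) (fourier_ext 1 P j k z)) field_differentiable at z"
        if "\<bar>Im z\<bar> \<le> \<bar>t\<bar>" for z
      using fourier_ext_ne_1[OF K \<rho> _ tL k that] tq
      by (intro field_differentiable_diff field_differentiable_divide field_differentiable_power
            field_differentiable_mult field_differentiable_const fourier_ext_differentiable) (auto
                simp: q_def)
    have H2: "(\<lambda>z. ?H2 (fourier_ext L D j k z) (fourier_ext 1 P j k z)) field_differentiable at z"
        if "\<bar>Im z\<bar> \<le> \<bar>r\<bar>" for z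
      using P1[OF that] \<sigma>0
      by (intro field_differentiable_diff field_differentiable_divide field_differentiable_power
            field_differentiable_mult field_differentiable_const fourier_ext_differentiable) auto
    have "?f (symbol_error (variance D)) s = ?f ?H1 s - ?f ?H2 s" for s
      by (simp add: symbol_error_def right_diff_distrib)
    then have "?I (symbol_error (variance D)) = (LINT s:circ|lborel. ?f ?H1 s - ?f ?H2 s)"
      by (simp only:)
    also have "\<dots> = ?I ?H1 - ?I ?H2"
      by (rule set_integral_diff(2)[OF shifted_average(1)[OF K KP, where H = ?H1 and r = t, OF H1]
          shifted_average(1)[OF K KP, where H = ?H2 and r = r, OF H2]])
    finally have "norm (?I (symbol_error (variance D))) \<le> norm (?I ?H1) + norm (?I ?H2)"
      by (simp only: norm_triangle_ineq4)
    then have split: "ennreal (norm (?I (symbol_error (variance D)))) \<le> ennreal (norm (?I ?H1))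
        + ennreal (norm (?I ?H2))"
      by (subst ennreal_plus[symmetric]) (rule norm_ge_zero, rule norm_ge_zero, rule ennreal_leI)
    have "(\<integral>\<^sup>+s\<in>circ. ennreal (norm (?H1 (fourier (tilt j t D) (upd k j s)) (fourier (tilt j t P)
        (upd k j s)))) \<partial>lborel)
        \<le> (\<integral>\<^sup>+s. ennreal (2 / c) * (ennreal ((norm (fourier (tilt j t D) (upd k j s)))\<^sup>2) *
            indicator circ s) \<partial>lborel)"
    proof (rule nn_integral_mono)
      fix s :: real
      show "ennreal (norm (?H1 (fourier (tilt j t D) (upd k j s)) (fourier (tilt j t P) (upd k j
          s)))) * indicator circ s
        \<le> ennreal (2 / c) * (ennreal ((norm (fourier (tilt j t D) (upd k j s)))\<^sup>2) * indicator circ s)"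
      proof (cases "s \<in> circ")
        case True
        from square_over_one_minus_bound[OF K \<rho> ts tL upd_le_pi[OF k(1) pi[OF True]] far, of j]
        show ?thesis using True c by (simp add: ennreal_mult'[symmetric] ennreal_leI del:
            divide_less_0_iff)
      qed simp
    qed
    also have "\<dots> = ennreal (2 / c) * (\<integral>\<^sup>+s\<in>circ. ennreal ((norm (fourier (tilt j t D) (upd k j
        s)))\<^sup>2) \<partial>lborel)"
    proof (rule nn_integral_cmult)
      have [measurable]: "(\<lambda>s. fourier (tilt j t D) (upd k j s)) \<in> borel_measurable borel"
        by (rule borel_measurable_continuous_onI) (rule fourier_tilt_continuous[OF K])
      show "(\<lambda>s. ennreal ((norm (fourier (tilt j t D) (upd k j s)))\<^sup>2) * indicator circ s) \<in>
          borel_measurable lborel"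
        by measurable
    qed
    finally have "ennreal (exp (- t * m)) * (\<integral>\<^sup>+s\<in>circ. ennreal (norm (?H1 (fourier (tilt j t D)
        (upd k j s)) (fourier (tilt j t P) (upd k j s)))) \<partial>lborel)
        \<le> ennreal (exp (- t * m)) * (ennreal (2 / c) * (\<integral>\<^sup>+s\<in>circ. ennreal ((norm (fourier (tilt j t
            D) (upd k j s)))\<^sup>2) \<partial>lborel))"
      by (rule mult_left_mono) simp
    with shifted_average(2)[OF K KP, where H = ?H1 and r = t, OF H1, of x]
    have I1: "ennreal (norm (?I ?H1)) \<le> ennreal (exp (- t * m)) * (ennreal (2 / c) * (\<integral>\<^sup>+s\<in>circ.
        ennreal ((norm (fourier (tilt j t D) (upd k j s)))\<^sup>2) \<partial>lborel))"
      unfolding m_def by (rule order_trans)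
    have "ennreal (norm (?I ?H2)) \<le> ennreal (exp (- r * m)) *
        (\<integral>\<^sup>+s\<in>circ. ennreal (norm (?H2 (fourier (tilt j r D) (upd k j s)) (fourier (tilt j r P) (upd
            k j s)))) \<partial>lborel)"
      unfolding m_def by (rule shifted_average(2)[OF K KP]) (rule H2)
    also have "\<dots> \<le> ennreal (exp (- r * m)) * ennreal (C * B / L)"
      unfolding B_def
    proof (intro mult_left_mono nn_integral_circ_symbol[OF K, where r = 0 and j = j and k = k])
      fix s :: real assume s: "s \<in> circ"
      have Y: "0 \<le> 1 / (1 + L\<^sup>2 * (norm (upd k j s))\<^sup>2)"
          by (intro divide_nonneg_nonneg add_nonneg_nonneg) auto
      have "norm (?H2 (fourier (tilt j r D) (upd k j s)) (fourier (tilt j r P) (upd k j s)))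
        \<le> 2 * real CARD('n) * pi\<^sup>2 / (c * cP) / (1 + L\<^sup>2 * (norm (upd k j s))\<^sup>2)"
        by (rule unit_green_bound[OF K KP \<rho> rs upd_le_pi[OF k(1) pi[OF s]] far])
      also have "\<dots> \<le> C * (1 / (1 + L\<^sup>2 * (norm (upd k j s))\<^sup>2))"
        using mult_right_mono[OF C'(1) Y] by simp
      also have "\<dots> \<le> C * ((norm (fourier (tilt j 0 D) (upd k j s)))\<^sup>2 + 1 / (1 + L\<^sup>2 * s\<^sup>2))"
        using ss[of s] by (intro mult_left_mono C') (smt (verit) zero_le_power2)
      finally show "norm (?H2 (fourier (tilt j r D) (upd k j s)) (fourier (tilt j r P) (upd k j s)))
        \<le> C * ((norm (fourier (tilt j 0 D) (upd k j s)))\<^sup>2 + 1 / (1 + L\<^sup>2 * s\<^sup>2))" .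
    qed (use C' in auto)
    also have "\<dots> = ennreal (C * B / L * exp (- (\<rho> * \<bar>m\<bar>) * q))"
      unfolding rm by (subst ennreal_mult'[symmetric]) (auto simp: mult.commute)
    finally have I2: "ennreal (norm (?I ?H2)) \<le> ennreal (C * B / L * exp (- (\<rho> * \<bar>m\<bar>) * q))" .
    have "ennreal (norm (?I (symbol_error (variance D)))) \<le>
        ennreal (exp (- t * m)) * (ennreal (2 / c) * (\<integral>\<^sup>+s\<in>circ. ennreal ((norm (fourier (tilt j t
            D) (upd k j s)))\<^sup>2) \<partial>lborel))
        + ennreal (C * B / L * exp (- (\<rho> * \<bar>m\<bar>) * q))"
      by (rule order_trans[OF split add_mono[OF I1 I2]])
    also have "\<dots> = ennreal (C * B / L * exp (- (\<rho> * \<bar>m\<bar>) * q))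
        + ennreal (exp (- (\<rho> * \<bar>m\<bar> / L)) * (2 / c)) *
        (\<integral>\<^sup>+s\<in>circ. ennreal ((norm (fourier (tilt j t D) (upd k j s)))\<^sup>2) \<partial>lborel)"
      unfolding tm by (simp only: ennreal_mult' exp_ge_zero mult.assoc[symmetric] add.commute)
    finally show ?thesis unfolding C_def B_def m_def q_def t_def .
  qed
qed

section \<open>Decay of the error term\<close>

lemma fourier_measurable_kernel:
  assumes "step_kernel b c L D" shows "fourier D \<in> borel_measurable borel"
  using fourier_tilt_measurable[OF assms, of undefined 0] by simp

lemma fourier_at_0:
  assumes K: "step_kernel b c L D" shows "fourier D 0 = 1"
  using kernel_sum[OF K] by (subst fourier_lbox[OF kernel_supp[OF K]]) (auto simp flip: of_real_sum)

lemma torus_le_pi: "k \<in> torus \<Longrightarrow> \<bar>k $ i\<bar> \<le> pi"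
  by (auto simp: torus_def abs_le_iff dest: spec[of _ i])

lemma symbol_const_nonneg: "0 < c \<Longrightarrow> 0 < cP \<Longrightarrow> 0 \<le> n \<Longrightarrow> 0 \<le> symbol_const n c cP"
  unfolding symbol_const_def by (auto intro!: add_nonneg_nonneg)

lemma error_integrand_measurable:
  assumes "step_kernel b c L D" "step_kernel bP cP L' P"
  shows "(\<lambda>k. exp (- \<i> * of_real (k \<bullet> lat x)) * symbol_error \<sigma> (fourier D k) (fourier P k)) \<in>
      borel_measurable borel"
proof -
  note [measurable] = assms[THEN fourier_measurable_kernel]
  have [measurable]: "(\<lambda>k. exp (- \<i> * of_real (k \<bullet> lat x))) \<in> borel_measurable borel"
    by (intro borel_measurable_continuous_onI continuous_intros)
  show ?thesis unfolding symbol_error_def by measurable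
qed

lemma error_integrand_integrable:
  fixes D P :: "int ^ 'n::finite \<Rightarrow> real" and L :: real
  assumes K: "step_kernel b c L D" and KP: "step_kernel bP cP 1 P" and vP: "variance P = 1"
  shows "set_integrable lborel torus
    (\<lambda>k. exp (- \<i> * of_real (k \<bullet> lat x)) * symbol_error (variance D) (fourier D k) (fourier P k))"
proof (rule set_integrable_torus_bounded)
  show "(\<lambda>k. exp (- \<i> * of_real (k \<bullet> lat x)) * symbol_error (variance D) (fourier D k) (fourier P
      k)) \<in> borel_measurable borel"
    by (rule error_integrand_measurable[OF K KP])
next
  fix k :: "real ^ 'n" assume k: "k \<in> torus"
  have c: "0 < c" "0 < cP" by (rule kernel_c[OF K], rule kernel_c[OF KP])
  have L: "1 \<le> L" by (rule kernel_scale[OF K])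
  obtain \<rho> where \<rho>: "admissible_tilt CARD('n) c cP \<rho>"
    using admissible_tilt_exists[OF c, of "real CARD('n)"] by (auto simp: Suc_leI)
  note \<rho>' = \<rho>[unfolded admissible_tilt_def]
  have C: "0 \<le> symbol_const CARD('n) c cP" by (rule symbol_const_nonneg) (use c in auto)
  have "norm (symbol_error (variance D) (fourier D k) (fourier P k)) \<le> symbol_const CARD('n) c cP * 10"
  proof (cases "k = 0")
    case True
    then show ?thesis using C by (simp add: symbol_error_def fourier_at_0[OF K] fourier_at_0[OF KP])
  next
    case False
    have "norm (symbol_error (variance D) (fourier (tilt undefined 0 D) k) (fourier (tilt undefined
        0 P) k))
        \<le> symbol_const CARD('n) c cP * ((norm (fourier (tilt undefined 0 D) k))\<^sup>2 + 1 / (1 + L\<^sup>2 *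
            (norm k)\<^sup>2))"
      using \<rho>' by (intro symbol_error_bound[OF K KP vP \<rho>] False torus_le_pi k) auto
    also have "\<dots> \<le> symbol_const CARD('n) c cP * (3\<^sup>2 + 1)"
    proof (intro mult_left_mono add_mono power_mono C)
      show "norm (fourier (tilt undefined 0 D) k) \<le> 3" by (rule fourier_tilt_bound[OF K]) simp
      have "1 \<le> 1 + L\<^sup>2 * (norm k)\<^sup>2" by simp
      then show "1 / (1 + L\<^sup>2 * (norm k)\<^sup>2) \<le> 1" by (subst divide_le_eq_1) linarith
    qed simp
    finally show ?thesis by simp
  qed
  then show "norm (exp (- \<i> * of_real (k \<bullet> lat x)) * symbol_error (variance D) (fourier D k)
      (fourier P k))
      \<le> symbol_const CARD('n) c cP * 10"
    by (simp add: norm_mult)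
qed

definition decay_const :: "nat \<Rightarrow> real \<Rightarrow> real \<Rightarrow> real \<Rightarrow> real \<Rightarrow> real" where
  "decay_const d b c cP \<rho> = symbol_const d c cP * (9 * b * (2 * pi) * 3 ^ (d - 1)
      + pi) * (2 * pi * d / \<rho>) ^ (d - 1)
     + 2 / c * (9 * b * (2 * pi) ^ d) * (fact (d - 1) / \<rho> ^ (d - 1))"

text \<open>
  The pointwise bound on the averages is integrated over the torus. The first term contributes
  \<open>(1 / L) |x\<^sub>j|\<^sup>-\<^sup>(\<^sup>d\<^sup>-\<^sup>1\<^sup>)\<close> because \<open>k'\<close> has \<open>d - 1\<close> free components. The second contributes
  \<open>exp (- \<rho> |x\<^sub>j| / L) L\<^sup>-\<^sup>d\<close>, which is at most of the same order by \<open>exp (- t) \<le> n! / t\<^sup>n\<close> with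
  \<open>n = d - 1\<close>.
\<close>

lemma error_fourier_decay:
  fixes D P :: "int ^ 'n::finite \<Rightarrow> real" and x :: "int ^ 'n" and L :: real
  assumes d: "CARD('n) > 2"
    and K: "step_kernel b c L D" and KP: "step_kernel bP cP 1 P" and vP: "variance P = 1"
    and \<rho>: "admissible_tilt CARD('n) c cP \<rho>" and x: "x $ j \<noteq> 0"
  shows "norm (LINT k:torus|lborel. exp (- \<i> * of_real (k \<bullet> lat x)) *
        symbol_error (variance D) (fourier D k) (fourier P k))
    \<le> decay_const CARD('n) b c cP \<rho> / (L * \<bar>real_of_int (x $ j)\<bar> ^ (CARD('n) - 1))"
proof -
  define e where "e k = exp (- \<i> * of_real (k \<bullet> lat x)) *
        symbol_error (variance D) (fourier D k) (fourier P k)" for k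
  define m where "m = \<bar>real_of_int (x $ j)\<bar>"
  define n where "n = CARD('n) - 1"
  define A where "A = symbol_const CARD('n) c cP * (9 * b * (2 * pi) * 3 ^ n + pi)"
  define B where "B = exp (- (\<rho> * m / L)) * (2 / c)"
  define F where "F = fourier (tilt j (sgn (real_of_int (x $ j)) * \<rho> / L) D)"
  have c: "0 < c" "0 < cP" by (rule kernel_c[OF K], rule kernel_c[OF KP])
  have L: "1 \<le> L" by (rule kernel_scale[OF K])
  note \<rho>' = \<rho>[unfolded admissible_tilt_def]
  have m: "0 < m" using x by (simp add: m_def)
  have [measurable]: "F \<in> borel_measurable borel" unfolding F_def by (rule fourier_tilt_measurable[OF K])
  have b: "0 \<le> b" by (rule kernel_bound_nonneg[OF K])
  have A: "0 \<le> A" unfolding A_def using c b by (intro mult_nonneg_nonneg symbol_const_nonneg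
      add_nonneg_nonneg) auto
  have B: "0 \<le> B" using c by (simp add: B_def)
  have int: "set_integrable lborel torus e"
    unfolding e_def by (rule error_integrand_integrable[OF K KP vP])
  have "ennreal (norm (2 * pi * (LINT k:torus|lborel. e k)))
      = ennreal (norm (LINT k:torus|lborel. (LINT s:circ|lborel. e (upd k j s))))"
    unfolding integral_torus_average(1)[OF int, of j] ..
  also have "\<dots> \<le> (\<integral>\<^sup>+k. ennreal (norm (indicator torus k *\<^sub>R (LINT s:circ|lborel. e (upd k j s))))
      \<partial>lborel)"
    unfolding set_lebesgue_integral_def[of _ torus]
    by (rule integral_norm_bound_ennreal)
       (use integral_torus_average(2)[OF int, of j] in \<open>simp add: set_integrable_def\<close>)
  also have "\<dots> \<le> (\<integral>\<^sup>+k. (ennreal (A / L) * (ennreal (exp (- (\<rho> * m) * norm (upd k j 0))) * indicator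
      torus k)
      + ennreal B * ((\<integral>\<^sup>+s\<in>circ. ennreal ((norm (F (upd k j s)))\<^sup>2) \<partial>lborel) * indicator torus k))
          \<partial>lborel)"
  proof (rule nn_integral_mono_AE, use AE_nonzero_components[where 'n='n] in eventually_elim)
    case (elim k)
    show ?case
    proof (cases "k \<in> torus")
      case True
      have "UNIV - {j} \<noteq> {}"
      proof
        assume "UNIV - {j} = {}"
        moreover have "card (UNIV - {j}) = CARD('n) - 1" by (simp add: card_Diff_singleton)
        ultimately have "CARD('n) - 1 = 0" by (simp only: card.empty)
        then show False using d by simp
      qed
      then obtain i where i: "i \<noteq> j" by blast
      have nz: "upd k j 0 \<noteq> 0"
      proof
        assume "upd k j 0 = 0"
        then have "upd k j 0 $ i = 0" by (simp only: zero_index)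
        then show False using elim i by simp
      qed
      have "ennreal (norm (LINT s:circ|lborel. e (upd k j s)))
        \<le> ennreal (A / L * exp (- (\<rho> * m) * norm (upd k j 0)))
          + ennreal B * (\<integral>\<^sup>+s\<in>circ. ennreal ((norm (F (upd k j s)))\<^sup>2) \<partial>lborel)"
        unfolding e_def A_def B_def F_def m_def n_def
        by (rule averaged_error_bound[OF K KP vP \<rho> True nz x])
      also have "ennreal (A / L * exp (- (\<rho> * m) * norm (upd k j 0)))
          = ennreal (A / L) * ennreal (exp (- (\<rho> * m) * norm (upd k j 0)))"
        using A L by (intro ennreal_mult) auto
      finally show ?thesis using True by simp
    qed simp
  qed
  also have "\<dots> = ennreal (A / L) * (\<integral>\<^sup>+k\<in>torus. ennreal (exp (- (\<rho> * m) * norm (upd k j 0))) \<partial>lborel)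
      + ennreal B * (\<integral>\<^sup>+k\<in>torus. (\<integral>\<^sup>+s\<in>circ. ennreal ((norm (F (upd k j s)))\<^sup>2) \<partial>lborel) \<partial>lborel)"
  proof -
    define p where "p k = ennreal (exp (- (\<rho> * m) * norm (upd k j 0))) * indicator torus k" for k
    define q where "q k = (\<integral>\<^sup>+s\<in>circ. ennreal ((norm (F (upd k j s)))\<^sup>2) \<partial>lborel) * indicator torus
        k" for k
    have [measurable]: "p \<in> borel_measurable borel" unfolding p_def by measurable
    have [measurable]: "q \<in> borel_measurable borel" unfolding q_def by measurable
    have "(\<integral>\<^sup>+k. (ennreal (A / L) * p k + ennreal B * q k) \<partial>lborel)
        = ennreal (A / L) * (\<integral>\<^sup>+k. p k \<partial>lborel) + ennreal B * (\<integral>\<^sup>+k. q k \<partial>lborel)"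
      by (simp add: nn_integral_add nn_integral_cmult)
    then show ?thesis unfolding p_def q_def .
  qed
  also have "(\<integral>\<^sup>+k\<in>torus. (\<integral>\<^sup>+s\<in>circ. ennreal ((norm (F (upd k j s)))\<^sup>2) \<partial>lborel) \<partial>lborel)
      = ennreal (2 * pi) * (\<integral>\<^sup>+k\<in>torus. ennreal ((norm (F k))\<^sup>2) \<partial>lborel)"
    by (rule nn_integral_torus_average[symmetric]) measurable
  finally have "ennreal (norm (2 * pi * (LINT k:torus|lborel. e k)))
      \<le> ennreal (A / L) * (\<integral>\<^sup>+k\<in>torus. ennreal (exp (- (\<rho> * m) * norm (upd k j 0))) \<partial>lborel)
        + ennreal B * (ennreal (2 * pi) * (\<integral>\<^sup>+k\<in>torus. ennreal ((norm (F k))\<^sup>2) \<partial>lborel))" .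
  also have "\<dots> \<le> ennreal (A / L) * ennreal (2 * pi * (2 * pi * CARD('n) / (\<rho> * m)) ^ (CARD('n) - 1))
      + ennreal B * (ennreal (2 * pi) * ennreal (9 * b * (2 * pi) ^ CARD('n) / L ^ CARD('n)))"
  proof (intro add_mono mult_left_mono)
    show "(\<integral>\<^sup>+k\<in>torus. ennreal (exp (- (\<rho> * m) * norm (upd k j 0))) \<partial>lborel)
        \<le> ennreal (2 * pi * (2 * pi * CARD('n) / (\<rho> * m)) ^ (CARD('n) - 1))"
      by (rule nn_integral_exp_transverse) (use \<rho>' m in simp)
    show "(\<integral>\<^sup>+k\<in>torus. ennreal ((norm (F k))\<^sup>2) \<partial>lborel)
        \<le> ennreal (9 * b * (2 * pi) ^ CARD('n) / L ^ CARD('n))"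
      unfolding F_def using \<rho>' L x
      by (intro nn_integral_torus_fourier_tilt[OF K]) (auto simp: abs_mult)
  qed auto
  also have "\<dots> = ennreal (A / L * (2 * pi * (2 * pi * CARD('n) / (\<rho> * m)) ^ n)
      + B * (2 * pi * (9 * b * (2 * pi) ^ CARD('n) / L ^ CARD('n))))"
  proof -
    have gen: "ennreal a * ennreal u + ennreal b' * (ennreal w * ennreal v) = ennreal (a * u
        + b' * (w * v))"
      if "0 \<le> a" "0 \<le> u" "0 \<le> b'" "0 \<le> w" "0 \<le> v" for a u b' w v
      using that by (simp add: ennreal_mult ennreal_plus)
    show ?thesis unfolding n_def[symmetric] using A B L b \<rho>' m by (intro gen) auto
  qed
  finally have "norm (2 * pi * (LINT k:torus|lborel. e k))
      \<le> A / L * (2 * pi * (2 * pi * CARD('n) / (\<rho> * m)) ^ n)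
      + B * (2 * pi * (9 * b * (2 * pi) ^ CARD('n) / L ^ CARD('n)))"
    using A B L b \<rho>' m by (subst (asm) ennreal_le_iff) auto
  then have "2 * pi * norm (LINT k:torus|lborel. e k)
      \<le> 2 * pi * (A / L * (2 * pi * CARD('n) / (\<rho> * m)) ^ n
      + B * (9 * b * (2 * pi) ^ CARD('n) / L ^ CARD('n)))"
    by (simp add: norm_mult algebra_simps)
  then have "norm (LINT k:torus|lborel. e k) \<le> A / L * (2 * pi * CARD('n) / (\<rho> * m)) ^ n
      + B * (9 * b * (2 * pi) ^ CARD('n) / L ^ CARD('n))"
    by simp
  also have "\<dots> \<le> A / L * ((2 * pi * CARD('n) / \<rho>) ^ n / m ^ n)
      + 2 / c * (9 * b * (2 * pi) ^ CARD('n)) * (fact n / \<rho> ^ n) / (L * m ^ n)"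
  proof (intro add_mono order_refl)
    show "A / L * (2 * pi * CARD('n) / (\<rho> * m)) ^ n \<le> A / L * ((2 * pi * CARD('n) / \<rho>) ^ n / m ^ n)"
      by (simp add: power_divide power_mult_distrib)
    have "(\<rho> * m / L) ^ n / fact n \<le> exp (\<rho> * m / L)"
      using \<rho>' m L by (intro exp_ge_power_over_fact) auto
    then have "1 / exp (\<rho> * m / L) \<le> 1 / ((\<rho> * m / L) ^ n / fact n)"
      using \<rho>' m L by (intro frac_le) auto
    then have "exp (- (\<rho> * m / L)) \<le> fact n * L ^ n / (\<rho> ^ n * m ^ n)"
      by (simp add: exp_minus inverse_eq_divide power_divide power_mult_distrib mult_ac)
    then have "B * (9 * b * (2 * pi) ^ CARD('n) / L ^ CARD('n))
        \<le> (fact n * L ^ n / (\<rho> ^ n * m ^ n)) * (2 / c) * (9 * b * (2 * pi) ^ CARD('n) / L ^ CARD('n))"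
      unfolding B_def using c b L by (intro mult_right_mono) auto
    also have "\<dots> = 2 / c * (9 * b * (2 * pi) ^ CARD('n)) * (fact n / \<rho> ^ n) / (L * m ^ n)"
    proof -
      have "L ^ CARD('n) = L * L ^ n"
        unfolding n_def by (metis One_nat_def Suc_pred power_Suc zero_less_card_finite)
      then show ?thesis using L by (simp add: mult_ac)
    qed
    finally show "B * (9 * b * (2 * pi) ^ CARD('n) / L ^ CARD('n))
        \<le> 2 / c * (9 * b * (2 * pi) ^ CARD('n)) * (fact n / \<rho> ^ n) / (L * m ^ n)" .
  qed
  also have "\<dots> = decay_const CARD('n) b c cP \<rho> / (L * m ^ n)"
    unfolding decay_const_def n_def[symmetric] A_def by (simp add: add_divide_distrib)
  finally show ?thesis unfolding e_def m_def n_def .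
qed

section \<open>Expansion of the Green function\<close>

definition phase :: "int ^ 'n::finite \<Rightarrow> real ^ 'n \<Rightarrow> complex" where
  "phase x k = exp (- \<i> * of_real (k \<bullet> lat x))"

lemma norm_phase [simp]: "norm (phase x k) = 1" by (simp add: phase_def)

lemma phase_measurable [measurable]: "phase x \<in> borel_measurable borel"
  unfolding phase_def by (intro borel_measurable_continuous_onI continuous_intros)

lemma inverse_symbol_bound:
  fixes D :: "int ^ 'n::finite \<Rightarrow> real" and L :: real
  assumes K: "step_kernel b c L D" and k: "k \<in> torus"
  shows "norm (1 / (1 - fourier D k)) \<le> 1 / c * (1 + of_bool (L * norm k \<le> 1) / (L * norm k)\<^sup>2)"
    and "k \<noteq> 0 \<Longrightarrow> 1 - fourier D k \<noteq> 0"
proof -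
  have c: "0 < c" by (rule kernel_c[OF K])
  have L: "1 \<le> L" by (rule kernel_scale[OF K])
  have "c * min 1 (L\<^sup>2 * (norm k)\<^sup>2) \<le> Re (1 - fourier D k)"
    using kernel_infrared[OF K torus_le_pi[OF k]] by simp
  also have "\<dots> \<le> norm (1 - fourier D k)" by (rule complex_Re_le_cmod)
  finally have lb: "c * min 1 ((L * norm k)\<^sup>2) \<le> norm (1 - fourier D k)"
      by (simp add: power_mult_distrib)
  have pos: "0 < c * min 1 ((L * norm k)\<^sup>2)" if "k \<noteq> 0" using that c L by (intro mult_pos_pos) auto
  show "1 - fourier D k \<noteq> 0" if "k \<noteq> 0" using lb pos[OF that] by auto
  show "norm (1 / (1 - fourier D k)) \<le> 1 / c * (1 + of_bool (L * norm k \<le> 1) / (L * norm k)\<^sup>2)"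
  proof (cases "k = 0")
    case True
    then show ?thesis using c by (simp add: fourier_at_0[OF K])
  next
    case False
    have "norm (1 / (1 - fourier D k)) = 1 / norm (1 - fourier D k)" by (simp add: norm_divide)
    also have "\<dots> \<le> 1 / (c * min 1 ((L * norm k)\<^sup>2))"
      using lb pos[OF False] by (intro frac_le) auto
    also have "\<dots> \<le> 1 / c * (1 + of_bool (L * norm k \<le> 1) / (L * norm k)\<^sup>2)"
    proof (cases "L * norm k \<le> 1")
      case True
      then have "(L * norm k)\<^sup>2 \<le> 1" using L by (simp add: power_le_one)
      then show ?thesis using True c by (simp add: min_def distrib_left)
    next
      case False
      then have "1 \<le> (L * norm k)\<^sup>2" by (simp add: one_le_power)
      then show ?thesis using False by (simp add: min_def)
    qed
    finally show ?thesis .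
  qed
qed

lemma nn_integral_torus_singular_bound:
  fixes f :: "real ^ 'n::finite \<Rightarrow> complex" and L :: real
  assumes d: "CARD('n) > 2" and L: "0 < L" and a: "0 \<le> a" "0 \<le> a'"
    and g: "g \<in> borel_measurable borel" "(\<integral>\<^sup>+k\<in>torus. ennreal (g k) \<partial>lborel) \<le> ennreal B" "\<And>k. 0
        \<le> g k" "0 \<le> B"
    and f: "\<And>k. k \<in> torus \<Longrightarrow> norm (f k) \<le> a * g k + a' * (of_bool (L * norm k \<le> 1) / (L * norm k)\<^sup>2)"
  shows "(\<integral>\<^sup>+k. ennreal (norm (indicator torus k *\<^sub>R f k)) \<partial>lborel)
    \<le> ennreal (a * B + a' * ((2 / (1 - 2 / real CARD('n))) ^ CARD('n) / L ^ CARD('n)))"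
proof -
  note [measurable] = g(1)
  let ?h = "\<lambda>k :: real ^ 'n. of_bool (L * norm k \<le> 1) / (L * norm k)\<^sup>2 :: real"
  have C: "0 \<le> (2 / (1 - 2 / real CARD('n))) ^ CARD('n) / L ^ CARD('n)"
    using d L by (intro divide_nonneg_nonneg zero_le_power) auto
  have "(\<integral>\<^sup>+k. ennreal (norm (indicator torus k *\<^sub>R f k)) \<partial>lborel)
      \<le> (\<integral>\<^sup>+k. (ennreal a * (ennreal (g k) * indicator torus k) + ennreal a' * ennreal (?h k)) \<partial>lborel)"
  proof (rule nn_integral_mono)
    fix k :: "real ^ 'n"
    show "ennreal (norm (indicator torus k *\<^sub>R f k))
        \<le> ennreal a * (ennreal (g k) * indicator torus k) + ennreal a' * ennreal (?h k)"
    proof (cases "k \<in> torus")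
      case True
      have "ennreal (norm (f k)) \<le> ennreal (a * g k + a' * ?h k)"
        by (rule ennreal_leI) (rule f[OF True])
      also have "\<dots> = ennreal a * ennreal (g k) + ennreal a' * ennreal (?h k)"
      proof -
        have "0 \<le> ?h k" by simp
        then show ?thesis using a g(3)[of k] by (simp only: ennreal_plus mult_nonneg_nonneg ennreal_mult)
      qed
      finally show ?thesis using True by simp
    qed simp
  qed
  also have "\<dots> = ennreal a * (\<integral>\<^sup>+k\<in>torus. ennreal (g k) \<partial>lborel)
      + ennreal a' * (\<integral>\<^sup>+k. ennreal (?h k) \<partial>lborel)"
    by (simp add: nn_integral_add nn_integral_cmult)
  also have "\<dots> \<le> ennreal a * ennreal B + ennreal a' * ennreal ((2 / (1 - 2 / real CARD('n))) ^
      CARD('n) / L ^ CARD('n))"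
    using nn_integral_inverse_square_cutoff[OF d L] by (intro add_mono mult_left_mono g(2)) auto
  also have "\<dots> = ennreal (a * B + a' * ((2 / (1 - 2 / real CARD('n))) ^ CARD('n) / L ^ CARD('n)))"
    using a g(4) C by (simp only: ennreal_mult[symmetric] ennreal_plus[symmetric] mult_nonneg_nonneg)
  finally show ?thesis .
qed

lemma green_integrable:
  fixes D :: "int ^ 'n::finite \<Rightarrow> real" and L :: real
  assumes d: "CARD('n) > 2" and K: "step_kernel b c L D"
  shows "set_integrable lborel torus (\<lambda>k. phase x k / (1 - fourier D k))"
  unfolding set_integrable_def
proof (rule integrableI_bounded)
  note [measurable] = fourier_measurable_kernel[OF K]
  have L: "1 \<le> L" by (rule kernel_scale[OF K])
  have c: "0 < c" by (rule kernel_c[OF K])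
  show "(\<lambda>k. indicat_real torus k *\<^sub>R (phase x k / (1 - fourier D k))) \<in> borel_measurable lborel"
    by measurable
  have "(\<integral>\<^sup>+k. ennreal (norm (indicator torus k *\<^sub>R (phase x k / (1 - fourier D k)))) \<partial>lborel)
      \<le> ennreal (1 / c * (2 * pi) ^ CARD('n) + 1 / c * ((2 / (1 - 2 / real CARD('n))) ^ CARD('n) / L
          ^ CARD('n)))"
  proof (rule nn_integral_torus_singular_bound[OF d, where g = "\<lambda>_. 1"])
    fix k :: "real ^ 'n" assume "k \<in> torus"
    from inverse_symbol_bound(1)[OF K this]
    show "norm (phase x k / (1 - fourier D k)) \<le> 1 / c * 1 + 1 / c * (of_bool (L * norm k
        \<le> 1) / (L * norm k)\<^sup>2)"
      by (simp add: norm_divide distrib_left)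
  qed (use L c in \<open>auto simp: emeasure_torus\<close>)
  also have "\<dots> < \<infinity>" by simp
  finally show "(\<integral>\<^sup>+k. ennreal (norm (indicator torus k *\<^sub>R (phase x k / (1 - fourier D k))))
      \<partial>lborel) < \<infinity>" .
qed

lemma green_remainder_bound:
  fixes D :: "int ^ 'n::finite \<Rightarrow> real" and L :: real
  assumes d: "CARD('n) > 2" and K: "step_kernel b c L D"
  shows "set_integrable lborel torus (\<lambda>k. phase x k * ((fourier D k)\<^sup>2 / (1 - fourier D k)))"
    and "norm (LINT k:torus|lborel. phase x k * ((fourier D k)\<^sup>2 / (1 - fourier D k)))
      \<le> 9 / c * (b * (2 * pi) ^ CARD('n) + (2 / (1 - 2 / real CARD('n))) ^ CARD('n)) / L ^ CARD('n)"
proof -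
  note [measurable] = fourier_measurable_kernel[OF K]
  have L: "1 \<le> L" by (rule kernel_scale[OF K])
  have c: "0 < c" by (rule kernel_c[OF K])
  have b: "0 \<le> b" by (rule kernel_bound_nonneg[OF K])
  define C where "C = (2 / (1 - 2 / real CARD('n))) ^ CARD('n)"
  have C: "0 \<le> C" unfolding C_def using d by (intro zero_le_power) auto
  have bd: "(\<integral>\<^sup>+k. ennreal (norm (indicator torus k *\<^sub>R (phase x k * ((fourier D k)\<^sup>2 / (1 - fourier
      D k))))) \<partial>lborel)
      \<le> ennreal (1 / c * (9 * b * (2 * pi) ^ CARD('n) / L ^ CARD('n)) + 9 / c * (C / L ^ CARD('n)))"
    unfolding C_def
  proof (rule nn_integral_torus_singular_bound[OF d, where g = "\<lambda>k. (norm (fourier D k))\<^sup>2"])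
    show "(\<integral>\<^sup>+k\<in>torus. ennreal ((norm (fourier D k))\<^sup>2) \<partial>lborel)
        \<le> ennreal (9 * b * (2 * pi) ^ CARD('n) / L ^ CARD('n))"
      using nn_integral_torus_fourier_tilt[OF K, of 0 undefined] by simp
    fix k :: "real ^ 'n" assume k: "k \<in> torus"
    let ?h = "of_bool (L * norm k \<le> 1) / (L * norm k)\<^sup>2 :: real"
    have F: "norm (fourier D k) \<le> 3" using fourier_tilt_bound[OF K, of 0 undefined] by simp
    have "norm (phase x k * ((fourier D k)\<^sup>2 / (1 - fourier D k)))
        = (norm (fourier D k))\<^sup>2 * norm (1 / (1 - fourier D k))"
      by (simp add: norm_mult norm_divide norm_power)
    also have "\<dots> \<le> (norm (fourier D k))\<^sup>2 * (1 / c * (1 + ?h))"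
      by (intro mult_left_mono inverse_symbol_bound(1)[OF K k]) auto
    also have "\<dots> = 1 / c * (norm (fourier D k))\<^sup>2 + (norm (fourier D k))\<^sup>2 / c * ?h"
      by (simp add: distrib_left mult_ac)
    also have "\<dots> \<le> 1 / c * (norm (fourier D k))\<^sup>2 + 9 / c * ?h"
      using power_mono[OF F, of 2] c by (intro add_left_mono mult_right_mono divide_right_mono) auto
    finally show "norm (phase x k * ((fourier D k)\<^sup>2 / (1 - fourier D k)))
        \<le> 1 / c * (norm (fourier D k))\<^sup>2 + 9 / c * ?h" .
  qed (use L c b in auto)
  have int: "integrable lborel (\<lambda>k. indicator torus k *\<^sub>R (phase x k * ((fourier D k)\<^sup>2 / (1 -
      fourier D k))))"
  proof (rule integrableI_bounded)
    show "(\<integral>\<^sup>+k. ennreal (norm (indicator torus k *\<^sub>R (phase x k * ((fourier D k)\<^sup>2 / (1 - fourier D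
        k))))) \<partial>lborel) < \<infinity>"
      by (rule le_less_trans[OF bd]) simp
  qed measurable
  then show "set_integrable lborel torus (\<lambda>k. phase x k * ((fourier D k)\<^sup>2 / (1 - fourier D k)))"
    by (simp add: set_integrable_def)
  have "ennreal (norm (LINT k:torus|lborel. phase x k * ((fourier D k)\<^sup>2 / (1 - fourier D k))))
      \<le> ennreal (1 / c * (9 * b * (2 * pi) ^ CARD('n) / L ^ CARD('n)) + 9 / c * (C / L ^ CARD('n)))"
    unfolding set_lebesgue_integral_def by (rule order_trans[OF integral_norm_bound_ennreal[OF int] bd])
  then have "norm (LINT k:torus|lborel. phase x k * ((fourier D k)\<^sup>2 / (1 - fourier D k)))
      \<le> 1 / c * (9 * b * (2 * pi) ^ CARD('n) / L ^ CARD('n)) + 9 / c * (C / L ^ CARD('n))"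
    using C L b c by (subst (asm) ennreal_le_iff) auto
  also have "\<dots> = 9 / c * (b * (2 * pi) ^ CARD('n) + C) / L ^ CARD('n)"
    by (simp add: add_divide_distrib distrib_left)
  finally show "norm (LINT k:torus|lborel. phase x k * ((fourier D k)\<^sup>2 / (1 - fourier D k)))
      \<le> 9 / c * (b * (2 * pi) ^ CARD('n) + (2 / (1 - 2 / real CARD('n))) ^ CARD('n)) / L ^ CARD('n)"
    by (simp only: C_def)
qed

lemma phase_times_exp: "phase x k * exp (\<i> * of_real (k \<bullet> lat y)) = exp (\<i> * of_real (k \<bullet> lat (y - x)))"
proof -
  have "lat (y - x) = lat y - lat x" by (simp add: lat_def vec_eq_iff)
  then have "k \<bullet> lat (y - x) = k \<bullet> lat y - k \<bullet> lat x" by (simp only: inner_diff_right)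
  then show ?thesis unfolding phase_def exp_add[symmetric] by (simp add: right_diff_distrib)
qed

text \<open>
  The identity \<open>1 / (1 - u) = 1 + u + u\<^sup>2 / (1 - u)\<close>; the first two terms are trigonometric
  polynomials, whose Fourier coefficients are read off.
\<close>

lemma green_expansion:
  fixes D :: "int ^ 'n::finite \<Rightarrow> real" and L :: real
  assumes d: "CARD('n) > 2" and K: "step_kernel b c L D"
  shows "(LINT k:torus|lborel. phase x k / (1 - fourier D k))
    = (2 * of_real pi) ^ CARD('n) * of_real (of_bool (x = 0) + D x)
      + (LINT k:torus|lborel. phase x k * ((fourier D k)\<^sup>2 / (1 - fourier D k)))"
proof -
  note [measurable] = fourier_measurable_kernel[OF K]
  let ?E = "\<lambda>y k. exp (\<i> * of_real (k \<bullet> lat (y - x))) :: complex"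
  have Ei: "set_integrable lborel torus (?E y)" for y
    by (rule set_integrable_torus_bounded[where B = 1]) auto
  have E: "(LINT k:torus|lborel. ?E y k) = of_bool (y = x) * (2 * of_real pi) ^ CARD('n)" for y
    unfolding integral_torus_exp by simp
  have F: "phase x k * fourier D k = (\<Sum>y\<in>lbox L. of_real (D y) * ?E y k)" for k
  proof -
    have "fourier D k = (\<Sum>y\<in>lbox L. of_real (D y) * exp (\<i> * of_real (k \<bullet> lat y)))"
      by (rule fourier_lbox) (rule kernel_supp[OF K])
    then have "phase x k * fourier D k = (\<Sum>y\<in>lbox L. phase x k * (of_real (D y) * exp (\<i> * of_real
        (k \<bullet> lat y))))"
      by (simp only: sum_distrib_left)
    also have "\<dots> = (\<Sum>y\<in>lbox L. of_real (D y) * ?E y k)"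
      by (intro sum.cong refl) (subst mult.left_commute, subst phase_times_exp, rule refl)
    finally show ?thesis .
  qed
  have p0: "phase x k = ?E 0 k" for k
  proof -
    have "lat (0 :: int ^ 'n) = 0" by (simp add: lat_def vec_eq_iff)
    then have "phase x k * exp (\<i> * of_real (k \<bullet> lat 0)) = phase x k" by simp
    then show ?thesis unfolding phase_times_exp by (rule sym)
  qed
  have i1: "set_integrable lborel torus (\<lambda>k. of_real (D y) * ?E y k)" for y
    using Ei by (rule set_integrable_mult_right)
  have i2: "set_integrable lborel torus (\<lambda>k. phase x k * fourier D k)"
    unfolding F by (rule set_integral_sum(2)) (rule i1)
  have i3: "set_integrable lborel torus (phase x)" using Ei[of 0] unfolding p0[abs_def] .
  have I2: "(LINT k:torus|lborel. phase x k * fourier D k) = of_real (D x) * (2 * of_real pi) ^ CARD('n)"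
  proof -
    have "(LINT k:torus|lborel. phase x k * fourier D k)
        = (\<Sum>y\<in>lbox L. LINT k:torus|lborel. of_real (D y) * ?E y k)"
      unfolding F by (rule set_integral_sum(1)) (rule i1)
    also have "\<dots> = (\<Sum>y\<in>lbox L. if y = x then of_real (D x) * (2 * of_real pi) ^ CARD('n) else 0)"
      by (intro sum.cong refl) (simp add: E)
    also have "\<dots> = of_real (D x) * (2 * of_real pi) ^ CARD('n)"
      using kernel_supp[OF K, of x] by (auto simp: sum.delta)
    finally show ?thesis .
  qed
  have I3: "(LINT k:torus|lborel. phase x k) = of_bool (x = 0) * (2 * of_real pi) ^ CARD('n)"
    unfolding p0 E by (simp only: eq_commute[of 0 x])
  have "(LINT k:torus|lborel. phase x k / (1 - fourier D k))
      = (LINT k:torus|lborel. (phase x k + phase x k * fourier D k) + phase x k * ((fourier D k)\<^sup>2 /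
          (1 - fourier D k)))"
  proof (rule set_lebesgue_integral_cong_AE)
    show "AE k \<in> torus in lborel. phase x k / (1 - fourier D k)
        = (phase x k + phase x k * fourier D k) + phase x k * ((fourier D k)\<^sup>2 / (1 - fourier D k))"
      using AE_lborel_singleton[of 0]
    proof eventually_elim
      case (elim k)
      show ?case
      proof
        assume k: "k \<in> torus"
        have nz: "1 - fourier D k \<noteq> 0" by (rule inverse_symbol_bound(2)[OF K k elim])
        have "p / (1 - u) = (p + p * u) + p * (u\<^sup>2 / (1 - u))" if "1 - u \<noteq> 0" for p u :: complex
        proof -
          have "(p + p * u) * (1 - u) + p * u\<^sup>2 = p" by (simp add: algebra_simps power2_eq_square)
          moreover have "(p + p * u) + p * (u\<^sup>2 / (1 - u)) = ((p + p * u) * (1 - u) + p * u\<^sup>2) / (1 - u)"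
            using that by (simp add: add_divide_distrib)
          ultimately show ?thesis by simp
        qed
        then show "phase x k / (1 - fourier D k)
          = (phase x k + phase x k * fourier D k) + phase x k * ((fourier D k)\<^sup>2 / (1 - fourier D k))"
          using nz by blast
      qed
    qed
  qed measurable
  also have "\<dots> = (LINT k:torus|lborel. phase x k) + (LINT k:torus|lborel. phase x k * fourier D k)
      + (LINT k:torus|lborel. phase x k * ((fourier D k)\<^sup>2 / (1 - fourier D k)))"
    using set_integral_add(2)[OF set_integral_add(1)[OF i3 i2] green_remainder_bound(1)[OF d K, of x]]
      set_integral_add(2)[OF i3 i2] by simp
  finally show ?thesis unfolding I2 I3 by (simp add: algebra_simps)
qed

lemma green_eq_phase: "green f x = Re (LINT k:torus|lborel. phase x k / (1 - fourier f k)) / (2 *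
    pi) ^ CARD('n)"
  for f :: "int ^ 'n::finite \<Rightarrow> real"
proof -
  have "(2 * complex_of_real pi) ^ CARD('n) = of_real ((2 * pi) ^ CARD('n))" by simp
  then show ?thesis unfolding green_def green_integral_def phase_def by (simp only: Re_divide_of_real)
qed

lemma two_pi_power_ge_1: "1 \<le> (2 * pi) ^ n"
  using pi_gt3 by (intro one_le_power) simp

lemma green_local_bound:
  fixes D :: "int ^ 'n::finite \<Rightarrow> real" and L :: real
  assumes d: "CARD('n) > 2" and K: "step_kernel b c L D"
  shows "\<bar>green D x - of_bool (x = 0) - D x\<bar>
    \<le> 9 / c * (b * (2 * pi) ^ CARD('n) + (2 / (1 - 2 / real CARD('n))) ^ CARD('n)) / L ^ CARD('n)"
proof -
  let ?R = "LINT k:torus|lborel. phase x k * ((fourier D k)\<^sup>2 / (1 - fourier D k))"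
  have "(2 * complex_of_real pi) ^ CARD('n) = of_real ((2 * pi) ^ CARD('n))" by simp
  then have "green D x = of_bool (x = 0) + D x + Re ?R / (2 * pi) ^ CARD('n)"
    unfolding green_eq_phase green_expansion[OF d K]
        by (simp add: add_divide_distrib del: of_real_add of_real_power)
  then have "\<bar>green D x - of_bool (x = 0) - D x\<bar> = \<bar>Re ?R\<bar> / (2 * pi) ^ CARD('n)" by simp
  also have "\<dots> \<le> \<bar>Re ?R\<bar> / 1"
    by (intro divide_left_mono two_pi_power_ge_1) auto
  also have "\<dots> \<le> norm ?R" by (simp add: abs_Re_le_cmod)
  also note green_remainder_bound(2)[OF d K, of x]
  finally show ?thesis .
qed

lemma green_decay_bound:
  fixes D P :: "int ^ 'n::finite \<Rightarrow> real" and L :: real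
  assumes d: "CARD('n) > 2"
    and K: "step_kernel b c L D" and KP: "step_kernel bP cP 1 P" and vP: "variance P = 1"
    and \<rho>: "admissible_tilt CARD('n) c cP \<rho>" and x: "x $ j \<noteq> 0"
  shows "\<bar>green D x - of_bool (x = 0) - D x - 1 / variance D * green P x\<bar>
    \<le> decay_const CARD('n) b c cP \<rho> / (L * \<bar>real_of_int (x $ j)\<bar> ^ (CARD('n) - 1))"
proof -
  let ?R = "LINT k:torus|lborel. phase x k * ((fourier D k)\<^sup>2 / (1 - fourier D k))"
  let ?Q = "LINT k:torus|lborel. phase x k / (1 - fourier P k)"
  let ?I = "LINT k:torus|lborel. phase x k * symbol_error (variance D) (fourier D k) (fourier P k)"
  let ?v = "complex_of_real (variance D)"
  have "phase x k * symbol_error (variance D) (fourier D k) (fourier P k)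
      = phase x k * ((fourier D k)\<^sup>2 / (1 - fourier D k)) - 1 / ?v * (phase x k / (1 - fourier P
          k))" for k
    by (simp add: symbol_error_def right_diff_distrib)
  then have "?I = (LINT k:torus|lborel. phase x k * ((fourier D k)\<^sup>2 / (1 - fourier D k))
      - 1 / ?v * (phase x k / (1 - fourier P k)))"
    by (simp only:)
  also have "\<dots> = ?R - (LINT k:torus|lborel. 1 / ?v * (phase x k / (1 - fourier P k)))"
    by (rule set_integral_diff(2)[OF green_remainder_bound(1)[OF d K]
        set_integrable_mult_right[OF green_integrable[OF d KP]]])
  also have "(LINT k:torus|lborel. 1 / ?v * (phase x k / (1 - fourier P k))) = 1 / ?v * ?Q"
    by (rule set_integral_mult_right)
  finally have I: "?I = ?R - 1 / ?v * ?Q" .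
  have "(2 * complex_of_real pi) ^ CARD('n) = of_real ((2 * pi) ^ CARD('n))" by simp
  then have 1: "green D x = of_bool (x = 0) + D x + Re ?R / (2 * pi) ^ CARD('n)"
    unfolding green_eq_phase green_expansion[OF d K]
        by (simp add: add_divide_distrib del: of_real_add of_real_power)
  have "1 / ?v = of_real (1 / variance D)" by simp
  then have "Re (1 / ?v * ?Q) = 1 / variance D * Re ?Q"
    by (simp only: Re_complex_of_real Im_complex_of_real times_complex.simps)
  then have 2: "1 / variance D * green P x = Re (1 / ?v * ?Q) / (2 * pi) ^ CARD('n)"
    unfolding green_eq_phase by (simp only: times_divide_eq_right)
  have 3: "Re ?I = Re ?R - Re (1 / ?v * ?Q)" by (simp only: I minus_complex.simps)
  have "green D x - of_bool (x = 0) - D x - 1 / variance D * green P x = Re ?I / (2 * pi) ^ CARD('n)"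
    unfolding 1 2 3 by (simp only: diff_divide_distrib)
  then have "\<bar>green D x - of_bool (x = 0) - D x - 1 / variance D * green P x\<bar>
      = \<bar>Re ?I\<bar> / (2 * pi) ^ CARD('n)" by simp
  also have "\<dots> \<le> \<bar>Re ?I\<bar> / 1"
    by (intro divide_left_mono two_pi_power_ge_1) auto
  also have "\<dots> \<le> norm ?I" by (simp add: abs_Re_le_cmod)
  also have "\<dots> \<le> decay_const CARD('n) b c cP \<rho> / (L * \<bar>real_of_int (x $ j)\<bar> ^ (CARD('n) - 1))"
    unfolding phase_def by (rule error_fourier_decay[OF d K KP vP \<rho> x])
  finally show ?thesis .
qed

section \<open>Estimates uniform over step kernels\<close>

lemma max_component:
  fixes y :: "real ^ 'n::finite"
  obtains j where "\<And>i. \<bar>y $ i\<bar> \<le> \<bar>y $ j\<bar>" "norm y \<le> real CARD('n) * \<bar>y $ j\<bar>"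
proof -
  have "Max (range (\<lambda>i. \<bar>y $ i\<bar>)) \<in> range (\<lambda>i. \<bar>y $ i\<bar>)" by (rule Max_in) auto
  then obtain j where "Max (range (\<lambda>i. \<bar>y $ i\<bar>)) = \<bar>y $ j\<bar>" by blast
  then have j: "\<bar>y $ i\<bar> \<le> \<bar>y $ j\<bar>" for i
    using Max_ge[of "range (\<lambda>i. \<bar>y $ i\<bar>)" "\<bar>y $ i\<bar>"] by simp
  have "norm y \<le> (\<Sum>i\<in>UNIV. \<bar>y $ i\<bar>)" by (rule norm_le_l1_cart)
  also have "\<dots> \<le> (\<Sum>i\<in>(UNIV :: 'n set). \<bar>y $ j\<bar>)" by (intro sum_mono j)
  finally show ?thesis using j by (intro that[of j]) auto
qed

lemma tnorm_pos: "1 \<le> tnorm y" "0 < tnorm y" "norm y \<le> tnorm y"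
  by (auto simp: tnorm_def)

lemma tnorm_lat_nonzero:
  fixes x :: "int ^ 'n::finite"
  assumes "x \<noteq> 0" shows "tnorm (lat x) = norm (lat x)"
proof -
  obtain j where "x $ j \<noteq> 0" using assms by (auto simp: vec_eq_iff)
  then have "1 \<le> \<bar>lat x $ j\<bar>" by (simp add: lat_def)
  also have "\<dots> \<le> norm (lat x)" by (rule component_le_norm_cart)
  finally show ?thesis by (simp add: tnorm_def)
qed

text \<open>
  Where \<open>D\<close> does not vanish, \<open>|x| \<le> d L\<close>, so that \<open>L\<^sup>-\<^sup>d\<close> is at most a multiple of the
  right-hand side.
\<close>

lemma kernel_local_decay:
  fixes D :: "int ^ 'n::finite \<Rightarrow> real" and L :: real
  assumes K: "step_kernel b c L D"
  shows "D x \<le> b * real CARD('n) ^ (CARD('n) - 1) / (L * tnorm (lat x) ^ (CARD('n) - 1))"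
proof -
  define n where "n = CARD('n) - 1"
  have L: "1 \<le> L" by (rule kernel_scale[OF K])
  have b: "0 \<le> b" by (rule kernel_bound_nonneg[OF K])
  have C1: "1 \<le> real CARD('n)" by (simp add: Suc_leI)
  show "D x \<le> b * real CARD('n) ^ (CARD('n) - 1) / (L * tnorm (lat x) ^ (CARD('n) - 1))"
  proof (cases "x \<in> lbox L")
    case True
    have "1 \<le> real CARD('n) * L" using C1 L by (intro mult_ge1_I) auto
    then have t: "tnorm (lat x) \<le> real CARD('n) * L" using norm_lat_lbox[OF True]
        by (simp add: tnorm_def)
    have "tnorm (lat x) ^ n \<le> (real CARD('n) * L) ^ n"
      using t tnorm_pos(2)[of "lat x"] by (intro power_mono) auto
    then have t': "L * tnorm (lat x) ^ n \<le> real CARD('n) ^ n * L ^ CARD('n)"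
    proof -
      assume h: "tnorm (lat x) ^ n \<le> (real CARD('n) * L) ^ n"
      have "L ^ CARD('n) = L * L ^ n"
        unfolding n_def by (metis One_nat_def Suc_pred power_Suc zero_less_card_finite)
      then show ?thesis using mult_left_mono[OF h, of L] L by (simp add: power_mult_distrib mult_ac)
    qed
    have "D x \<le> b / L ^ CARD('n)" by (rule kernel_le[OF K])
    also have "\<dots> = b * real CARD('n) ^ n / (real CARD('n) ^ n * L ^ CARD('n))" by simp
    also have "\<dots> \<le> b * real CARD('n) ^ n / (L * tnorm (lat x) ^ n)"
      using t' b C1 L tnorm_pos(2)[of "lat x"] by (intro divide_left_mono) auto
    finally show ?thesis unfolding n_def .
  next
    case False
    have "0 \<le> b * real CARD('n) ^ (CARD('n) - 1) / (L * tnorm (lat x) ^ (CARD('n) - 1))"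
      using b L tnorm_pos(2)[of "lat x"] by (intro divide_nonneg_nonneg mult_nonneg_nonneg) auto
    then show ?thesis using kernel_supp[OF K False] by simp
  qed
qed

lemma green_local_estimate:
  fixes b c :: real
  assumes d: "CARD('n::finite) > 2"
  shows "\<exists>K0\<ge>0. \<forall>L (D :: int ^ 'n \<Rightarrow> real) x. step_kernel b c L D \<longrightarrow>
    \<bar>green D x - of_bool (x = 0)\<bar> \<le> K0 / L ^ CARD('n)"
proof -
  define K1 where "K1 = 9 / c * (b * (2 * pi) ^ CARD('n) + (2 / (1 - 2 / real CARD('n))) ^ CARD('n))"
  have "\<bar>green D x - of_bool (x = 0)\<bar> \<le> max 0 (b + K1) / L ^ CARD('n)"
    if K: "step_kernel b c L D" for L and D :: "int ^ 'n \<Rightarrow> real" and x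
  proof -
    have L: "1 \<le> L" by (rule kernel_scale[OF K])
    have "\<bar>green D x - of_bool (x = 0) - D x\<bar> \<le> K1 / L ^ CARD('n)"
      unfolding K1_def by (rule green_local_bound[OF d K])
    moreover have "D x \<le> b / L ^ CARD('n)" "0 \<le> D x" by (rule kernel_le[OF K], rule kernel_nonneg[OF K])
    ultimately have "\<bar>green D x - of_bool (x = 0)\<bar> \<le> (b + K1) / L ^ CARD('n)"
      unfolding add_divide_distrib by linarith
    also have "\<dots> \<le> max 0 (b + K1) / L ^ CARD('n)" using L by (intro divide_right_mono) auto
    finally show ?thesis .
  qed
  then show ?thesis by (intro exI[of _ "max 0 (b + K1)"]) auto
qed

text \<open>
  For \<open>x \<noteq> 0\<close> the decay bound is used for the largest component of \<open>x\<close>, which is comparable to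
  \<open>|x|\<close>. At the origin the local estimate suffices, as \<open>\<sigma>\<^sup>-\<^sup>2 = O(L\<^sup>-\<^sup>2)\<close>.
\<close>

lemma green_comparison_estimate:
  fixes b c :: real and P :: "int ^ 'n::finite \<Rightarrow> real"
  assumes d: "CARD('n) > 2" and KP: "step_kernel bP cP 1 P" and vP: "variance P = 1" and c: "0 < c"
  shows "\<exists>K\<ge>0. \<forall>L (D :: int ^ 'n \<Rightarrow> real) x. step_kernel b c L D \<longrightarrow>
    \<bar>green D x - of_bool (x = 0) - 1 / variance D * green P x\<bar> \<le> K / (L * tnorm (lat x) ^ (CARD('n)
        - 1))"
proof -
  define n where "n = CARD('n) - 1"
  define N where "N = real CARD('n)"
  have N: "1 \<le> N" by (simp add: N_def Suc_leI)
  obtain \<rho> where \<rho>: "admissible_tilt CARD('n) c cP \<rho>"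
    using admissible_tilt_exists[OF c kernel_c[OF KP], of "real CARD('n)"] by (auto simp: Suc_leI)
  obtain K0 where K0: "0 \<le> K0" "\<And>L (D :: int ^ 'n \<Rightarrow> real) x. step_kernel b c L D \<Longrightarrow>
    \<bar>green D x - of_bool (x = 0)\<bar> \<le> K0 / L ^ CARD('n)"
    using green_local_estimate[OF d, of b c] by blast
  define K1 where "K1 = max 0 (decay_const CARD('n) b c cP \<rho>)"
  define K2 where "K2 = b * N ^ n + K1 * N ^ n"
  define K3 where "K3 = K0 + \<bar>green P 0\<bar> / (2 * N * c)"
  have K3: "0 \<le> K3" using K0 N c by (auto simp: K3_def intro!: add_nonneg_nonneg divide_nonneg_nonneg)
  have main: "\<bar>green D x - of_bool (x = 0) - 1 / variance D * green P x\<bar>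
      \<le> max 0 (max K2 K3) / (L * tnorm (lat x) ^ n)"
    if K: "step_kernel b c L D" for L and D :: "int ^ 'n \<Rightarrow> real" and x
  proof -
    have L: "1 \<le> L" by (rule kernel_scale[OF K])
    have pos: "0 < L * tnorm (lat x) ^ n" using L tnorm_pos(2)[of "lat x"] by simp
    have "\<bar>green D x - of_bool (x = 0) - 1 / variance D * green P x\<bar>
        \<le> max K2 K3 / (L * tnorm (lat x) ^ n)"
    proof (cases "x = 0")
      case True
      have t: "tnorm (lat x) = 1" using True by (simp add: tnorm_def lat_def zero_vec_def[symmetric])
      have v: "2 * N * c * L\<^sup>2 \<le> variance D" unfolding N_def by (rule kernel_variance_lower[OF K])
      have "L * 1 \<le> L * L" using L by (intro mult_left_mono) auto
      then have "2 * N * c * L \<le> 2 * N * c * L\<^sup>2" using N c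
          by (intro mult_left_mono) (auto simp: power2_eq_square)
      then have v': "2 * N * c * L \<le> variance D" using v by linarith
      have p: "0 < 2 * N * c * L" using N c L by simp
      have vp: "0 < variance D" using v' p by linarith
      have "\<bar>1 / variance D * green P x\<bar> = \<bar>green P 0\<bar> / variance D"
        using vp True by (simp add: abs_mult)
      also have "\<dots> \<le> \<bar>green P 0\<bar> / (2 * N * c * L)"
        using v' p by (intro frac_le) auto
      finally have a: "\<bar>1 / variance D * green P x\<bar> \<le> \<bar>green P 0\<bar> / (2 * N * c) / L" by simp
      have "L ^ 1 \<le> L ^ CARD('n)" using L d by (intro power_increasing) auto
      then have "K0 / L ^ CARD('n) \<le> K0 / L" using L K0(1) by (intro divide_left_mono) auto
      with K0(2)[OF K, of x] a
      have "\<bar>green D x - of_bool (x = 0) - 1 / variance D * green P x\<bar> \<le> K3 / L"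
        unfolding K3_def add_divide_distrib by linarith
      also have "\<dots> \<le> max K2 K3 / L" using L by (intro divide_right_mono) auto
      finally show ?thesis by (simp add: t)
    next
      case False
      obtain j where j: "norm (lat x) \<le> N * \<bar>real_of_int (x $ j)\<bar>"
        using max_component[of "lat x"] by (auto simp: N_def lat_def)
      have t: "tnorm (lat x) = norm (lat x)" by (rule tnorm_lat_nonzero[OF False])
      have "0 < N * \<bar>real_of_int (x $ j)\<bar>" using j t tnorm_pos(2)[of "lat x"] by linarith
      then have xj: "x $ j \<noteq> 0" by auto
      have "tnorm (lat x) ^ n \<le> (N * \<bar>real_of_int (x $ j)\<bar>) ^ n" unfolding t using j
          by (intro power_mono) auto
      then have "L * tnorm (lat x) ^ n \<le> N ^ n * (L * \<bar>real_of_int (x $ j)\<bar> ^ n)"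
        using L mult_left_mono[of "tnorm (lat x) ^ n" "(N * \<bar>real_of_int (x $ j)\<bar>) ^ n" L]
            by (simp add: power_mult_distrib mult_ac)
      then have le: "K1 * N ^ n / (N ^ n * (L * \<bar>real_of_int (x $ j)\<bar> ^ n))
          \<le> K1 * N ^ n / (L * tnorm (lat x) ^ n)"
        using pos N by (intro frac_le) (auto simp: K1_def)
      have "\<bar>green D x - of_bool (x = 0) - D x - 1 / variance D * green P x\<bar>
          \<le> decay_const CARD('n) b c cP \<rho> / (L * \<bar>real_of_int (x $ j)\<bar> ^ n)"
        unfolding n_def by (rule green_decay_bound[OF d K KP vP \<rho> xj])
      also have "\<dots> \<le> K1 / (L * \<bar>real_of_int (x $ j)\<bar> ^ n)"
        using L unfolding K1_def by (intro divide_right_mono) auto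
      also have "\<dots> = K1 * N ^ n / (N ^ n * (L * \<bar>real_of_int (x $ j)\<bar> ^ n))" using N by simp
      also note le
      finally have "\<bar>green D x - of_bool (x = 0) - D x - 1 / variance D * green P x\<bar>
          \<le> K1 * N ^ n / (L * tnorm (lat x) ^ n)" .
      moreover have "D x \<le> b * N ^ n / (L * tnorm (lat x) ^ n)" unfolding N_def n_def
          by (rule kernel_local_decay[OF K])
      moreover have "0 \<le> D x" by (rule kernel_nonneg[OF K])
      ultimately have "\<bar>green D x - of_bool (x = 0) - 1 / variance D * green P x\<bar>
          \<le> K2 / (L * tnorm (lat x) ^ n)"
        unfolding K2_def add_divide_distrib by linarith
      also have "\<dots> \<le> max K2 K3 / (L * tnorm (lat x) ^ n)" using pos by (intro divide_right_mono) auto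
      finally show ?thesis .
    qed
    also have "\<dots> \<le> max 0 (max K2 K3) / (L * tnorm (lat x) ^ n)" using pos
        by (intro divide_right_mono) auto
    finally show ?thesis .
  qed
  show ?thesis unfolding n_def[symmetric]
    by (rule exI[of _ "max 0 (max K2 K3)"]) (use main in auto)
qed

text \<open>
  The nearest-neighbour Green function does not depend on \<open>L\<close>, so it may be estimated at the
  scale \<open>L = |x|\<close>: there the first bound and the local estimate give \<open>\<sigma>\<^sup>-\<^sup>2 C(x) = O(|x|\<^sup>-\<^sup>d)\<close>,
  that is \<open>C(x) = O(|x|\<^sup>2\<^sup>-\<^sup>d)\<close>. The second bound then follows for \<open>|x| > L\<close> from the first one,
  and for \<open>|x| \<le> L\<close> from the local estimate.
\<close>

theorem green_estimates:
  fixes P :: "int ^ 'n::finite \<Rightarrow> real" and D :: "real \<Rightarrow> int ^ 'n \<Rightarrow> real"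
  assumes d: "CARD('n) > 2" and KP: "step_kernel bP cP 1 P" and vP: "variance P = 1" and c: "0 < c"
    and L0: "1 \<le> L0" and KD: "\<And>L. L0 \<le> L \<Longrightarrow> step_kernel b c L (D L)"
  shows "\<exists>K KS. 0 \<le> K \<and> 0 \<le> KS \<and> (\<forall>L\<ge>L0. \<forall>x.
    \<bar>green (D L) x - of_bool (x = 0) - 1 / variance (D L) * green P x\<bar> \<le> K / (L * tnorm (lat x) ^
        (CARD('n) - 1)) \<and>
    green (D L) x \<le> of_bool (x = 0) + KS / (L\<^sup>2 * tnorm (lat x) ^ (CARD('n) - 2)))"
proof -
  define n where "n = CARD('n) - 2"
  define N where "N = real CARD('n)"
  have N: "1 \<le> N" by (simp add: N_def Suc_leI)
  have dn: "CARD('n) - 1 = Suc n" "CARD('n) = Suc (Suc n)" using d by (auto simp: n_def)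
  obtain K0 where K0: "0 \<le> K0" "\<And>L (D :: int ^ 'n \<Rightarrow> real) x. step_kernel b c L D \<Longrightarrow>
    \<bar>green D x - of_bool (x = 0)\<bar> \<le> K0 / L ^ CARD('n)"
    using green_local_estimate[OF d, of b c] by blast
  obtain K where K: "0 \<le> K" "\<And>L (D :: int ^ 'n \<Rightarrow> real) x. step_kernel b c L D \<Longrightarrow>
    \<bar>green D x - of_bool (x = 0) - 1 / variance D * green P x\<bar> \<le> K / (L * tnorm (lat x) ^ (CARD('n)
        - 1))"
    using green_comparison_estimate[OF d KP vP c, of b] by blast
  have var: "0 < variance (D L)" "variance (D L) \<le> N\<^sup>2 * L\<^sup>2" "2 * N * c * L\<^sup>2 \<le> variance (D L)"
      if "L0 \<le> L" for L
  proof -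
    show l: "2 * N * c * L\<^sup>2 \<le> variance (D L)" unfolding N_def
        by (rule kernel_variance_lower[OF KD[OF that]])
    have "0 < 2 * N * c * L\<^sup>2" using N c L0 that by (intro mult_pos_pos) auto
    then show "0 < variance (D L)" using l by linarith
    show "variance (D L) \<le> N\<^sup>2 * L\<^sup>2" using kernel_variance_upper[OF KD[OF that]]
        by (simp add: N_def power_mult_distrib)
  qed
  define K4 where "K4 = N\<^sup>2 * (K0 + K)"
  have K4: "0 \<le> K4" using K0 K by (simp add: K4_def)
  have P: "\<bar>green P x\<bar> \<le> K4 / t ^ n" if t: "t = tnorm (lat x)" "L0 \<le> t" "x \<noteq> 0" for x t
  proof -
    have t0: "0 < t" using L0 t by simp
    have "\<bar>green (D t) x\<bar> \<le> K0 / t ^ CARD('n)" using K0(2)[OF KD[OF t(2)], of x] t(3) by simp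
    moreover have "\<bar>green (D t) x - 1 / variance (D t) * green P x\<bar> \<le> K / t ^ CARD('n)"
      using K(2)[OF KD[OF t(2)], of x] t(3) unfolding dn(1) t(1)[symmetric] dn(2) by simp
    ultimately have "\<bar>1 / variance (D t) * green P x\<bar> \<le> (K0 + K) / t ^ CARD('n)"
      unfolding add_divide_distrib by linarith
    then have "variance (D t) * \<bar>1 / variance (D t) * green P x\<bar> \<le> variance (D t) * ((K0
        + K) / t ^ CARD('n))"
      using var(1)[OF t(2)] by (intro mult_left_mono) auto
    moreover have "variance (D t) * \<bar>1 / variance (D t) * green P x\<bar> = \<bar>green P x\<bar>"
      using var(1)[OF t(2)] by (simp add: abs_mult)
    ultimately have "\<bar>green P x\<bar> \<le> variance (D t) * ((K0 + K) / t ^ CARD('n))" by simp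
    also have "\<dots> \<le> (N\<^sup>2 * t\<^sup>2) * ((K0 + K) / t ^ CARD('n))"
      using var(2)[OF t(2)] K0(1) K(1) t0 by (intro mult_right_mono) auto
    also have "\<dots> = K4 / t ^ n" using t0 by (simp add: K4_def dn(2) power2_eq_square)
    finally show ?thesis .
  qed
  define KS where "KS = K0 + K4 / (2 * N * c) + K"
  have KS: "0 \<le> KS" using K0 K K4 N c by (auto simp: KS_def intro!: add_nonneg_nonneg
      divide_nonneg_nonneg)
  have "green (D L) x \<le> of_bool (x = 0) + KS / (L\<^sup>2 * tnorm (lat x) ^ n)" if L: "L0 \<le> L" for L x
  proof -
    define t where "t = tnorm (lat x)"
    have t: "1 \<le> t" unfolding t_def by (rule tnorm_pos)
    have L1: "1 \<le> L" using L L0 by simp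
    have pos: "0 < L\<^sup>2 * t ^ n" using L1 t by simp
    have Kn: "0 \<le> K4 / (2 * N * c)" using K4 N c by simp
    show ?thesis
    proof (cases "t \<le> L")
      case True
      have "L\<^sup>2 * t ^ n \<le> L\<^sup>2 * L ^ n" using True t by (intro mult_left_mono power_mono) auto
      then have "L\<^sup>2 * t ^ n \<le> L ^ CARD('n)" by (simp add: dn(2) power2_eq_square mult.assoc)
      then have "K0 / L ^ CARD('n) \<le> K0 / (L\<^sup>2 * t ^ n)" using K0(1) pos by (intro frac_le) auto
      also have "\<dots> \<le> KS / (L\<^sup>2 * t ^ n)" using pos Kn K(1)
          by (intro divide_right_mono) (auto simp: KS_def)
      finally show ?thesis using K0(2)[OF KD[OF L], of x] unfolding t_def by linarith
    next
      case False
      have x: "x \<noteq> 0" using False L1 by (auto simp: t_def tnorm_def lat_def zero_vec_def[symmetric])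
      have tL0: "L0 \<le> t" using False L by simp
      have "1 / variance (D L) * green P x \<le> \<bar>green P x\<bar> / variance (D L)"
        using var(1)[OF L] by (simp add: divide_right_mono)
      also have "\<dots> \<le> (K4 / t ^ n) / (2 * N * c * L\<^sup>2)"
        using P[OF t_def tL0 x] var(3)[OF L] N c L1 by (intro frac_le) auto
      also have "\<dots> = K4 / (2 * N * c) / (L\<^sup>2 * t ^ n)" by (simp add: mult_ac)
      finally have 1: "1 / variance (D L) * green P x \<le> K4 / (2 * N * c) / (L\<^sup>2 * t ^ n)" .
      have "L * (L * t ^ n) \<le> L * (t * t ^ n)" using False L1 t
          by (intro mult_left_mono mult_right_mono) auto
      then have "L\<^sup>2 * t ^ n \<le> L * t ^ Suc n" by (simp add: power2_eq_square mult.assoc)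
      then have 2: "K / (L * t ^ Suc n) \<le> K / (L\<^sup>2 * t ^ n)" using K(1) pos by (intro frac_le) auto
      have 3: "0 \<le> K0 / (L\<^sup>2 * t ^ n)" using K0(1) pos by simp
      show ?thesis
        using K(2)[OF KD[OF L], of x] 1 2 3
        unfolding dn(1) t_def[symmetric] KS_def add_divide_distrib by linarith
    qed
  qed
  then show ?thesis using K(1) KS K(2)[OF KD] unfolding n_def by (intro exI[of _ K] exI[of _ KS]) auto
qed

section \<open>The nearest-neighbour kernel\<close>

lemma one_minus_cos_lower:
  fixes t :: real
  assumes "\<bar>t\<bar> \<le> pi"
  shows "t\<^sup>2 / (3 * pi\<^sup>2) \<le> 1 - cos t"
proof -
  have q: "u\<^sup>2 / 3 \<le> 1 - cos u" if "0 \<le> u" "u \<le> 1" for u :: real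
  proof -
    have "norm (1 - cos (complex_of_real u) - (complex_of_real u)\<^sup>2 / 2)
        \<le> exp \<bar>Im (complex_of_real u)\<bar> * norm (complex_of_real u) ^ 4 / 6"
      by (rule cos_quartic_bound)
    also have "1 - cos (complex_of_real u) - (complex_of_real u)\<^sup>2 / 2 = of_real (1 - cos u - u\<^sup>2 / 2)"
      by (simp add: cos_of_real)
    finally have "\<bar>1 - cos u - u\<^sup>2 / 2\<bar> \<le> u ^ 4 / 6" using that unfolding norm_of_real by simp
    moreover have "u ^ 4 \<le> u\<^sup>2" using that by (intro power_decreasing) auto
    ultimately show ?thesis by linarith
  qed
  have "1 \<le> pi" using pi_gt3 by simp
  then have pi1: "1 \<le> pi\<^sup>2" by (rule one_le_power)
  have main: "u\<^sup>2 / (3 * pi\<^sup>2) \<le> 1 - cos u" if u: "0 \<le> u" "u \<le> pi" for u :: real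
  proof (cases "u \<le> 1")
    case True
    have "u\<^sup>2 / (3 * pi\<^sup>2) \<le> u\<^sup>2 / 3" using pi1 by (intro divide_left_mono) auto
    then show ?thesis using q[OF u(1) True] by linarith
  next
    case False
    have "u\<^sup>2 \<le> pi\<^sup>2" using u by (intro power_mono) auto
    then have "u\<^sup>2 / (3 * pi\<^sup>2) \<le> 1 / 3" by (simp add: divide_le_eq)
    also have "\<dots> \<le> 1 - cos 1" using q[of 1] by simp
    also have "\<dots> \<le> 1 - cos u" using cos_monotone_0_pi_le[of 1 u] False u by simp
    finally show ?thesis .
  qed
  from main[of "\<bar>t\<bar>"] assms show ?thesis by simp
qed

lemma Re_fourier:
  assumes "\<And>x. x \<notin> lbox L \<Longrightarrow> f x = 0"
  shows "Re (fourier f k) = (\<Sum>x\<in>lbox L. f x * cos (k \<bullet> lat x))"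
  by (subst fourier_lbox[of L, OF assms]) (auto simp: Re_exp)

lemma unit_lattice_vectors:
  "{x :: int ^ 'n::finite. norm (lat x) = 1} = range (\<lambda>i. axis i 1) \<union> range (\<lambda>i. axis i (- 1))"
proof (intro equalityI subsetI)
  fix x :: "int ^ 'n" assume "x \<in> {x. norm (lat x) = 1}"
  then have "(norm (lat x))\<^sup>2 = 1" by simp
  then have "(\<Sum>i\<in>UNIV. real_of_int ((x $ i)\<^sup>2)) = 1"
    unfolding power2_norm_eq_inner inner_vec_def by (simp add: lat_def power2_eq_square)
  then have "real_of_int (\<Sum>i\<in>UNIV. (x $ i)\<^sup>2) = 1" by simp
  then have s1: "(\<Sum>i\<in>UNIV. (x $ i)\<^sup>2) = 1" by (simp only: of_int_eq_1_iff)
  then obtain i where i: "x $ i \<noteq> 0" by (metis (mono_tags, lifting) power_zero_numeral sum.neutral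
      zero_neq_one)
  have "(\<Sum>l\<in>UNIV. (x $ l)\<^sup>2) = (x $ i)\<^sup>2 + (\<Sum>l\<in>UNIV - {i}. (x $ l)\<^sup>2)"
    by (rule sum.remove) auto
  moreover have "0 \<le> (\<Sum>l\<in>UNIV - {i}. (x $ l)\<^sup>2)" by (rule sum_nonneg) simp
  moreover have "1 \<le> (x $ i)\<^sup>2" using i by (simp add: int_one_le_iff_zero_less)
  ultimately have xi: "(x $ i)\<^sup>2 = 1" and z: "(\<Sum>l\<in>UNIV - {i}. (x $ l)\<^sup>2) = 0" using s1 by linarith+
  have zl: "x $ l = 0" if "l \<noteq> i" for l
    using z that by (subst (asm) sum_nonneg_eq_0_iff) auto
  have "x = axis i (x $ i)" using zl by (auto simp: vec_eq_iff axis_def)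
  moreover have "x $ i = 1 \<or> x $ i = - 1" using xi by (simp add: power2_eq_1_iff)
  ultimately show "x \<in> range (\<lambda>i. axis i 1) \<union> range (\<lambda>i. axis i (- 1))" by (metis UnCI rangeI)
next
  fix x :: "int ^ 'n" assume "x \<in> range (\<lambda>i. axis i 1) \<union> range (\<lambda>i. axis i (- 1))"
  moreover have "lat (axis i 1 :: int ^ 'n) = axis i 1" "lat (axis i (- 1) :: int ^ 'n)
      = axis i (- 1)" for i
    by (auto simp: lat_def vec_eq_iff axis_def)
  moreover have "axis i (- 1) = - (axis i 1 :: real ^ 'n)" for i by (simp add: vec_eq_iff axis_def)
  ultimately show "x \<in> {x. norm (lat x) = 1}" by (auto simp: norm_axis_1)
qed

lemma nearest_neighbour_supp:
  "(x :: int ^ 'n::finite) \<notin> lbox 1 \<Longrightarrow> nearest_neighbour_step x = 0"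
proof (rule ccontr)
  assume x: "x \<notin> lbox 1" "nearest_neighbour_step x \<noteq> 0"
  then have "norm (lat x) = 1" by (auto simp: nearest_neighbour_step_def split: if_splits)
  then have "\<bar>lat x $ i\<bar> \<le> 1" for i using component_le_norm_cart[of "lat x" i] by simp
  then show False using x(1) by (simp add: lbox_def lat_def)
qed

lemma sum_nearest_neighbour:
  fixes g :: "int ^ 'n::finite \<Rightarrow> real"
  shows "(\<Sum>x\<in>lbox 1. nearest_neighbour_step x * g x)
    = (\<Sum>i\<in>UNIV. g (axis i 1) + g (axis i (- 1))) / (2 * real CARD('n))"
proof -
  let ?S = "{x :: int ^ 'n. norm (lat x) = 1}"
  have inj: "inj (\<lambda>i::'n. axis i (a::int))" if "a \<noteq> 0" for a using that
      by (auto simp: inj_on_def axis_eq_axis)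
  have "(\<Sum>x\<in>lbox 1. nearest_neighbour_step x * g x) = (\<Sum>x\<in>?S. nearest_neighbour_step x * g x)"
  proof (rule sum.mono_neutral_right)
    show "?S \<subseteq> lbox 1"
    proof
      fix x :: "int ^ 'n" assume "x \<in> ?S"
      then have "nearest_neighbour_step x \<noteq> 0" by (simp add: nearest_neighbour_step_def)
      then show "x \<in> lbox 1" using nearest_neighbour_supp by blast
    qed
  qed (auto simp: nearest_neighbour_step_def)
  also have "\<dots> = (\<Sum>x\<in>?S. g x / (2 * real CARD('n)))"
    by (intro sum.cong refl) (simp add: nearest_neighbour_step_def)
  also have "\<dots> = (\<Sum>x\<in>range (\<lambda>i::'n. axis i (1::int)). g x / (2 * real CARD('n)))
      + (\<Sum>x\<in>range (\<lambda>i::'n. axis i (- 1 :: int)). g x / (2 * real CARD('n)))"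
    unfolding unit_lattice_vectors by (intro sum.union_disjoint) (auto simp: axis_eq_axis)
  also have "\<dots> = (\<Sum>i\<in>(UNIV :: 'n set). g (axis i 1) / (2 * real CARD('n)))
      + (\<Sum>i\<in>(UNIV :: 'n set). g (axis i (- 1)) / (2 * real CARD('n)))"
    by (subst (1 2) sum.reindex[OF inj]) auto
  finally show ?thesis by (simp add: sum.distrib sum_divide_distrib add_divide_distrib)
qed

lemma norm_reflect: "norm (reflect i x) = norm x"
  unfolding norm_eq_sqrt_inner inner_vec_def
  by (intro arg_cong[where f = sqrt] sum.cong) (auto simp: reflect_def)

lemma norm_rotate_plane:
  assumes "i \<noteq> j" shows "norm (rotate_plane i j x) = norm x"
proof -
  let ?t = "\<lambda>l. if l = i then j else if l = j then i else l"
  have "(\<Sum>l\<in>UNIV. rotate_plane i j x $ l * rotate_plane i j x $ l) = (\<Sum>l\<in>UNIV. x $ l * x $ l)"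
    by (rule sum.reindex_bij_witness[of _ ?t ?t]) (use assms in \<open>auto simp: rotate_plane_def\<close>)
  then show ?thesis unfolding norm_eq_sqrt_inner inner_vec_def by simp
qed

lemma nearest_neighbour_kernel:
  "step_kernel 1 (1 / (3 * pi\<^sup>2 * real CARD('n))) 1 (nearest_neighbour_step :: int ^ 'n::finite \<Rightarrow> real)"
  unfolding step_kernel_def
proof (intro conjI allI impI)
  let ?P = "nearest_neighbour_step :: int ^ 'n \<Rightarrow> real"
  have C1: "1 \<le> real CARD('n)" by (simp add: Suc_leI)
  show "0 < 1 / (3 * pi\<^sup>2 * real CARD('n))" by simp
  show "0 \<le> ?P x" for x by (simp add: nearest_neighbour_step_def)
  have "1 / (2 * real CARD('n)) \<le> 1 / 1" by (intro frac_le) (use C1 in linarith)+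
  then show "?P x \<le> 1 / 1 ^ CARD('n)" for x by (simp add: nearest_neighbour_step_def)
  show "?P x = 0" if "x \<notin> lbox 1" for x by (rule nearest_neighbour_supp[OF that])
  show sum1: "(\<Sum>x\<in>lbox 1. ?P x) = 1"
    using sum_nearest_neighbour[of "\<lambda>_ :: int ^ 'n. 1"] by simp
  show "\<exists>u. lattice_symmetric u \<and> ?P = u \<circ> lat"
    by (rule exI[of _ "\<lambda>y. if norm y = 1 then 1 / (2 * real CARD('n)) else 0"])
       (auto simp: lattice_symmetric_def norm_reflect norm_rotate_plane nearest_neighbour_step_def
           fun_eq_iff)
  fix k :: "real ^ 'n" assume k: "\<forall>i. \<bar>k $ i\<bar> \<le> pi"
  have ax: "k \<bullet> lat (axis i 1) = k $ i" "k \<bullet> lat (axis i (- 1)) = - k $ i" for i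
  proof -
    have "lat (axis i 1 :: int ^ 'n) = axis i 1" "lat (axis i (- 1) :: int ^ 'n) = axis i (- 1)"
      by (auto simp: lat_def vec_eq_iff axis_def)
    then show "k \<bullet> lat (axis i 1) = k $ i" "k \<bullet> lat (axis i (- 1)) = - k $ i" by (auto simp: inner_axis)
  qed
  have "1 / (3 * pi\<^sup>2 * real CARD('n)) * min 1 (1\<^sup>2 * (norm k)\<^sup>2)
      \<le> 1 / (3 * pi\<^sup>2 * real CARD('n)) * (norm k)\<^sup>2"
    by (intro mult_left_mono) auto
  also have "1 / (3 * pi\<^sup>2 * real CARD('n)) * (norm k)\<^sup>2
      = (\<Sum>i\<in>UNIV. (k $ i)\<^sup>2 / (3 * pi\<^sup>2)) / real CARD('n)"
  proof -
    have "(norm k)\<^sup>2 = (\<Sum>i\<in>UNIV. (k $ i)\<^sup>2)"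
      unfolding power2_norm_eq_inner inner_vec_def by (simp add: power2_eq_square)
    then show ?thesis by (simp add: sum_divide_distrib)
  qed
  also have "\<dots> \<le> (\<Sum>i\<in>UNIV. 1 - cos (k $ i)) / real CARD('n)"
    using k by (intro divide_right_mono sum_mono one_minus_cos_lower) auto
  also have "\<dots> = 1 - (\<Sum>i\<in>UNIV. cos (k $ i)) / real CARD('n)"
    by (simp add: sum_subtractf diff_divide_distrib)
  also have "(\<Sum>i\<in>UNIV. cos (k $ i)) / real CARD('n) = Re (fourier ?P k)"
  proof -
    have "Re (fourier ?P k) = (\<Sum>x\<in>lbox 1. ?P x * cos (k \<bullet> lat x))"
      by (rule Re_fourier) (rule nearest_neighbour_supp)
    then show ?thesis unfolding sum_nearest_neighbour ax by (simp flip: sum_distrib_left)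
  qed
  finally show "1 / (3 * pi\<^sup>2 * real CARD('n)) * min 1 (1\<^sup>2 * (norm k)\<^sup>2) \<le> 1 - Re (fourier ?P k)" .
qed simp

lemma variance_nearest_neighbour: "variance (nearest_neighbour_step :: int ^ 'n::finite \<Rightarrow> real) = 1"
proof -
  have "variance (nearest_neighbour_step :: int ^ 'n \<Rightarrow> real)
      = (\<Sum>x\<in>lbox 1. (norm (lat (x :: int ^ 'n)))\<^sup>2 * nearest_neighbour_step x)"
    by (rule variance_lbox) (rule nearest_neighbour_supp)
  also have "\<dots> = (\<Sum>x\<in>lbox 1. nearest_neighbour_step (x :: int ^ 'n))"
    by (intro sum.cong refl) (simp add: nearest_neighbour_step_def)
  also have "\<dots> = 1" using nearest_neighbour_kernel[where 'n='n] by (rule kernel_sum)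
  finally show ?thesis .
qed

section \<open>Riemann sums of the profile\<close>

text \<open>
  A point lies in the closure of some piece; outside all frontiers it lies in the open piece
  itself.
\<close>

lemma profile_continuous_ae:
  fixes v :: "real ^ 'n::finite \<Rightarrow> real"
  assumes "mixed_derivative_piecewise_continuous v"
  obtains Z where "closed Z" "negligible Z" "\<And>y. y \<notin> Z \<Longrightarrow> isCont v y"
proof -
  obtain \<U> where U0: "finite \<U>" "\<forall>U\<in>\<U>. open U \<and> connected U \<and> negligible (frontier U)"
      "(\<Union>U\<in>\<U>. closure U) = UNIV"
      "\<forall>U\<in>\<U>. continuous_on U v \<and> (\<exists>w. continuous_on (closure U) w \<and>
          (\<forall>is. distinct is \<and> set is = UNIV \<longrightarrow> has_mixed_partial is v w U))"
    using assms unfolding mixed_derivative_piecewise_continuous_def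
    by (elim exE conjE) (rule that, assumption+)
  have U: "finite \<U>" "\<And>U. U \<in> \<U> \<Longrightarrow> open U" "\<And>U. U \<in> \<U> \<Longrightarrow> negligible (frontier U)"
      "(\<Union>U\<in>\<U>. closure U) = UNIV" "\<And>U. U \<in> \<U> \<Longrightarrow> continuous_on U v"
    using U0(1,3) bspec[OF U0(2)] bspec[OF U0(4)] by simp_all
  show ?thesis
  proof (rule that[of "\<Union>U\<in>\<U>. frontier U"])
    show "closed (\<Union>U\<in>\<U>. frontier U)" using U(1) by (intro closed_UN) auto
    show "negligible (\<Union>U\<in>\<U>. frontier U)" using U(1,3) by (intro negligible_Union) auto
    fix y assume y: "y \<notin> (\<Union>U\<in>\<U>. frontier U)"
    obtain V where V: "V \<in> \<U>" "y \<in> closure V" using U(4) by blast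
    then have "y \<in> interior V" using y by (auto simp: frontier_def)
    then have "y \<in> V" using interior_subset by blast
    then show "isCont v y" using U(2,5) V(1) continuous_on_eq_continuous_at by blast
  qed
qed

text \<open>
  The point \<open>lat (grid_floor L y) / L\<close> is \<open>y\<close> rounded down to the grid of mesh \<open>1 / L\<close>;
  composing with it turns sums over the grid into integrals.
\<close>

definition grid_floor :: "real \<Rightarrow> real ^ 'n \<Rightarrow> int ^ 'n::finite" where
  "grid_floor L y = (\<chi> i. \<lfloor>L * y $ i\<rfloor>)"

lemma emeasure_lattice_cell:
  fixes x :: "int ^ 'n::finite"
  assumes L: "0 < L"
  shows "{y. grid_floor L y = x} \<in> sets borel"
    and "emeasure lborel {y. grid_floor L y = x} = ennreal (1 / L ^ CARD('n))"
proof -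
  define I where "I i = {real_of_int (x $ i) / L..<(real_of_int (x $ i) + 1) / L}" for i
  have eq: "grid_floor L y = x \<longleftrightarrow> (\<forall>i. y $ i \<in> I i)" for y
    using L by (auto simp: grid_floor_def vec_eq_iff I_def floor_eq_iff field_simps)
  have ind: "indicator {y. grid_floor L y = x} y = (\<Prod>i\<in>UNIV. indicator (I i) (y $ i) :: ennreal)" for y
  proof (cases "grid_floor L y = x")
    case False
    then obtain i where "y $ i \<notin> I i" using eq by auto
    then have "(\<Prod>i\<in>UNIV. indicator (I i) (y $ i) :: ennreal) = 0"
      by (intro prod_zero bexI[of _ i]) auto
    then show ?thesis using False by simp
  qed (auto simp: eq)
  have "{y. grid_floor L y = x} = (\<Inter>i. {y. y $ i \<in> I i})" by (auto simp: eq)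
  also have "\<dots> \<in> sets borel"
  proof (intro sets.finite_INT)
    fix i
    have "(\<lambda>y :: real ^ 'n. y $ i) \<in> borel_measurable borel"
      by (intro borel_measurable_continuous_onI continuous_intros)
    then have "(\<lambda>y :: real ^ 'n. y $ i) -` I i \<inter> space borel \<in> sets borel"
      by (rule measurable_sets) (simp add: I_def)
    then show "{y :: real ^ 'n. y $ i \<in> I i} \<in> sets borel" by (simp add: vimage_def)
  qed auto
  finally show S: "{y. grid_floor L y = x} \<in> sets borel" .
  have "emeasure lborel {y. grid_floor L y = x} = (\<integral>\<^sup>+y. indicator {y. grid_floor L y = x} y \<partial>lborel)"
    using S by simp
  also have "\<dots> = (\<integral>\<^sup>+y. (\<Prod>i\<in>UNIV. indicator (I i) (y $ i)) \<partial>lborel)" by (simp only: ind)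
  also have "\<dots> = (\<Prod>i\<in>UNIV. \<integral>\<^sup>+s. indicator (I i) s \<partial>lborel)"
    by (rule nn_integral_lborel_vec_prod) (simp add: I_def)
  also have "\<dots> = (\<Prod>i\<in>(UNIV :: 'n set). ennreal (1 / L))"
  proof (rule prod.cong[OF refl])
    fix i
    have "(\<integral>\<^sup>+s. indicator (I i) s \<partial>lborel) = emeasure lborel (I i)" by (simp add: I_def)
    also have "\<dots> = ennreal ((real_of_int (x $ i) + 1) / L - real_of_int (x $ i) / L)"
      unfolding I_def using L by (intro emeasure_lborel_Ico) (simp add: divide_right_mono)
    finally show "(\<integral>\<^sup>+s. indicator (I i) s \<partial>lborel) = ennreal (1 / L)" by (simp add: add_divide_distrib)
  qed
  also have "\<dots> = ennreal (1 / L ^ CARD('n))" using L by (simp add: ennreal_power power_divide)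
  finally show "emeasure lborel {y. grid_floor L y = x} = ennreal (1 / L ^ CARD('n))" .
qed

lemma riemann_sum_integral:
  fixes F :: "int ^ 'n::finite \<Rightarrow> real"
  assumes L: "0 < L" and F: "\<And>x. x \<notin> lbox M \<Longrightarrow> F x = 0"
  shows "(\<lambda>y. F (grid_floor L y)) \<in> borel_measurable borel"
    and "integral\<^sup>L lborel (\<lambda>y. F (grid_floor L y)) = (\<Sum>x\<in>lbox M. F x) / L ^ CARD('n)"
proof -
  have eq: "(\<lambda>y. F (grid_floor L y)) = (\<lambda>y. \<Sum>x\<in>lbox M. F x * indicator {y. grid_floor L y = x} y)"
  proof
    fix y
    have "(\<Sum>x\<in>lbox M. F x * indicator {y. grid_floor L y = x} y) = (\<Sum>x\<in>lbox M. if x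
        = grid_floor L y then F x else 0)"
      by (intro sum.cong) (auto simp: indicator_def)
    also have "\<dots> = F (grid_floor L y)" using F by (auto simp: sum.delta)
    finally show "F (grid_floor L y) = (\<Sum>x\<in>lbox M. F x * indicator {y. grid_floor L y = x} y)" ..
  qed
  have [measurable]: "{y. grid_floor L y = x} \<in> sets borel" for x :: "int ^ 'n"
    by (rule emeasure_lattice_cell(1)[OF L])
  show "(\<lambda>y. F (grid_floor L y)) \<in> borel_measurable borel" unfolding eq by measurable
  have i: "integrable lborel (indicator {y. grid_floor L y = x} :: _ \<Rightarrow> real)" for x :: "int ^ 'n"
    using emeasure_lattice_cell[OF L, of x] by (intro integrable_real_indicator) auto
  have "integral\<^sup>L lborel (\<lambda>y. F (grid_floor L y))
      = (\<Sum>x\<in>lbox M. F x * measure lborel {y. grid_floor L y = x})"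
    unfolding eq using i by (subst Bochner_Integration.integral_sum) (auto intro: integrable_mult_right)
  also have "\<dots> = (\<Sum>x\<in>lbox M. F x) / L ^ CARD('n)"
  proof -
    have "measure lborel {y. grid_floor L y = x} = 1 / L ^ CARD('n)" for x :: "int ^ 'n"
      using emeasure_lattice_cell(2)[OF L, of x] L by (simp add: measure_def)
    then show ?thesis by (simp add: sum_divide_distrib)
  qed
  finally show "integral\<^sup>L lborel (\<lambda>y. F (grid_floor L y)) = (\<Sum>x\<in>lbox M. F x) / L ^ CARD('n)" .
qed

lemma grid_floor_scaled_tendsto:
  fixes y :: "real ^ 'n::finite" and L :: "nat \<Rightarrow> real"
  assumes L: "filterlim L at_top sequentially" "\<And>n. 1 \<le> L n"
  shows "(\<lambda>n. lat (grid_floor (L n) y) /\<^sub>R L n) \<longlonglongrightarrow> y"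
proof (rule vec_tendstoI)
  fix i
  have "(\<lambda>n. (lat (grid_floor (L n) y) /\<^sub>R L n) $ i - y $ i) \<longlonglongrightarrow> 0"
  proof (rule Lim_null_comparison)
    show "\<forall>\<^sub>F n in sequentially. norm ((lat (grid_floor (L n) y) /\<^sub>R L n) $ i - y $ i) \<le> 1 / L n"
    proof (rule always_eventually, rule allI)
      fix n
      have L1: "0 < L n" using L(2)[of n] by linarith
      have "(lat (grid_floor (L n) y) /\<^sub>R L n) $ i - y $ i = (of_int \<lfloor>L n * y $ i\<rfloor> - L n * y $ i) / L n"
        using L1 by (simp add: lat_def grid_floor_def divide_inverse left_diff_distrib)
      moreover have "\<bar>of_int \<lfloor>L n * y $ i\<rfloor> - L n * y $ i\<bar> \<le> 1" by linarith
      ultimately show "norm ((lat (grid_floor (L n) y) /\<^sub>R L n) $ i - y $ i) \<le> 1 / L n"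
        using L1 by (simp add: divide_right_mono)
    qed
    show "(\<lambda>n. 1 / L n) \<longlonglongrightarrow> 0"
      using tendsto_inverse_0_at_top[OF L(1)] by (simp add: inverse_eq_divide)
  qed
  then show "(\<lambda>n. (lat (grid_floor (L n) y) /\<^sub>R L n) $ i) \<longlonglongrightarrow> y $ i" by (rule LIM_zero_cancel)
qed

lemma spread_out_outside:
  assumes "spread_out_profile v" "\<bar>y $ i\<bar> > 1"
  shows "v y = 0"
proof -
  have "y \<notin> cbox (- 1) 1"
  proof
    assume "y \<in> cbox (- 1) 1"
    then have "- 1 \<le> y $ i" "y $ i \<le> 1" by (auto simp: mem_box_cart)
    then show False using assms(2) by linarith
  qed
  then show ?thesis using assms(1) unfolding spread_out_profile_def by blast
qed

lemma profile_shift_outside: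
  fixes x :: "int ^ 'n::finite"
  assumes v: "spread_out_profile v" and L: "1 \<le> L" and h: "\<And>i. \<bar>h $ i\<bar> \<le> 1" and x: "x \<notin> lbox (2 * L)"
  shows "v (lat x /\<^sub>R L + h) = 0"
proof -
  obtain i where i: "2 * L < \<bar>real_of_int (x $ i)\<bar>" using x by (auto simp: lbox_def not_le)
  then have "2 < \<bar>real_of_int (x $ i)\<bar> / L" using L by (simp add: less_divide_eq)
  moreover have "\<bar>(lat x /\<^sub>R L) $ i\<bar> = \<bar>real_of_int (x $ i)\<bar> / L"
    using L by (simp add: lat_def abs_mult divide_inverse mult.commute)
  ultimately have "1 < \<bar>(lat x /\<^sub>R L + h) $ i\<bar>" using h[of i] by simp
  then show ?thesis by (rule spread_out_outside[OF v])
qed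

lemma grid_floor_in_lbox:
  assumes L: "1 \<le> L" and y: "grid_floor L y \<in> lbox (2 * L)"
  shows "y \<in> cbox (- 3) 3"
proof -
  have "\<bar>y $ i\<bar> \<le> 3" for i
  proof -
    have "\<bar>real_of_int \<lfloor>L * y $ i\<rfloor>\<bar> \<le> 2 * L" using y by (auto simp: lbox_def grid_floor_def)
    then have "\<bar>L * y $ i\<bar> \<le> 2 * L + 1" by linarith
    moreover have "\<bar>L * y $ i\<bar> = L * \<bar>y $ i\<bar>" using L by (simp add: abs_mult)
    ultimately have "L * \<bar>y $ i\<bar> \<le> L * 3" using L by linarith
    then show ?thesis by (rule mult_left_le_imp_le) (use L in linarith)
  qed
  then have "- 3 \<le> y $ i \<and> y $ i \<le> 3" for i by (simp add: abs_le_iff minus_le_iff)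
  then show ?thesis by (simp add: mem_box_cart)
qed

text \<open>
  Both expressions are integrals of functions of the rounded variable. Where \<open>v\<close> is continuous,
  its values at the rounded point and at the translated rounded point tend to the same limit,
  and dominated convergence applies.
\<close>

lemma riemann_sums_converge:
  fixes v :: "real ^ 'n::finite \<Rightarrow> real"
  assumes v: "spread_out_profile v"
    and L: "filterlim L at_top sequentially" "\<And>n::nat. 1 \<le> L n"
    and h: "h \<longlonglongrightarrow> 0" "\<And>n i. \<bar>h n $ i\<bar> \<le> 1"
  shows "(\<lambda>n. (\<Sum>x\<in>lbox (2 * L n). v (lat x /\<^sub>R L n)) / L n ^ CARD('n)) \<longlonglongrightarrow> 1"
    and "(\<lambda>n. (\<Sum>x\<in>lbox (2 * L n). \<bar>v (lat x /\<^sub>R L n + h n) - v (lat x /\<^sub>R L n)\<bar>) / L n ^ CARD('n)) \<longlonglongrightarrow> 0"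
proof -
  note v' = v[unfolded spread_out_profile_def]
  obtain Z where Z: "closed Z" "negligible Z" "\<And>y. y \<notin> Z \<Longrightarrow> isCont v y"
    using profile_continuous_ae v' by blast
  have ZS: "Z \<in> sets borel" using Z(1) by (rule borel_closed)
  have "Z \<in> null_sets lborel"
    using Z(2) ZS null_sets_completion_iff[of Z lborel] by (simp add: negligible_iff_null_sets)
  then have AEZ: "AE y in lborel. y \<notin> Z" by (rule AE_not_in)
  obtain B where B: "\<And>y. \<bar>v y\<bar> \<le> B"
  proof -
    have "bounded (range v)" using v' by blast
    then obtain B where "\<forall>x\<in>range v. norm x \<le> B" unfolding bounded_iff by blast
    then show ?thesis using that[of B] by simp
  qed
  have B0: "0 \<le> B" using B[of 0] by linarith
  \<comment> \<open>The profile is Borel measurable only up to the null set \<open>Z\<close>.\<close>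
  define w where "w y = indicator (- Z) y *\<^sub>R v y" for y
  have wm: "w \<in> borel_measurable borel"
    unfolding w_def using ZS Z(3)
    by (intro borel_measurable_continuous_on_indicator continuous_at_imp_continuous_on) auto
  have dom: "integrable lborel (\<lambda>y :: real ^ 'n. 2 * B * indicator (cbox (- 3) 3) y)"
    by (intro integrable_mult_right integrable_real_indicator) (simp_all add:
        emeasure_lborel_cbox_finite[unfolded infinity_ennreal_def])
  have hout: "v (lat x /\<^sub>R L n + h n) = 0" "v (lat x /\<^sub>R L n) = 0" if "x \<notin> lbox (2 * L n)" for x n
    using profile_shift_outside[OF v L(2) h(2) that] profile_shift_outside[OF v L(2) _ that, of 0]
        by auto
  have lim: "(\<lambda>n. v (lat (grid_floor (L n) y) /\<^sub>R L n + h n)) \<longlonglongrightarrow> v y"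
       "(\<lambda>n. v (lat (grid_floor (L n) y) /\<^sub>R L n)) \<longlonglongrightarrow> v y" if "y \<notin> Z" for y
  proof -
    note t = grid_floor_scaled_tendsto[OF L, of y]
    have "(\<lambda>n. lat (grid_floor (L n) y) /\<^sub>R L n + h n) \<longlonglongrightarrow> y" using tendsto_add[OF t h(1)] by simp
    then show "(\<lambda>n. v (lat (grid_floor (L n) y) /\<^sub>R L n + h n)) \<longlonglongrightarrow> v y"
        by (rule isCont_tendsto_compose[OF Z(3)[OF that]])
    show "(\<lambda>n. v (lat (grid_floor (L n) y) /\<^sub>R L n)) \<longlonglongrightarrow> v y"
        by (rule isCont_tendsto_compose[OF Z(3)[OF that] t])
  qed
  have L0: "0 < L n" for n using L(2)[of n] by linarith
  define F where "F n x = v (lat x /\<^sub>R L n)" for n and x :: "int ^ 'n"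
  define G where "G n x = \<bar>v (lat x /\<^sub>R L n + h n) - v (lat x /\<^sub>R L n)\<bar>" for n and x :: "int ^ 'n"
  have FG: "\<And>x n. x \<notin> lbox (2 * L n) \<Longrightarrow> F n x = 0" "\<And>x n. x \<notin> lbox (2 * L n) \<Longrightarrow> G n x = 0"
    using hout by (auto simp: F_def G_def)
  have Fb: "\<bar>F n x\<bar> \<le> 2 * B" "\<bar>G n x\<bar> \<le> 2 * B" for n x
    using B[of "lat x /\<^sub>R L n"] B[of "lat x /\<^sub>R L n + h n"] B0 unfolding F_def G_def by linarith+
  have bnd: "norm (H n (grid_floor (L n) y)) \<le> 2 * B * indicator (cbox (- 3) 3) y"
    if H: "\<And>x n. x \<notin> lbox (2 * L n) \<Longrightarrow> H n x = 0" "\<And>n x. \<bar>H n x\<bar> \<le> 2 * B"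
    for H :: "nat \<Rightarrow> int ^ 'n \<Rightarrow> real" and n y
  proof (cases "grid_floor (L n) y \<in> lbox (2 * L n)")
    case True
    then have "y \<in> cbox (- 3) 3" by (rule grid_floor_in_lbox[OF L(2)])
    then show ?thesis using H(2)[of n "grid_floor (L n) y"] by simp
  qed (use H(1) B0 in simp)
  have "(\<lambda>n. integral\<^sup>L lborel (\<lambda>y. F n (grid_floor (L n) y))) \<longlonglongrightarrow> integral\<^sup>L lborel w"
  proof (rule integral_dominated_convergence[OF _ _ dom])
    show "AE y in lborel. (\<lambda>n. F n (grid_floor (L n) y)) \<longlonglongrightarrow> w y"
      using AEZ by eventually_elim (use lim(2) in \<open>simp add: F_def w_def\<close>)
    show "AE y in lborel. norm (F n (grid_floor (L n) y)) \<le> 2 * B * indicator (cbox (- 3) 3) y" for n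
      by (rule AE_I2) (rule bnd[OF FG(1) Fb(1)])
    show "(\<lambda>y. F n (grid_floor (L n) y)) \<in> borel_measurable lborel" for n
      using riemann_sum_integral(1)[OF L0, of _ "F n"] FG(1) by simp
  qed (use wm in simp)
  moreover have "integral\<^sup>L lborel w = 1"
  proof -
    have wv: "(w has_integral 1) (cbox (- 1) 1)"
      using v' by (intro has_integral_spike[OF Z(2) _ , of "cbox (- 1) 1" w v 1]) (auto simp: w_def)
    have "(\<lambda>y. if y \<in> cbox (- 1) 1 then w y else 0) = w"
      using v' by (auto simp: w_def fun_eq_iff)
    then have wU: "(w has_integral 1) UNIV"
      using wv has_integral_restrict_UNIV[of "cbox (- 1) 1" w 1] by simp
    have "integrable lborel w"
    proof (rule Bochner_Integration.integrable_bound[OF dom])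
      show "AE y in lborel. norm (w y) \<le> norm (2 * B * indicator (cbox (- 3) 3) y)"
      proof (rule AE_I2)
        fix y
        show "norm (w y) \<le> norm (2 * B * indicator (cbox (- 3) 3) y)"
        proof (cases "y \<in> cbox (- 3) 3")
          case True
          then show ?thesis using B[of y] B0 by (auto simp: w_def indicator_def)
        next
          case False
          then obtain i where "\<not> (- 3 \<le> y $ i \<and> y $ i \<le> 3)" by (auto simp: mem_box_cart)
          then have "1 < \<bar>y $ i\<bar>" by linarith
          then show ?thesis using spread_out_outside[OF v] by (simp add: w_def)
        qed
      qed
    qed (use wm in simp)
    then have "(w has_integral integral\<^sup>L lborel w) UNIV" by (rule has_integral_integral_lborel)
    then show ?thesis using wU has_integral_unique by blast
  qed
  moreover have "integral\<^sup>L lborel (\<lambda>y. F n (grid_floor (L n) y))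
      = (\<Sum>x\<in>lbox (2 * L n). F n x) / L n ^ CARD('n)" for n
    by (rule riemann_sum_integral(2)[OF L0]) (rule FG(1))
  ultimately show "(\<lambda>n. (\<Sum>x\<in>lbox (2 * L n). v (lat x /\<^sub>R L n)) / L n ^ CARD('n)) \<longlonglongrightarrow> 1"
    unfolding F_def by simp
  have "(\<lambda>n. integral\<^sup>L lborel (\<lambda>y. G n (grid_floor (L n) y)))
      \<longlonglongrightarrow> integral\<^sup>L lborel (\<lambda>y :: real ^ 'n. 0 :: real)"
  proof (rule integral_dominated_convergence[OF _ _ dom])
    show "AE y in lborel. (\<lambda>n. G n (grid_floor (L n) y)) \<longlonglongrightarrow> 0"
      using AEZ
    proof eventually_elim
      case (elim y)
      from tendsto_rabs[OF tendsto_diff[OF lim[OF elim]]]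
      show ?case by (simp add: G_def)
    qed
    show "AE y in lborel. norm (G n (grid_floor (L n) y)) \<le> 2 * B * indicator (cbox (- 3) 3) y" for n
      by (rule AE_I2) (rule bnd[OF FG(2) Fb(2)])
    show "(\<lambda>y. G n (grid_floor (L n) y)) \<in> borel_measurable lborel" for n
      using riemann_sum_integral(1)[OF L0, of _ "G n"] FG(2) by simp
  qed simp
  moreover have "integral\<^sup>L lborel (\<lambda>y. G n (grid_floor (L n) y))
      = (\<Sum>x\<in>lbox (2 * L n). G n x) / L n ^ CARD('n)" for n
    by (rule riemann_sum_integral(2)[OF L0]) (rule FG(2))
  ultimately show "(\<lambda>n. (\<Sum>x\<in>lbox (2 * L n). \<bar>v (lat x /\<^sub>R L n
      + h n) - v (lat x /\<^sub>R L n)\<bar>) / L n ^ CARD('n)) \<longlonglongrightarrow> 0"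
    unfolding G_def by simp
qed

lemma profile_sum_lower:
  fixes v :: "real ^ 'n::finite \<Rightarrow> real"
  assumes v: "spread_out_profile v"
  shows "\<exists>L1\<ge>1. \<forall>L\<ge>L1. L ^ CARD('n) / 2 \<le> (\<Sum>x\<in>lbox (2 * L). v (lat x /\<^sub>R L))"
proof (rule ccontr)
  assume neg: "\<not> ?thesis"
  have "\<exists>L\<ge>real n + 1. (\<Sum>x\<in>lbox (2 * L). v (lat x /\<^sub>R L)) < L ^ CARD('n) / 2" for n
    using neg by (metis add_increasing le_add_same_cancel2 not_le of_nat_0_le_iff order_refl)
  then obtain L where L: "\<And>n. real n + 1 \<le> L n" "\<And>n. (\<Sum>x\<in>lbox (2 * L n). v (lat x /\<^sub>R L n))
      < L n ^ CARD('n) / 2"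
    by metis
  have L1: "1 \<le> L n" for n using L(1)[of n] by linarith
  have top: "filterlim L at_top sequentially"
    by (rule filterlim_at_top_mono[OF filterlim_real_sequentially], rule always_eventually, rule allI)
       (use L(1) in \<open>smt (verit)\<close>)
  have "(\<lambda>n. (\<Sum>x\<in>lbox (2 * L n). v (lat x /\<^sub>R L n)) / L n ^ CARD('n)) \<longlonglongrightarrow> 1"
    by (rule riemann_sums_converge(1)[OF v top L1, of "\<lambda>_. 0"]) auto
  moreover have "(\<Sum>x\<in>lbox (2 * L n). v (lat x /\<^sub>R L n)) / L n ^ CARD('n) \<le> 1 / 2" for n
  proof -
    have "0 < L n ^ CARD('n)" using L1[of n] by simp
    then show ?thesis using L(2)[of n] by (simp add: divide_le_eq)
  qed
  ultimately have "1 \<le> (1 / 2 :: real)" by (intro LIMSEQ_le_const2) auto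
  then show False by simp
qed

text \<open>
  A failure for all \<open>\<tau> = 1 / (n + 1)\<close> would give scales tending to infinity and translations
  tending to zero along which the translation error does not vanish.
\<close>

lemma profile_translation_small:
  fixes v :: "real ^ 'n::finite \<Rightarrow> real"
  assumes v: "spread_out_profile v"
  shows "\<exists>\<tau> L2. 0 < \<tau> \<and> \<tau> \<le> 1 \<and> 1 \<le> L2 \<and> (\<forall>L\<ge>L2. \<forall>j. \<forall>m. 0 \<le> m \<and> m \<le> \<tau> * L \<longrightarrow>
    (\<Sum>x\<in>lbox (2 * L). \<bar>v (lat x /\<^sub>R L + (m / L) *\<^sub>R axis j 1) - v (lat x /\<^sub>R L)\<bar>) \<le> L ^ CARD('n) / 4)"
proof (rule ccontr)
  assume neg: "\<not> ?thesis"
  define R where "R n L j m \<longleftrightarrow> real n + 1 \<le> L \<and> 0 \<le> m \<and> m \<le> 1 / (real n + 1) * L \<and>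
      L ^ CARD('n) / 4 < (\<Sum>x\<in>lbox (2 * L). \<bar>v (lat x /\<^sub>R L + (m / L) *\<^sub>R axis j 1) - v (lat x /\<^sub>R L)\<bar>)"
    for n :: nat and L and j :: 'n and m
  have "\<exists>L j m. R n L j m" for n
  proof (rule ccontr)
    assume nR: "\<not> (\<exists>L j m. R n L j m)"
    have "0 < 1 / (real n + 1) \<and> 1 / (real n + 1) \<le> 1 \<and> 1 \<le> real n + 1 \<and> (\<forall>L\<ge>real n + 1. \<forall>j. \<forall>m. 0
        \<le> m \<and> m \<le> 1 / (real n + 1) * L \<longrightarrow>
      (\<Sum>x\<in>lbox (2 * L). \<bar>v (lat x /\<^sub>R L + (m / L) *\<^sub>R axis j 1) - v (lat x /\<^sub>R L)\<bar>) \<le> L ^ CARD('n) / 4)"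
    proof (intro conjI allI impI)
      fix L and j :: 'n and m assume "real n + 1 \<le> L" "0 \<le> m \<and> m \<le> 1 / (real n + 1) * L"
      moreover have "\<not> R n L j m" using nR by blast
      ultimately show "(\<Sum>x\<in>lbox (2 * L). \<bar>v (lat x /\<^sub>R L + (m / L) *\<^sub>R axis j 1) - v (lat x /\<^sub>R L)\<bar>)
          \<le> L ^ CARD('n) / 4"
        unfolding R_def not_less[symmetric] by blast
    qed auto
    then show False by - (rule notE[OF neg], intro exI, assumption)
  qed
  then obtain L j m where Rn: "\<And>n. R n (L n) (j n) (m n)" by metis
  have L: "real n + 1 \<le> L n" and m: "0 \<le> m n" "m n \<le> 1 / (real n + 1) * L n"
    and big: "L n ^ CARD('n) / 4 < (\<Sum>x\<in>lbox (2 * L n). \<bar>v (lat x /\<^sub>R L n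
        + (m n / L n) *\<^sub>R axis (j n) 1) - v (lat x /\<^sub>R L n)\<bar>)" for n
    using Rn[of n] unfolding R_def by blast+
  have L1: "1 \<le> L n" for n using L[of n] by linarith
  have top: "filterlim L at_top sequentially"
    by (rule filterlim_at_top_mono[OF filterlim_real_sequentially], rule always_eventually, rule allI)
       (use L in \<open>smt (verit)\<close>)
  define h where "h n = (m n / L n) *\<^sub>R axis (j n) (1::real)" for n
  have mL: "0 \<le> m n / L n" "m n / L n \<le> 1 / (real n + 1)" for n
    using m[of n] L1[of n] by (auto simp: divide_le_eq)
  have nh: "norm (h n) \<le> 1 / (real n + 1)" for n using mL[of n] by (simp add: h_def norm_axis_1)
  have h0: "h \<longlonglongrightarrow> 0"
  proof (rule Lim_null_comparison)
    show "\<forall>\<^sub>F n in sequentially. norm (h n) \<le> inverse (real (Suc n))"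
      by (rule always_eventually) (use nh in \<open>simp add: inverse_eq_divide add.commute\<close>)
  qed (rule LIMSEQ_inverse_real_of_nat)
  have h1: "\<bar>h n $ i\<bar> \<le> 1" for n i
  proof -
    have "\<bar>h n $ i\<bar> \<le> norm (h n)" by (rule component_le_norm_cart)
    also have "\<dots> \<le> 1 / (real n + 1)" by (rule nh)
    also have "\<dots> \<le> 1" by simp
    finally show ?thesis .
  qed
  have "(\<lambda>n. (\<Sum>x\<in>lbox (2 * L n). \<bar>v (lat x /\<^sub>R L n + h n) - v (lat x /\<^sub>R L n)\<bar>) / L n ^ CARD('n)) \<longlonglongrightarrow> 0"
    by (rule riemann_sums_converge(2)[OF v top L1 h0 h1])
  moreover have "1 / 4 \<le> (\<Sum>x\<in>lbox (2 * L n). \<bar>v (lat x /\<^sub>R L n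
      + h n) - v (lat x /\<^sub>R L n)\<bar>) / L n ^ CARD('n)" for n
  proof -
    have "0 < L n ^ CARD('n)" using L1[of n] by simp
    then show ?thesis using big[of n] by (simp add: h_def le_divide_eq)
  qed
  ultimately have "(1 / 4 :: real) \<le> 0" by (intro LIMSEQ_le_const) auto
  then show False by simp
qed

section \<open>The spread-out kernel\<close>

lemma lbox_mono: "L \<le> M \<Longrightarrow> lbox L \<subseteq> lbox M"
  by (auto simp: lbox_def intro: order_trans)

text \<open>
  Translating \<open>D\<close> by \<open>m\<close> steps multiplies its transform by a phase, which is at distance at
  least \<open>1\<close> from \<open>1\<close> since its argument lies between \<open>\<pi>/2\<close> and \<open>\<pi>\<close> in modulus; but the
  translation changes \<open>D\<close> by at most \<open>1/2\<close> in \<open>\<ell>\<^sup>1\<close>.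
\<close>

lemma fourier_half_bound:
  fixes D :: "int ^ 'n::finite \<Rightarrow> real"
  assumes supp: "\<And>x. x \<notin> lbox L \<Longrightarrow> D x = 0" and m: "real m \<le> L" "pi / 2
      \<le> real m * \<bar>k $ j\<bar>" "real m * \<bar>k $ j\<bar> \<le> pi"
    and small: "(\<Sum>x\<in>lbox (2 * L). \<bar>D (x + axis j (int m)) - D x\<bar>) \<le> 1 / 2"
  shows "norm (fourier D k) \<le> 1 / 2"
proof -
  let ?e = "axis j (int m) :: int ^ 'n"
  have latp: "lat (x + ?e) = lat x + axis j (real m)" for x by (auto simp: lat_def vec_eq_iff axis_def)
  have L0: "0 \<le> L" using m(1) by simp
  let ?E = "\<lambda>x. exp (\<i> * of_real (k \<bullet> lat x)) :: complex"
  define \<theta> where "\<theta> = k $ j * real m"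
  have Ep: "?E (x + ?e) = exp (\<i> * of_real \<theta>) * ?E x" for x
    by (simp add: latp inner_add_right inner_axis \<theta>_def distrib_left exp_add mult_ac)
  have F1: "fourier D k = (\<Sum>x\<in>lbox L. of_real (D x) * ?E x)" by (rule fourier_lbox) (rule supp)
  have F2: "fourier D k = (\<Sum>x\<in>lbox (2 * L). of_real (D x) * ?E x)"
    unfolding F1 using lbox_mono[of L "2 * L"] L0 supp by (intro sum.mono_neutral_left) auto
  have sub: "(\<lambda>x. x - ?e) ` lbox L \<subseteq> lbox (2 * L)"
  proof
    fix y assume "y \<in> (\<lambda>x. x - ?e) ` lbox L"
    then obtain x where x: "x \<in> lbox L" "y = x - ?e" by blast
    have "\<bar>real_of_int (y $ i)\<bar> \<le> 2 * L" for i
    proof -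
      have "\<bar>real_of_int (?e $ i)\<bar> \<le> L" using m(1) L0 by (simp add: axis_def)
      moreover have "\<bar>real_of_int (x $ i)\<bar> \<le> L" using x(1) by (simp add: lbox_def)
      ultimately show ?thesis unfolding x(2) by simp
    qed
    then show "y \<in> lbox (2 * L)" by (simp add: lbox_def)
  qed
  have "(\<Sum>x\<in>lbox (2 * L). of_real (D (x + ?e)) * ?E (x + ?e))
      = (\<Sum>x\<in>(\<lambda>x. x - ?e) ` lbox L. of_real (D (x + ?e)) * ?E (x + ?e))"
  proof (rule sum.mono_neutral_right[OF finite_lbox sub], rule ballI)
    fix x assume x: "x \<in> lbox (2 * L) - (\<lambda>x. x - ?e) ` lbox L"
    have "x + ?e \<notin> lbox L"
    proof
      assume "x + ?e \<in> lbox L"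
      then have "(x + ?e) - ?e \<in> (\<lambda>x. x - ?e) ` lbox L" by (rule imageI)
      then show False using x by simp
    qed
    then show "of_real (D (x + ?e)) * ?E (x + ?e) = 0" using supp by simp
  qed
  also have "\<dots> = fourier D k" unfolding F1 by (subst sum.reindex) (auto simp: inj_on_def)
  finally have F3: "exp (\<i> * of_real \<theta>) * (\<Sum>x\<in>lbox (2 * L). of_real (D (x + ?e)) * ?E x) = fourier D k"
    unfolding Ep by (simp add: sum_distrib_left mult_ac)
  define S where "S = (\<Sum>x\<in>lbox (2 * L). of_real (D (x + ?e)) * ?E x)"
  have nS: "norm (fourier D k) = norm S" unfolding F3[symmetric] S_def[symmetric]
      by (simp add: norm_mult)
  have "S - fourier D k = (\<Sum>x\<in>lbox (2 * L). of_real (D (x + ?e) - D x) * ?E x)"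
    unfolding S_def F2 by (simp add: sum_subtractf left_diff_distrib)
  also have "norm \<dots> \<le> (\<Sum>x\<in>lbox (2 * L). norm (of_real (D (x + ?e) - D x) * ?E x))" by (rule norm_sum)
  also have "\<dots> = (\<Sum>x\<in>lbox (2 * L). \<bar>D (x + ?e) - D x\<bar>)"
    by (intro sum.cong refl) (simp add: norm_mult del: of_real_diff)
  also have "\<dots> \<le> 1 / 2" by (rule small)
  finally have d: "norm (S - fourier D k) \<le> 1 / 2" .
  have eq: "S - fourier D k = (1 - exp (\<i> * of_real \<theta>)) * S"
    using F3 by (simp add: S_def left_diff_distrib)
  have "1 \<le> norm (1 - exp (\<i> * of_real \<theta>))"
  proof -
    have "\<bar>\<theta>\<bar> = real m * \<bar>k $ j\<bar>" by (simp add: \<theta>_def abs_mult mult.commute)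
    then have "cos \<bar>\<theta>\<bar> \<le> cos (pi / 2)" using m by (intro cos_monotone_0_pi_le) auto
    then have "cos \<theta> \<le> 0" by simp
    then have "1 \<le> Re (1 - exp (\<i> * of_real \<theta>))" by (simp add: Re_exp)
    then show ?thesis using complex_Re_le_cmod order_trans by blast
  qed
  then have "1 * norm S \<le> norm (1 - exp (\<i> * of_real \<theta>)) * norm S" by (intro mult_right_mono) auto
  then show ?thesis using d unfolding eq nS norm_mult by linarith
qed

text \<open>
  One doubling costs a factor \<open>4\<close>, as it would for \<open>|k|\<^sup>2\<close>, because \<open>1 - cos 2t = 2 (1 - cos t)
  (1 + cos t)\<close>.
\<close>

lemma infrared_doubling:
  assumes D: "\<And>x. 0 \<le> D x" and supp: "\<And>x. x \<notin> lbox L \<Longrightarrow> D x = 0"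
  shows "(\<Sum>x\<in>lbox L. D x) - Re (fourier D ((2 ^ n) *\<^sub>R k))
      \<le> 4 ^ n * ((\<Sum>x\<in>lbox L. D x) - Re (fourier D k))"
proof -
  have f: "(\<Sum>x\<in>lbox L. D x) - Re (fourier D k) = (\<Sum>x\<in>lbox L. D x * (1 - cos (k \<bullet> lat x)))" for k
    by (subst Re_fourier[of L]) (auto simp: supp right_diff_distrib sum_subtractf)
  have two: "1 - cos (2 * t) \<le> 4 * (1 - cos t)" for t :: real
  proof -
    have "1 - cos (2 * t) = 2 * (1 - cos t) * (1 + cos t)"
      unfolding cos_double_cos by (simp add: algebra_simps power2_eq_square)
    also have "\<dots> \<le> 2 * (1 - cos t) * 2" by (intro mult_left_mono) auto
    finally show ?thesis by simp
  qed
  show ?thesis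
  proof (induction n)
    case (Suc n)
    have "(\<Sum>x\<in>lbox L. D x) - Re (fourier D ((2 ^ Suc n) *\<^sub>R k))
        = (\<Sum>x\<in>lbox L. D x * (1 - cos (2 * (((2 ^ n) *\<^sub>R k) \<bullet> lat x))))"
      unfolding f by (simp add: mult.assoc)
    also have "\<dots> \<le> (\<Sum>x\<in>lbox L. D x * (4 * (1 - cos (((2 ^ n) *\<^sub>R k) \<bullet> lat x))))"
      by (intro sum_mono mult_left_mono two D)
    also have "\<dots> = 4 * ((\<Sum>x\<in>lbox L. D x) - Re (fourier D ((2 ^ n) *\<^sub>R k)))"
      unfolding f by (simp add: sum_distrib_left mult_ac)
    also have "\<dots> \<le> 4 * (4 ^ n * ((\<Sum>x\<in>lbox L. D x) - Re (fourier D k)))" using Suc.IH by simp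
    finally show ?case by simp
  qed simp
qed

lemma multiple_in_half_period:
  fixes t :: real
  assumes "0 < t" "t \<le> pi"
  obtains m :: nat where "pi / 2 \<le> real m * t" "real m * t \<le> pi"
proof -
  define m where "m = nat \<lceil>(pi / 2) / t\<rceil>"
  have nn: "0 \<le> (pi / 2) / t" using assms by simp
  have m1: "(pi / 2) / t \<le> real m" "real m < (pi / 2) / t + 1" using nn unfolding m_def by linarith+
  have lo: "pi / 2 \<le> real m * t" using m1(1) assms by (simp add: divide_le_eq)
  have "real m * t \<le> pi"
  proof (cases "t \<le> pi / 2")
    case True
    have "real m * t \<le> ((pi / 2) / t + 1) * t" using m1(2) assms by (intro mult_right_mono) auto
    also have "\<dots> = pi / 2 + t" using assms by (simp add: distrib_right)
    finally show ?thesis using True by simp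
  next
    case False
    then have "(pi / 2) / t \<le> 1" using assms by (simp add: divide_le_eq)
    then have "\<lceil>(pi / 2) / t\<rceil> \<le> 1" by (simp add: ceiling_le_iff)
    then have "m \<le> 1" unfolding m_def by simp
    then have "real m * t \<le> 1 * t" using assms by (intro mult_right_mono) auto
    then show ?thesis using assms by linarith
  qed
  then show ?thesis using lo that by blast
qed

text \<open>
  The vector \<open>k\<close> is doubled until its largest component \<open>q\<close> exceeds \<open>M / L\<close>, where the transform
  is at most \<open>1/2\<close>. This takes \<open>n\<close> steps with \<open>2\<^sup>n q \<le> 2 M / L\<close>, so the factor \<open>4\<^sup>-\<^sup>n\<close> that is
  lost is at least a multiple of \<open>(L q)\<^sup>2\<close>.
\<close>

lemma infrared_bound_from_half_bound:
  fixes D :: "int ^ 'n::finite \<Rightarrow> real" and L M :: real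
  assumes D: "\<And>x. 0 \<le> D x" and supp: "\<And>x. x \<notin> lbox L \<Longrightarrow> D x = 0" and sum1: "(\<Sum>x\<in>lbox L. D x) = 1"
    and L: "0 < L" and M: "0 < M" "2 * M \<le> pi * L"
    and half: "\<And>k j. M / L \<le> \<bar>k $ j\<bar> \<Longrightarrow> \<bar>k $ j\<bar> \<le> pi \<Longrightarrow> norm (fourier D k) \<le> 1 / 2"
    and k: "\<And>i. \<bar>k $ i\<bar> \<le> pi"
  shows "min (1 / 2) (1 / (8 * M\<^sup>2 * (real CARD('n))\<^sup>2)) * min 1 (L\<^sup>2 * (norm k)\<^sup>2)
      \<le> 1 - Re (fourier D k)"
proof -
  define N where "N = real CARD('n)"
  define c where "c = min (1 / 2) (1 / (8 * M\<^sup>2 * N\<^sup>2))"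
  have N: "1 \<le> N" by (simp add: N_def Suc_leI)
  have c: "0 < c" "c \<le> 1 / 2" "c \<le> 1 / (8 * M\<^sup>2 * N\<^sup>2)" using N M by (auto simp: c_def)
  have half': "1 / 2 \<le> 1 - Re (fourier D k)" if "M / L \<le> \<bar>k $ j\<bar>" "\<bar>k $ j\<bar> \<le> pi" for k j
    using half[OF that] complex_Re_le_cmod[of "fourier D k"] by linarith
  have dbl: "1 - Re (fourier D ((2 ^ n) *\<^sub>R k)) \<le> 4 ^ n * (1 - Re (fourier D k))" for n
  proof -
    have "(\<Sum>x\<in>lbox L. D x) - Re (fourier D ((2 ^ n) *\<^sub>R k))
        \<le> 4 ^ n * ((\<Sum>x\<in>lbox L. D x) - Re (fourier D k))"
      by (rule infrared_doubling) (rule D, rule supp)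
    then show ?thesis by (simp add: sum1)
  qed
  obtain j where j: "\<And>i. \<bar>k $ i\<bar> \<le> \<bar>k $ j\<bar>" "norm k \<le> N * \<bar>k $ j\<bar>"
    using max_component[of k] unfolding N_def by blast
  define q where "q = \<bar>k $ j\<bar>"
  have "c * min 1 (L\<^sup>2 * (norm k)\<^sup>2) \<le> 1 - Re (fourier D k)"
  proof (cases "q = 0")
    case True
    then have "k = 0" using j(2) by (simp add: q_def)
    then have "fourier D k = 1" using sum1 by (subst fourier_lbox[of L]) (auto simp: supp simp flip:
        of_real_sum)
    then show ?thesis using \<open>k = 0\<close> by simp
  next
    case False
    then have q: "0 < q" by (simp add: q_def)
    obtain n0 where "M / L / q < 2 ^ n0" using real_arch_pow[of 2 "M / L / q"] by auto
    then have "M / L < 2 ^ n0 * q" by (simp only: pos_divide_less_eq[OF q])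
    \<comment> \<open>The condition \<open>2 M \<le> \<pi> L\<close> keeps the doubled vector in the torus.\<close>
    then have ex: "\<exists>n. M / L \<le> 2 ^ n * q" by (intro exI less_imp_le)
    define n where "n = (LEAST n. M / L \<le> 2 ^ n * q)"
    have n: "M / L \<le> 2 ^ n * q" unfolding n_def by (rule LeastI_ex[OF ex])
    show ?thesis
    proof (cases n)
      case 0
      then have "1 / 2 \<le> 1 - Re (fourier D k)" using n k[of j]
          by (intro half'[of k j]) (auto simp: q_def)
      moreover have "c * min 1 (L\<^sup>2 * (norm k)\<^sup>2) \<le> 1 / 2 * 1" using c by (intro mult_mono) auto
      ultimately show ?thesis by simp
    next
      case (Suc n')
      have "\<not> M / L \<le> 2 ^ n' * q" using not_less_Least[of n' "\<lambda>n. M / L \<le> 2 ^ n * q"] Suc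
          unfolding n_def by simp
      then have up: "2 ^ n * q \<le> 2 * M / L" unfolding Suc by simp
      also have "\<dots> \<le> pi" using M L by (simp add: divide_le_eq)
      finally have "2 ^ n * q \<le> pi" .
      then have "1 / 2 \<le> 1 - Re (fourier D ((2 ^ n) *\<^sub>R k))"
        using n by (intro half'[of _ j]) (auto simp: q_def abs_mult)
      then have f: "1 / 2 \<le> 4 ^ n * (1 - Re (fourier D k))" using dbl[of n] by linarith
      have four: "(4::real) ^ n = (2 ^ n)\<^sup>2" by (simp add: power_mult[symmetric] power2_eq_square
          flip: power_mult_distrib)
      have "(2 ^ n * q)\<^sup>2 \<le> (2 * M / L)\<^sup>2" using up q by (intro power_mono) auto
      then have "4 ^ n * q\<^sup>2 \<le> 4 * M\<^sup>2 / L\<^sup>2" by (simp add: four power_mult_distrib power_divide)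
      then have a: "4 ^ n * (L\<^sup>2 * q\<^sup>2) \<le> 4 * M\<^sup>2" using L by (simp add: le_divide_eq mult_ac)
      have kq: "(norm k)\<^sup>2 \<le> N\<^sup>2 * q\<^sup>2" using power_mono[OF j(2), of 2]
          by (simp add: q_def power_mult_distrib)
      have "c * min 1 (L\<^sup>2 * (norm k)\<^sup>2) \<le> 1 / (8 * M\<^sup>2 * N\<^sup>2) * (L\<^sup>2 * (N\<^sup>2 * q\<^sup>2))"
        using c kq by (intro mult_mono order_trans[OF min.cobounded2] mult_left_mono) auto
      also have "\<dots> = L\<^sup>2 * q\<^sup>2 / (8 * M\<^sup>2)" using N by simp
      also have "\<dots> \<le> 1 - Re (fourier D k)"
      proof -
        have "4 ^ n * (L\<^sup>2 * q\<^sup>2 / (8 * M\<^sup>2)) = 4 ^ n * (L\<^sup>2 * q\<^sup>2) / (8 * M\<^sup>2)" by simp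
        also have "\<dots> \<le> 4 * M\<^sup>2 / (8 * M\<^sup>2)" using a by (intro divide_right_mono) auto
        also have "\<dots> = 1 / 2" using M by simp
        finally have "4 ^ n * (L\<^sup>2 * q\<^sup>2 / (8 * M\<^sup>2)) \<le> 1 / 2" .
        then have "4 ^ n * (L\<^sup>2 * q\<^sup>2 / (8 * M\<^sup>2)) \<le> 4 ^ n * (1 - Re (fourier D k))" using f by linarith
        then show ?thesis by (rule mult_left_le_imp_le) simp
      qed
      finally show ?thesis .
    qed
  qed
  then show ?thesis unfolding c_def N_def .
qed

lemma spread_out_kernel:
  fixes v :: "real ^ 'n::finite \<Rightarrow> real"
  assumes v: "spread_out_profile v"
  shows "\<exists>b c L0. 0 < c \<and> 1 \<le> L0 \<and> (\<forall>L\<ge>L0. profile_sum v L \<noteq> 0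
      \<and> step_kernel b c L (spread_out_step v L))"
proof -
  note v' = v[unfolded spread_out_profile_def]
  obtain L1 where L1: "1 \<le> L1" "\<And>L. L1 \<le> L \<Longrightarrow> L ^ CARD('n) / 2 \<le> (\<Sum>x\<in>lbox (2 * L). v (lat x /\<^sub>R L))"
    using profile_sum_lower[OF v] by blast
  obtain \<tau> L2 where \<tau>: "0 < \<tau>" "\<tau> \<le> 1" "1 \<le> L2"
    and tr: "\<And>L j m. L2 \<le> L \<Longrightarrow> 0 \<le> m \<and> m \<le> \<tau> * L \<Longrightarrow>
      (\<Sum>x\<in>lbox (2 * L). \<bar>v (lat x /\<^sub>R L + (m / L) *\<^sub>R axis j 1) - v (lat x /\<^sub>R L)\<bar>) \<le> L ^ CARD('n) / 4"
    using profile_translation_small[OF v] by blast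
  have "bounded (range v)" using v' by blast
  then obtain B where "\<forall>x\<in>range v. norm x \<le> B" unfolding bounded_iff by blast
  then have B: "v y \<le> B" for y using abs_ge_self[of "v y"] by (auto intro: order_trans)
  have vnn: "0 \<le> v y" for y using v' by blast
  have B0: "0 \<le> B" using B[of 0] vnn[of 0] by linarith
  define M where "M = pi / \<tau>"
  have M: "0 < M" using \<tau> by (simp add: M_def)
  define c where "c = min (1 / 2) (1 / (8 * M\<^sup>2 * (real CARD('n))\<^sup>2))"
  \<comment> \<open>The bound \<open>2 / \<tau>\<close> ensures \<open>2 M \<le> \<pi> L\<close>.\<close>
  define L0 where "L0 = max (max L1 L2) (2 / \<tau>)"
  have c: "0 < c" using M by (simp add: c_def)
  have "profile_sum v L \<noteq> 0 \<and> step_kernel (2 * B) c L (spread_out_step v L)" if L: "L0 \<le> L" for L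
  proof -
    have LL: "L1 \<le> L" "L2 \<le> L" "2 / \<tau> \<le> L" "1 \<le> L" using L L1(1) by (auto simp: L0_def)
    define S where "S = profile_sum v L"
    define D where "D = spread_out_step v L"
    have Dx: "D x = v (lat x /\<^sub>R L) / S" for x by (simp add: D_def S_def spread_out_step_def)
    have vout: "v (lat x /\<^sub>R L) = 0" if out: "x \<notin> lbox L" for x :: "int ^ 'n"
    proof -
      obtain i where "L < \<bar>real_of_int (x $ i)\<bar>" using out by (auto simp: lbox_def not_le)
      then have "1 < \<bar>real_of_int (x $ i)\<bar> / L" using LL by (simp add: less_divide_eq)
      then have "1 < \<bar>(lat x /\<^sub>R L) $ i\<bar>" using LL
          by (simp add: lat_def abs_mult divide_inverse mult.commute)
      then show ?thesis by (rule spread_out_outside[OF v])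
    qed
    have SL: "S = (\<Sum>x\<in>lbox L. v (lat x /\<^sub>R L))"
    proof -
      have "S = (\<Sum>\<^sub>\<infinity>x\<in>lbox L. v (lat x /\<^sub>R L))"
        unfolding S_def profile_sum_def by (rule infsum_cong_neutral) (use vout in auto)
      then show ?thesis by simp
    qed
    have "S = (\<Sum>x\<in>lbox (2 * L). v (lat x /\<^sub>R L))"
      unfolding SL using lbox_mono[of L "2 * L"] LL vout by (intro sum.mono_neutral_left) auto
    then have S: "L ^ CARD('n) / 2 \<le> S" using L1(2)[OF LL(1)] by simp
    have Ld: "0 < L ^ CARD('n)" using LL by simp
    have S0: "0 < S" using S Ld by linarith
    have supp: "D x = 0" if "x \<notin> lbox L" for x using vout[OF that] by (simp add: Dx)
    have Dnn: "0 \<le> D x" for x using vnn S0 by (simp add: Dx)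
    have sum1: "(\<Sum>x\<in>lbox L. D x) = 1" using S0 by (simp add: Dx SL flip: sum_divide_distrib)
    have half: "norm (fourier D k) \<le> 1 / 2" if k: "M / L \<le> \<bar>k $ j\<bar>" "\<bar>k $ j\<bar> \<le> pi" for k j
    proof -
      have k0: "0 < \<bar>k $ j\<bar>" using k(1) M LL by (meson divide_pos_pos less_le_trans zero_less_one)
      obtain m :: nat where m: "pi / 2 \<le> real m * \<bar>k $ j\<bar>" "real m * \<bar>k $ j\<bar> \<le> pi"
        using multiple_in_half_period[OF k0 k(2)] by blast
      have "real m * (M / L) \<le> real m * \<bar>k $ j\<bar>" using k(1) by (intro mult_left_mono) auto
      then have "real m * (M / L) \<le> pi" using m(2) by linarith
      then have "real m * pi \<le> pi * (\<tau> * L)" using LL \<tau> by (simp add: M_def divide_le_eq mult_ac)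
      then have mt: "real m \<le> \<tau> * L" by (simp add: mult.commute[of "real m"])
      also have "\<dots> \<le> 1 * L" using \<tau> LL by (intro mult_right_mono) auto
      finally have mL: "real m \<le> L" by simp
      have sh: "lat (x + axis j (int m)) /\<^sub>R L = lat x /\<^sub>R L + (real m / L) *\<^sub>R axis j 1" for x
        by (auto simp: lat_def vec_eq_iff axis_def divide_inverse distrib_left mult.commute)
      have "(\<Sum>x\<in>lbox (2 * L). \<bar>D (x + axis j (int m)) - D x\<bar>)
          = (\<Sum>x\<in>lbox (2 * L). \<bar>v (lat x /\<^sub>R L + (real m / L) *\<^sub>R axis j 1) - v (lat x /\<^sub>R L)\<bar>) / S"
        unfolding Dx sh sum_divide_distrib using S0
            by (intro sum.cong refl) (simp flip: diff_divide_distrib)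
      also have "\<dots> \<le> (L ^ CARD('n) / 4) / (L ^ CARD('n) / 2)"
        using tr[OF LL(2), of "real m" j] mt S Ld by (intro frac_le) auto
      also have "\<dots> = 1 / 2" using LL(4) by simp
      finally show ?thesis by (intro fourier_half_bound[of L D m k j] supp mL m)
    qed
    have "step_kernel (2 * B) c L D"
      unfolding step_kernel_def
    proof (intro conjI allI impI)
      show "1 \<le> L" by (rule LL)
      show "0 < c" by (rule c)
      show "0 \<le> D x" for x by (rule Dnn)
      show "D x \<le> 2 * B / L ^ CARD('n)" for x
      proof -
        have "D x \<le> B / (L ^ CARD('n) / 2)" unfolding Dx using B B0 vnn S Ld by (intro frac_le) auto
        then show ?thesis by (simp add: mult.commute)
      qed
      show "x \<notin> lbox L \<Longrightarrow> D x = 0" for x by (rule supp)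
      show "(\<Sum>x\<in>lbox L. D x) = 1" by (rule sum1)
      have r: "reflect i y /\<^sub>R L = reflect i (y /\<^sub>R L)" "rotate_plane i j y /\<^sub>R L
          = rotate_plane i j (y /\<^sub>R L)" for i j and y :: "real ^ 'n"
        by (auto simp: reflect_def rotate_plane_def vec_eq_iff)
      have "lattice_symmetric v" using v' by blast
      then have "lattice_symmetric (\<lambda>y. v (y /\<^sub>R L) / S)" unfolding lattice_symmetric_def r by simp
      moreover have "D = (\<lambda>y. v (y /\<^sub>R L) / S) \<circ> lat" by (simp add: fun_eq_iff Dx)
      ultimately show "\<exists>u. lattice_symmetric u \<and> D = u \<circ> lat" by blast
      fix k :: "real ^ 'n" assume k: "\<forall>i. \<bar>k $ i\<bar> \<le> pi"
      have "2 * M \<le> pi * L" using LL(3) \<tau> by (simp add: M_def divide_le_eq mult_ac)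
      then show "c * min 1 (L\<^sup>2 * (norm k)\<^sup>2) \<le> 1 - Re (fourier D k)"
        unfolding c_def using LL k M by (intro infrared_bound_from_half_bound[OF Dnn supp sum1]
            half) auto
    qed
    then show ?thesis using S0 by (simp add: S_def D_def)
  qed
  moreover have "1 \<le> L0" using L1(1) by (simp add: L0_def)
  ultimately show ?thesis using c by blast
qed

section \<open>Conclusion\<close>

theorem proposition1p2:
  fixes v :: "real ^ 'n::finite \<Rightarrow> real"
  assumes "CARD('n) > 2"
    and "spread_out_profile v"
  shows "\<exists>L0\<ge>1. (\<forall>L\<ge>L0. profile_sum v L \<noteq> 0) \<and>
    (\<forall>\<epsilon>>0. \<exists>K KS. \<forall>L\<ge>L0. \<forall>x::int ^ 'n.
       \<bar>green (spread_out_step v L) x - of_bool (x = 0)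
          - 1 / variance (spread_out_step v L) * green nearest_neighbour_step x\<bar>
         \<le> K / (L powr (1 - \<epsilon>) * tnorm (lat x) ^ (CARD('n) - 1)) \<and>
       green (spread_out_step v L) x
         \<le> of_bool (x = 0) + KS * L powr (- (2 - \<epsilon>)) / tnorm (lat x) ^ (CARD('n) - 2))"
proof -
  obtain b c L0 where c: "0 < c" and L0: "1 \<le> L0"
    and D: "\<And>L. L0 \<le> L \<Longrightarrow> profile_sum v L \<noteq> 0" "\<And>L. L0 \<le> L \<Longrightarrow> step_kernel b c L (spread_out_step v L)"
    using spread_out_kernel[OF assms(2)] by blast
  obtain K KS where K: "0 \<le> K" "0 \<le> KS"
    and est: "\<And>L (x :: int ^ 'n). L0 \<le> L \<Longrightarrow>
      \<bar>green (spread_out_step v L) x - of_bool (x = 0) - 1 / variance (spread_out_step v L) * green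
          nearest_neighbour_step x\<bar>
        \<le> K / (L * tnorm (lat x) ^ (CARD('n) - 1)) \<and>
      green (spread_out_step v L) x \<le> of_bool (x = 0) + KS / (L\<^sup>2 * tnorm (lat x) ^ (CARD('n) - 2))"
    using green_estimates[OF assms(1) nearest_neighbour_kernel variance_nearest_neighbour c L0 D(2)]
        by blast
  have "\<bar>green (spread_out_step v L) x - of_bool (x = 0)
          - 1 / variance (spread_out_step v L) * green nearest_neighbour_step x\<bar>
         \<le> K / (L powr (1 - \<epsilon>) * tnorm (lat x) ^ (CARD('n) - 1)) \<and>
       green (spread_out_step v L) x
         \<le> of_bool (x = 0) + KS * L powr (- (2 - \<epsilon>)) / tnorm (lat x) ^ (CARD('n) - 2)"
    if \<epsilon>: "0 < \<epsilon>" and L: "L0 \<le> L" for \<epsilon> L :: real and x :: "int ^ 'n"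
  proof -
    define t where "t = tnorm (lat x)"
    have t: "0 < t" by (simp add: t_def tnorm_pos)
    have L1: "1 \<le> L" using L L0 by linarith
    have "L powr (1 - \<epsilon>) \<le> L powr 1" using L1 \<epsilon> by (intro powr_mono) auto
    then have "L powr (1 - \<epsilon>) * t ^ (CARD('n) - 1) \<le> L * t ^ (CARD('n) - 1)"
      using L1 t by (intro mult_right_mono) auto
    then have 1: "K / (L * t ^ (CARD('n) - 1)) \<le> K / (L powr (1 - \<epsilon>) * t ^ (CARD('n) - 1))"
      using K(1) L1 t by (intro frac_le) auto
    have "1 / L\<^sup>2 = L powr (- 2)" using L1 by (simp add: powr_minus inverse_eq_divide)
    also have "\<dots> \<le> L powr (- (2 - \<epsilon>))" using L1 \<epsilon> by (intro powr_mono) auto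
    finally have "KS * (1 / L\<^sup>2) / t ^ (CARD('n) - 2) \<le> KS * L powr (- (2 - \<epsilon>)) / t ^ (CARD('n) - 2)"
      using K(2) t by (intro divide_right_mono mult_left_mono) auto
    then have 2: "KS / (L\<^sup>2 * t ^ (CARD('n) - 2)) \<le> KS * L powr (- (2 - \<epsilon>)) / t ^ (CARD('n) - 2)" by simp
    show ?thesis using est[OF L, of x] 1 2 unfolding t_def by linarith
  qed
  then show ?thesis using L0 D(1) by (intro exI[of _ L0] conjI allI impI exI[of _ K] exI[of _ KS]) auto
qed

end
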